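(* Let $d\in\{1,2\}$, $\varepsilon\ge 0$ and $T>0$. Assume that $f\in L^2(\mathbb{R}^d)$ and $\boldsymbol{U}\in L^p(0,T;\mathbb{R}^d)$ with $1\le p\le +\infty$. Then for every $\hat\mu_{\varepsilon,0}\in D(A_\varepsilon)$ there is a unique solution $$\hat\mu_\varepsilon\in C^0([0,T];D(A_\varepsilon))\cap W^{1,p}(0,T;L^2(\mathbb{R}^d))$$ of $$\frac{d\hat\mu_{\varepsilon}}{dt}(t)=A_\varepsilon\hat\mu_{\varepsilon}(t)-\hat g(t)\quad\text{in } L^2(\mathbb{R}^d),\ \text{for a.e. } t\in(0,T),$$ such that $\hat\mu_\varepsilon(0)=\hat\mu_{\varepsilon,0}$. Moreover, $\hat\mu_\varepsilon$ is given by Duhamel's formula: for all $t\in[0,T]$ and almost every $\boldsymbol\kappa\in\mathbb{R}^d$, $$\hat\mu_{\boldsymbol\kappa,\varepsilon}(t)=\hat\mu_{\boldsymbol\kappa,\varepsilon}(0)e^{i\omega_{\boldsymbol\kappa,\varepsilon}t}-\int_0^t e^{i\omega_{\boldsymbol\kappa,\varepsilon}(t-\tau)}\hat g_{\boldsymbol\kappa}(\tau)\,d\tau .$$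
   Context: Constants: $0<\rho_1<\rho_2$ (densities), $h_1,h_2>0$ (layer thicknesses), $g>0$ (gravitational acceleration). $L^2(\mathbb{R}^d)=L^2(\mathbb{R}^d;\mathbb{C})$, and $|\cdot|_2$ is the Euclidean norm. For $\boldsymbol\kappa\in\mathbb{R}^d\setminus\{0\}$ set $$T_{j,\boldsymbol\kappa}=\rho_j\coth(2\pi|\boldsymbol\kappa|_2h_j)\ (j=1,2),\qquad \omega_{\boldsymbol\kappa}=\sqrt{\frac{2\pi|\boldsymbol\kappa|_2(\rho_2-\rho_1)g}{T_{1,\boldsymbol\kappa}+T_{2,\boldsymbol\kappa}}},\qquad \omega_{\boldsymbol\kappa,\varepsilon}=\omega_{\boldsymbol\kappa}+i\varepsilon .$$ The Fourier transform is $\hat f_{\boldsymbol\kappa}=\int_{\mathbb{R}^d}f(\boldsymbol x)e^{-2\pi i\boldsymbol\kappa\cdot\boldsymbol x}d\boldsymbol x$ (extended to $L^2$). Given the ship velocity $\boldsymbol U$, the ship position is $X(t)=\int_0^t\boldsymbol U(s)\,ds$, and the source term $\hat g(t):\boldsymbol\kappa\mapsto\hat g_{\boldsymbol\kappa}(t)$ is $$\hat g_{\boldsymbol\kappa}(t)=\frac{2\pi\rho_1\, i\,\boldsymbol\kappa\cdot\boldsymbol U(t)\,e^{-2\pi i\boldsymbol\kappa\cdot X(t)}\hat f_{\boldsymbol\kappa}}{\sinh(2\pi|\boldsymbol\kappa|_2h_1)(T_{1,\boldsymbol\kappa}+T_{2,\boldsymbol\kappa})}.$$ $A_\varepsilon$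 is the unbounded multiplication operator on $L^2(\mathbb{R}^d)$ given by $(A_\varepsilon b)_{\boldsymbol\kappa}=i\omega_{\boldsymbol\kappa,\varepsilon}b_{\boldsymbol\kappa}$ with domain $D(A_\varepsilon)=\{b\in L^2(\mathbb{R}^d): \int_{\mathbb{R}^d}(\omega_{\boldsymbol\kappa}^2+\varepsilon^2)|b_{\boldsymbol\kappa}|^2d\boldsymbol\kappa<+\infty\}$, endowed with the Hilbert norm $b\mapsto\left(\int_{\mathbb{R}^d}(1+\omega_{\boldsymbol\kappa}^2+\varepsilon^2)|b_{\boldsymbol\kappa}|^2d\boldsymbol\kappa\right)^{1/2}$. A function with values in $L^2(\mathbb{R}^d)$ is written $\hat\mu_\varepsilon(t):\boldsymbol\kappa\mapsto\hat\mu_{\boldsymbol\kappa,\varepsilon}(t)$. *)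

theory Defs
  imports "HOL-Analysis.Analysis"
begin

definition square_integrable :: "('a::euclidean_space \<Rightarrow> complex) \<Rightarrow> bool" where
  "square_integrable f \<longleftrightarrow>
     f \<in> borel_measurable lebesgue \<and> integrable lebesgue (\<lambda>x. (cmod (f x))\<^sup>2)"

lemma square_integrable_zero: "square_integrable (\<lambda>x. 0)"
  by (simp add: square_integrable_def)

lemma square_integrable_measurable:
  "square_integrable f \<Longrightarrow> f \<in> borel_measurable lebesgue"
  by (simp add: square_integrable_def)

lemma square_integrable_bound:
  fixes f :: "'a::euclidean_space \<Rightarrow> complex"
  assumes "f \<in> borel_measurable lebesgue" "integrable lebesgue h" "\<And>x. (cmod (f x))\<^sup>2 \<le> h x"
  shows "square_integrable f"
  unfolding square_integrable_def
proof
  show "integrable lebesgue (\<lambda>x. (cmod (f x))\<^sup>2)"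
  proof (rule Bochner_Integration.integrable_bound[OF assms(2)])
    show "(\<lambda>x. (cmod (f x))\<^sup>2) \<in> borel_measurable lebesgue"
      using assms(1) by measurable
    show "AE x in lebesgue. norm ((cmod (f x))\<^sup>2) \<le> norm (h x)"
    proof (rule AE_I2)
      fix x show "norm ((cmod (f x))\<^sup>2) \<le> norm (h x)"
        using assms(3)[of x] by simp
    qed
  qed
qed fact

lemma norm_add_square_le: "(cmod (a + b))\<^sup>2 \<le> 2 * (cmod a)\<^sup>2 + 2 * (cmod b)\<^sup>2"
proof -
  have "(cmod (a + b))\<^sup>2 \<le> (cmod a + cmod b)\<^sup>2"
    by (intro power_mono norm_triangle_ineq) auto
  also have "\<dots> \<le> 2 * (cmod a)\<^sup>2 + 2 * (cmod b)\<^sup>2"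
    using sum_squares_bound[of "cmod a" "cmod b"] by (simp add: power2_sum)
  finally show ?thesis .
qed

lemma square_integrable_add:
  assumes "square_integrable f" "square_integrable g"
  shows "square_integrable (\<lambda>x. f x + g x)"
proof (rule square_integrable_bound)
  show "(\<lambda>x. f x + g x) \<in> borel_measurable lebesgue"
    using assms[THEN square_integrable_measurable] by measurable
  show "integrable lebesgue (\<lambda>x. 2 * (cmod (f x))\<^sup>2 + 2 * (cmod (g x))\<^sup>2)"
    using assms by (simp add: square_integrable_def)
qed (rule norm_add_square_le)

lemma square_integrable_cmult:
  assumes "square_integrable f"
  shows "square_integrable (\<lambda>x. c * f x)"
  using assms unfolding square_integrable_def
  by (intro conjI borel_measurable_times borel_measurable_const) (simp_all add: norm_mult power_mult_distrib)

lemma square_integrable_uminus: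
  assumes "square_integrable f"
  shows "square_integrable (\<lambda>x. - f x)"
  using square_integrable_cmult[OF assms, of "-1"] by simp

lemma square_integrable_diff:
  assumes "square_integrable f" "square_integrable g"
  shows "square_integrable (\<lambda>x. f x - g x)"
  using square_integrable_add[OF assms(1) square_integrable_uminus[OF assms(2)]] by simp

lemma integrable_mult_cnj:
  assumes "square_integrable f" "square_integrable g"
  shows "integrable lebesgue (\<lambda>x. f x * cnj (g x))"
proof (rule Bochner_Integration.integrable_bound)
  show "integrable lebesgue (\<lambda>x. (cmod (f x))\<^sup>2 + (cmod (g x))\<^sup>2)"
    using assms by (simp add: square_integrable_def)
  show "(\<lambda>x. f x * cnj (g x)) \<in> borel_measurable lebesgue"
  proof (rule borel_measurable_times)
    have "cnj \<in> borel_measurable borel"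
      by (intro borel_measurable_continuous_onI continuous_intros)
    then show "(\<lambda>x. cnj (g x)) \<in> borel_measurable lebesgue"
      using square_integrable_measurable[OF assms(2)] by measurable
  qed (rule square_integrable_measurable[OF assms(1)])
  have "cmod (f x * cnj (g x)) \<le> (cmod (f x))\<^sup>2 + (cmod (g x))\<^sup>2" for x
  proof -
    have "0 \<le> cmod (f x) * cmod (g x)" by simp
    moreover have "2 * (cmod (f x) * cmod (g x)) \<le> (cmod (f x))\<^sup>2 + (cmod (g x))\<^sup>2"
      using sum_squares_bound[of "cmod (f x)" "cmod (g x)"] by (simp add: mult.assoc)
    ultimately have "cmod (f x) * cmod (g x) \<le> (cmod (f x))\<^sup>2 + (cmod (g x))\<^sup>2"
      by linarith
    then show ?thesis by (simp add: norm_mult)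
  qed
  then show "AE x in lebesgue. norm (f x * cnj (g x)) \<le> norm ((cmod (f x))\<^sup>2 + (cmod (g x))\<^sup>2)"
    by simp
qed

lemma integrable_Re_mult_cnj:
  assumes "square_integrable f" "square_integrable g"
  shows "integrable lebesgue (\<lambda>x. Re (f x * cnj (g x)))"
  using integrable_mult_cnj[OF assms] by (rule integrable_Re)

text \<open>
  The space \<open>L\<^sup>2\<close> of complex-valued functions modulo equality almost everywhere. The type is a
  separable Banach space, so Bochner integration and strong (= Borel) measurability of
  \<open>L\<^sup>2\<close>-valued functions are those of the library. The inner product below is the real one,
  \<open>Re (\<integral> f (cnj g))\<close>; it induces the usual norm. \<open>rep_L2 b\<close> is an arbitrary representative of
  the class \<open>b\<close>.
\<close>

quotient_type (overloaded) 'a L2 = "'a::euclidean_space \<Rightarrow> complex" / partial: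
  "\<lambda>f g. square_integrable f \<and> square_integrable g \<and> (AE x in lebesgue. f x = g x)"
proof (rule part_equivpI)
  show "\<exists>f::'a \<Rightarrow> complex. square_integrable f \<and> square_integrable f \<and> (AE x in lebesgue. f x = f x)"
    using square_integrable_zero by auto
next
  show "symp (\<lambda>f g :: 'a \<Rightarrow> complex. square_integrable f \<and> square_integrable g \<and> (AE x in lebesgue. f x = g x))"
    by (rule sympI) (simp add: eq_commute)
next
  show "transp (\<lambda>f g :: 'a \<Rightarrow> complex. square_integrable f \<and> square_integrable g \<and> (AE x in lebesgue. f x = g x))"
  proof (rule transpI)
    fix f g h :: "'a \<Rightarrow> complex"
    assume *: "square_integrable f \<and> square_integrable g \<and> (AE x in lebesgue. f x = g x)"
      "square_integrable g \<and> square_integrable h \<and> (AE x in lebesgue. g x = h x)"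
    then have "AE x in lebesgue. f x = g x" "AE x in lebesgue. g x = h x" by simp_all
    then have "AE x in lebesgue. f x = h x" by eventually_elim simp
    with * show "square_integrable f \<and> square_integrable h \<and> (AE x in lebesgue. f x = h x)" by simp
  qed
qed

instantiation L2 :: (euclidean_space) real_inner
begin

lift_definition zero_L2 :: "'a L2" is "\<lambda>x. 0"
  by (simp add: square_integrable_zero)

lift_definition plus_L2 :: "'a L2 \<Rightarrow> 'a L2 \<Rightarrow> 'a L2" is "\<lambda>f g x. f x + g x"
  by (auto intro!: square_integrable_add)

lift_definition uminus_L2 :: "'a L2 \<Rightarrow> 'a L2" is "\<lambda>f x. - f x"
  by (auto intro!: square_integrable_uminus)

lift_definition minus_L2 :: "'a L2 \<Rightarrow> 'a L2 \<Rightarrow> 'a L2" is "\<lambda>f g x. f x - g x"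
  by (auto intro!: square_integrable_diff)

lift_definition scaleR_L2 :: "real \<Rightarrow> 'a L2 \<Rightarrow> 'a L2" is "\<lambda>c f x. of_real c * f x"
  by (auto intro!: square_integrable_cmult)

lift_definition inner_L2 :: "'a L2 \<Rightarrow> 'a L2 \<Rightarrow> real" is
  "\<lambda>f g. LINT x|lebesgue. Re (f x * cnj (g x))"
proof -
  fix f f' g g' :: "'a \<Rightarrow> complex"
  assume f: "square_integrable f \<and> square_integrable f' \<and> (AE x in lebesgue. f x = f' x)"
    and g: "square_integrable g \<and> square_integrable g' \<and> (AE x in lebesgue. g x = g' x)"
  show "(LINT x|lebesgue. Re (f x * cnj (g x))) = (LINT x|lebesgue. Re (f' x * cnj (g' x)))"
  proof (rule integral_cong_AE)
    have "AE x in lebesgue. f x = f' x" "AE x in lebesgue. g x = g' x" using f g by auto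
    then show "AE x in lebesgue. Re (f x * cnj (g x)) = Re (f' x * cnj (g' x))"
      by eventually_elim simp
  qed (use f g integrable_Re_mult_cnj[of f g] integrable_Re_mult_cnj[of f' g'] in
       \<open>simp_all only: borel_measurable_integrable\<close>)
qed

definition norm_L2 :: "'a L2 \<Rightarrow> real" where "norm_L2 x = sqrt (inner x x)"
definition dist_L2 :: "'a L2 \<Rightarrow> 'a L2 \<Rightarrow> real" where "dist_L2 x y = norm (x - y)"
definition sgn_L2 :: "'a L2 \<Rightarrow> 'a L2" where "sgn_L2 x = inverse (norm x) *\<^sub>R x"
definition uniformity_L2 :: "('a L2 \<times> 'a L2) filter" where
  "uniformity_L2 = (INF e\<in>{0 <..}. principal {(x, y). dist x y < e})"
definition open_L2 :: "'a L2 set \<Rightarrow> bool" where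
  "open_L2 U = (\<forall>x\<in>U. eventually (\<lambda>(x', y). x' = x \<longrightarrow> y \<in> U) uniformity)"

instance
proof
  fix x y z :: "'a L2" and r s :: real and U :: "'a L2 set"
  show "x + y + z = x + (y + z)"
    by transfer (auto intro!: square_integrable_add simp: add.assoc)
  show "x + y = y + x"
    by transfer (auto intro!: square_integrable_add simp: add.commute)
  show "0 + x = x"
    by transfer auto
  show "- x + x = 0"
    by transfer (auto simp: square_integrable_zero)
  show "x - y = x + - y"
    by transfer (auto intro!: square_integrable_diff)
  show "r *\<^sub>R (x + y) = r *\<^sub>R x + r *\<^sub>R y"
    by transfer (auto intro!: square_integrable_add square_integrable_cmult simp: distrib_left)
  show "(r + s) *\<^sub>R x = r *\<^sub>R x + s *\<^sub>R x"
    by transfer (auto intro!: square_integrable_add square_integrable_cmult simp: distrib_right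
        of_real_add)
  show "r *\<^sub>R s *\<^sub>R x = (r * s) *\<^sub>R x"
    by transfer (auto intro!: square_integrable_cmult simp: mult.assoc)
  show "1 *\<^sub>R x = x"
    by transfer auto
  show "dist x y = norm (x - y)" by (simp add: dist_L2_def)
  show "sgn x = inverse (norm x) *\<^sub>R x" by (simp add: sgn_L2_def)
  show "uniformity = (INF e\<in>{0 <..}. principal {(x::'a L2, y). dist x y < e})"
    by (simp add: uniformity_L2_def)
  show "open U = (\<forall>x\<in>U. \<forall>\<^sub>F (x', y) in uniformity. x' = x \<longrightarrow> y \<in> U)"
    by (simp add: open_L2_def)
  show "norm x = sqrt (inner x x)" by (simp add: norm_L2_def)
  show "inner x y = inner y x"
  proof transfer
    fix f g :: "'a \<Rightarrow> complex"
    have "(\<lambda>x. Re (f x * cnj (g x))) = (\<lambda>x. Re (g x * cnj (f x)))"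
      by (auto simp: fun_eq_iff)
    then show "(LINT x|lebesgue. Re (f x * cnj (g x))) = (LINT x|lebesgue. Re (g x * cnj (f x)))"
      by simp
  qed
  show "inner (x + y) z = inner x z + inner y z"
  proof transfer
    fix f g h :: "'a \<Rightarrow> complex"
    assume "square_integrable f \<and> square_integrable f \<and> (AE x in lebesgue. f x = f x)"
      "square_integrable g \<and> square_integrable g \<and> (AE x in lebesgue. g x = g x)"
      "square_integrable h \<and> square_integrable h \<and> (AE x in lebesgue. h x = h x)"
    then have "integrable lebesgue (\<lambda>x. Re (f x * cnj (h x)))" "integrable lebesgue (\<lambda>x. Re (g x * cnj (h x)))"
      using integrable_Re_mult_cnj[of f h] integrable_Re_mult_cnj[of g h] by (simp_all only:)
    from Bochner_Integration.integral_add[OF this, symmetric]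
    show "(LINT x|lebesgue. Re ((f x + g x) * cnj (h x))) =
       (LINT x|lebesgue. Re (f x * cnj (h x))) + (LINT x|lebesgue. Re (g x * cnj (h x)))"
      by (simp add: algebra_simps)
  qed
  show "inner (r *\<^sub>R x) y = r * inner x y"
  proof transfer
    fix r :: real and f g :: "'a \<Rightarrow> complex"
    have "(\<lambda>x. Re (of_real r * f x * cnj (g x))) = (\<lambda>x. r * Re (f x * cnj (g x)))"
      by (auto simp: fun_eq_iff algebra_simps)
    then show "(LINT x|lebesgue. Re (of_real r * f x * cnj (g x))) = r * (LINT x|lebesgue. Re (f x * cnj (g x)))"
      by simp
  qed
  show "0 \<le> inner x x"
    unfolding inner_L2.rep_eq by (intro Bochner_Integration.integral_nonneg) simp
  show "(inner x x = 0) = (x = 0)"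
  proof transfer
    fix f :: "'a \<Rightarrow> complex"
    assume "square_integrable f \<and> square_integrable f \<and> (AE x in lebesgue. f x = f x)"
    then have f: "square_integrable f" by blast
    have "((LINT x|lebesgue. Re (f x * cnj (f x))) = 0) = (AE x in lebesgue. Re (f x * cnj (f x)) = 0)"
      by (rule integral_nonneg_eq_0_iff_AE[OF integrable_Re_mult_cnj[OF f f]]) simp
    also have "\<dots> = (AE x in lebesgue. f x = 0)"
      by (intro AE_cong) (simp add: complex_mult_cnj complex_eq_iff sum_power2_eq_zero_iff)
    finally show "((LINT x|lebesgue. Re (f x * cnj (f x))) = 0) =
        (square_integrable f \<and> square_integrable (\<lambda>x. 0) \<and> (AE x in lebesgue. f x = 0))"
      using f square_integrable_zero by auto
  qed
qed

end

lemma square_integrable_rep_L2: "square_integrable (rep_L2 x)"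
  using Quotient3_rep_reflp[OF Quotient3_L2] by blast

lemma abs_L2_eq_iff:
  assumes "square_integrable f" "square_integrable g"
  shows "abs_L2 f = abs_L2 g \<longleftrightarrow> (AE x in lebesgue. f x = g x)"
  using Quotient3_rel[OF Quotient3_L2, of f g] assms by simp

lemma abs_rep_L2 [simp]: "abs_L2 (rep_L2 x) = x"
  by (rule Quotient3_abs_rep[OF Quotient3_L2])

lemma rep_abs_L2:
  assumes "square_integrable f"
  shows "AE x in lebesgue. rep_L2 (abs_L2 f) x = f x"
  using abs_L2_eq_iff[OF square_integrable_rep_L2 assms, of "abs_L2 f"] by simp

lemma abs_L2_add:
  assumes "square_integrable f" "square_integrable g"
  shows "abs_L2 f + abs_L2 g = abs_L2 (\<lambda>x. f x + g x)"
  using assms by (simp add: plus_L2.abs_eq)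

lemma abs_L2_diff:
  assumes "square_integrable f" "square_integrable g"
  shows "abs_L2 f - abs_L2 g = abs_L2 (\<lambda>x. f x - g x)"
  using assms by (simp add: minus_L2.abs_eq)

lemma norm_abs_L2:
  assumes "square_integrable f"
  shows "(norm (abs_L2 f))\<^sup>2 = (LINT x|lebesgue. (cmod (f x))\<^sup>2)"
proof -
  have "(norm (abs_L2 f))\<^sup>2 = inner (abs_L2 f) (abs_L2 f)"
    by (simp add: power2_norm_eq_inner)
  also have "\<dots> = (LINT x|lebesgue. Re (f x * cnj (f x)))"
    using assms by (simp add: inner_L2.abs_eq)
  also have "\<dots> = (LINT x|lebesgue. (cmod (f x))\<^sup>2)"
    by (rule Bochner_Integration.integral_cong)
       (simp_all only: Re_complex_of_real flip: complex_norm_square)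
  finally show ?thesis .
qed

lemma nn_integral_norm_L2:
  assumes "square_integrable f"
  shows "(\<integral>\<^sup>+x. ennreal ((cmod (f x))\<^sup>2) \<partial>lebesgue) = ennreal ((norm (abs_L2 f))\<^sup>2)"
  using assms unfolding norm_abs_L2[OF assms]
  by (intro nn_integral_eq_integral) (auto simp: square_integrable_def)

lemma square_integrable_nn:
  assumes "f \<in> borel_measurable lebesgue"
    and "(\<integral>\<^sup>+x. ennreal ((cmod (f x))\<^sup>2) \<partial>lebesgue) < \<infinity>"
  shows "square_integrable f"
  unfolding square_integrable_def
proof
  show "integrable lebesgue (\<lambda>x. (cmod (f x))\<^sup>2)"
  proof (rule integrableI_bounded)
    show "(\<lambda>x. (cmod (f x))\<^sup>2) \<in> borel_measurable lebesgue"
      using assms(1) by measurable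
  qed (use assms(2) in simp)
qed fact

lemma ennreal_le_suminf: "f n \<le> suminf f" for f :: "nat \<Rightarrow> ennreal"
  using sum_le_suminf[of f "{n}"] by simp

lemma L2_Cauchy_subseq_AE:
  fixes X :: "nat \<Rightarrow> 'a::euclidean_space L2"
  assumes X: "\<And>n. norm (X (Suc n) - X n) \<le> (1/2) ^ n"
  shows "AE x in lebesgue. convergent (\<lambda>n. rep_L2 (X n) x)"
proof -
  define F where "F n = rep_L2 (X n)" for n
  have F: "square_integrable (F n)" for n
    by (simp add: F_def square_integrable_rep_L2)
  define D where "D n x = F (Suc n) x - F n x" for n x
  have D: "square_integrable (D n)" for n
    unfolding D_def by (intro square_integrable_diff F)
  have Dmeas: "(\<lambda>x. ennreal (2 ^ n * (cmod (D n x))\<^sup>2)) \<in> borel_measurable lebesgue" for n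
    using square_integrable_measurable[OF D] by measurable
  have Dn: "(\<integral>\<^sup>+x. ennreal (2 ^ n * (cmod (D n x))\<^sup>2) \<partial>lebesgue) \<le> ennreal ((1/2) ^ n)" for n
  proof -
    have "abs_L2 (D n) = X (Suc n) - X n"
      unfolding D_def using F[of n] F[of "Suc n"] by (simp add: F_def flip: abs_L2_diff)
    then have "(norm (abs_L2 (D n)))\<^sup>2 \<le> ((1/2) ^ n)\<^sup>2"
      using X[of n] by (intro power_mono) auto
    then have "2 ^ n * (norm (abs_L2 (D n)))\<^sup>2 \<le> 2 ^ n * ((1/2) ^ n)\<^sup>2"
      by (intro mult_left_mono) auto
    also have "\<dots> = (1/2::real) ^ n"
      by (simp add: power2_eq_square power_one_over)
    finally have *: "2 ^ n * (norm (abs_L2 (D n)))\<^sup>2 \<le> (1/2) ^ n" .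
    have "(\<integral>\<^sup>+x. ennreal (2 ^ n * (cmod (D n x))\<^sup>2) \<partial>lebesgue) =
          ennreal (2 ^ n) * (\<integral>\<^sup>+x. ennreal ((cmod (D n x))\<^sup>2) \<partial>lebesgue)"
      using square_integrable_measurable[OF D, of n]
      by (subst nn_integral_cmult[symmetric]) (auto simp: ennreal_mult)
    also have "\<dots> = ennreal (2 ^ n * (norm (abs_L2 (D n)))\<^sup>2)"
      by (simp add: nn_integral_norm_L2[OF D] ennreal_mult)
    also have "\<dots> \<le> ennreal ((1/2) ^ n)"
      using * by (rule ennreal_leI)
    finally show ?thesis .
  qed
  have "(\<integral>\<^sup>+x. (\<Sum>n. ennreal (2 ^ n * (cmod (D n x))\<^sup>2)) \<partial>lebesgue) =
        (\<Sum>n. \<integral>\<^sup>+x. ennreal (2 ^ n * (cmod (D n x))\<^sup>2) \<partial>lebesgue)"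
    by (rule nn_integral_suminf[OF Dmeas])
  also have "\<dots> \<le> (\<Sum>n. ennreal ((1/2) ^ n))"
    by (intro suminf_le Dn) auto
  also have "\<dots> = ennreal (\<Sum>n. (1/2) ^ n)"
    by (rule suminf_ennreal2) (auto intro: summable_geometric)
  also have "\<dots> < \<infinity>" by simp
  finally have "(\<integral>\<^sup>+x. (\<Sum>n. ennreal (2 ^ n * (cmod (D n x))\<^sup>2)) \<partial>lebesgue) \<noteq> \<infinity>"
    by (rule less_imp_neq)
  moreover have "(\<lambda>x. \<Sum>n. ennreal (2 ^ n * (cmod (D n x))\<^sup>2)) \<in> borel_measurable lebesgue"
    by (rule borel_measurable_suminf_order[OF Dmeas])
  ultimately have "AE x in lebesgue. (\<Sum>n. ennreal (2 ^ n * (cmod (D n x))\<^sup>2)) \<noteq> \<infinity>"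
    by (intro nn_integral_noteq_infinite)
  then show ?thesis
  proof eventually_elim
    fix x
    assume fin: "(\<Sum>n. ennreal (2 ^ n * (cmod (D n x))\<^sup>2)) \<noteq> \<infinity>"
    define u where "u = (\<Sum>n. ennreal (2 ^ n * (cmod (D n x))\<^sup>2))"
    define s where "s = enn2real u"
    have "u < top" using fin unfolding u_def[symmetric] by (simp add: less_top)
    then have s: "0 \<le> s" "u = ennreal s"
      by (simp_all add: s_def)
    have bound: "cmod (D n x) \<le> sqrt s * (1 / sqrt 2) ^ n" for n
    proof -
      have "ennreal (2 ^ n * (cmod (D n x))\<^sup>2) \<le> ennreal s"
        unfolding s(2)[symmetric] u_def
        by (rule ennreal_le_suminf)
      then have "2 ^ n * (cmod (D n x))\<^sup>2 \<le> s"
        using s(1) by simp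
      then have "sqrt (2 ^ n * (cmod (D n x))\<^sup>2) \<le> sqrt s"
        by (rule real_sqrt_le_mono)
      then have "sqrt 2 ^ n * cmod (D n x) \<le> sqrt s"
        by (simp add: real_sqrt_mult real_sqrt_power)
      then show ?thesis
        by (simp add: field_simps)
    qed
    have "summable (\<lambda>n. sqrt s * (1 / sqrt 2) ^ n)"
      by (intro summable_mult summable_geometric) simp
    then have "summable (\<lambda>n. D n x)"
      by (rule summable_comparison_test'[where N = 0]) (use bound in auto)
    then have "convergent (\<lambda>n. \<Sum>k<n. D k x)"
      by (simp add: summable_iff_convergent)
    then have "convergent (\<lambda>n. (\<Sum>k<n. D k x) + F 0 x)"
      by (intro convergent_add convergent_const)
    moreover have "(\<Sum>k<n. D k x) + F 0 x = F n x" for n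
      unfolding D_def by (subst sum_lessThan_telescope) simp
    ultimately show "convergent (\<lambda>n. rep_L2 (X n) x)"
      by (simp add: F_def)
  qed
qed

lemma L2_fast_Cauchy_convergent:
  fixes X :: "nat \<Rightarrow> 'a::euclidean_space L2"
  assumes X: "\<And>n. norm (X (Suc n) - X n) \<le> (1/2) ^ n" and "Cauchy X"
  shows "convergent X"
proof -
  define F where "F n = rep_L2 (X n)" for n
  have F: "square_integrable (F n)" for n
    by (simp add: F_def square_integrable_rep_L2)
  have [measurable]: "F n \<in> borel_measurable lebesgue" for n
    by (rule square_integrable_measurable[OF F])
  define G where "G x = lim (\<lambda>n. F n x)" for x
  have [measurable]: "G \<in> borel_measurable lebesgue"
    unfolding G_def by measurable
  have conv: "AE x in lebesgue. (\<lambda>n. F n x) \<longlonglongrightarrow> G x"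
    using L2_Cauchy_subseq_AE[OF X] unfolding F_def[symmetric] G_def
    by eventually_elim (simp add: convergent_LIMSEQ_iff)
  have fatou: "(\<integral>\<^sup>+x. ennreal ((cmod (G x - F n x))\<^sup>2) \<partial>lebesgue) \<le> ennreal (e\<^sup>2)"
    if e: "0 < e" "\<And>m. m \<ge> n \<Longrightarrow> norm (X m - X n) \<le> e" for n e
  proof -
    have "(\<integral>\<^sup>+x. ennreal ((cmod (G x - F n x))\<^sup>2) \<partial>lebesgue) =
        (\<integral>\<^sup>+x. liminf (\<lambda>m. ennreal ((cmod (F m x - F n x))\<^sup>2)) \<partial>lebesgue)"
    proof (rule nn_integral_cong_AE)
      show "AE x in lebesgue. ennreal ((cmod (G x - F n x))\<^sup>2) =
          liminf (\<lambda>m. ennreal ((cmod (F m x - F n x))\<^sup>2))"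
        using conv
      proof eventually_elim
        fix x assume "(\<lambda>m. F m x) \<longlonglongrightarrow> G x"
        then have "(\<lambda>m. ennreal ((cmod (F m x - F n x))\<^sup>2)) \<longlonglongrightarrow> ennreal ((cmod (G x - F n x))\<^sup>2)"
          by (intro tendsto_intros)
        then show "ennreal ((cmod (G x - F n x))\<^sup>2) = liminf (\<lambda>m. ennreal ((cmod (F m x - F n x))\<^sup>2))"
          by (intro lim_imp_Liminf[symmetric]) simp_all
      qed
    qed
    also have "\<dots> \<le> liminf (\<lambda>m. \<integral>\<^sup>+x. ennreal ((cmod (F m x - F n x))\<^sup>2) \<partial>lebesgue)"
      by (rule nn_integral_liminf) measurable
    also have "\<dots> \<le> ennreal (e\<^sup>2)"
    proof (rule Liminf_le)
      have "(\<integral>\<^sup>+x. ennreal ((cmod (F m x - F n x))\<^sup>2) \<partial>lebesgue) \<le> ennreal (e\<^sup>2)" if "m \<ge> n" for m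
      proof -
        have "abs_L2 (\<lambda>x. F m x - F n x) = X m - X n"
          using F[of m] F[of n] by (simp add: F_def flip: abs_L2_diff)
        then show ?thesis
          using e(2)[OF that] nn_integral_norm_L2[OF square_integrable_diff[OF F F], of m n]
          by (auto intro!: ennreal_leI power_mono)
      qed
      then show "\<forall>\<^sub>F m in sequentially.
          (\<integral>\<^sup>+x. ennreal ((cmod (F m x - F n x))\<^sup>2) \<partial>lebesgue) \<le> ennreal (e\<^sup>2)"
        by (auto simp: eventually_sequentially)
    qed simp
    finally show ?thesis .
  qed
  have ex: "\<exists>N. \<forall>n\<ge>N. \<forall>m\<ge>n. norm (X m - X n) \<le> e" if "0 < e" for e
  proof -
    obtain N where "\<And>m n. m \<ge> N \<Longrightarrow> n \<ge> N \<Longrightarrow> norm (X m - X n) < e"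
      using CauchyD[OF \<open>Cauchy X\<close> \<open>0 < e\<close>] by blast
    then show ?thesis
      by (meson less_imp_le order_trans)
  qed
  have diff: "square_integrable (\<lambda>x. G x - F n x)"
    if "0 < e" "\<And>m. m \<ge> n \<Longrightarrow> norm (X m - X n) \<le> e" for n e
    by (rule square_integrable_nn)
       (use le_less_trans[OF fatou[OF that]] in \<open>auto\<close>)
  obtain N where N: "\<forall>n\<ge>N. \<forall>m\<ge>n. norm (X m - X n) \<le> 1"
    using ex[of 1] by auto
  have "square_integrable (\<lambda>x. (G x - F N x) + F N x)"
    using N by (intro square_integrable_add F diff[of 1]) auto
  then have G: "square_integrable G" by simp
  have "X \<longlonglongrightarrow> abs_L2 G"
  proof (rule LIMSEQ_I)
    fix e :: real assume "0 < e"
    then obtain N where N: "\<forall>n\<ge>N. \<forall>m\<ge>n. norm (X m - X n) \<le> e/2"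
      using ex[of "e/2"] by auto
    have "norm (X n - abs_L2 G) < e" if "n \<ge> N" for n
    proof -
      have eq: "abs_L2 (\<lambda>x. G x - F n x) = abs_L2 G - X n"
        using F[of n] G by (simp add: F_def flip: abs_L2_diff)
      have "ennreal ((norm (abs_L2 G - X n))\<^sup>2) \<le> ennreal ((e/2)\<^sup>2)"
        using fatou[of "e/2" n] N that \<open>0 < e\<close>
          nn_integral_norm_L2[OF square_integrable_diff[OF G F[of n]]] eq by simp
      then have "(norm (abs_L2 G - X n))\<^sup>2 \<le> (e/2)\<^sup>2"
        by (subst (asm) ennreal_le_iff) auto
      then have "norm (abs_L2 G - X n) \<le> e/2"
        using \<open>0 < e\<close> by (simp add: power2_le_iff_abs_le)
      then show ?thesis
        using \<open>0 < e\<close> by (simp add: norm_minus_commute)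
    qed
    then show "\<exists>N. \<forall>n\<ge>N. norm (X n - abs_L2 G) < e" by blast
  qed
  then show ?thesis by (auto simp: convergent_def)
qed

instance L2 :: (euclidean_space) banach
proof
  fix X :: "nat \<Rightarrow> 'a L2"
  assume X: "Cauchy X"
  have "\<exists>N. \<forall>m\<ge>N. \<forall>k\<ge>N. norm (X m - X k) < (1/2) ^ n" for n
    using CauchyD[OF X, of "(1/2) ^ n"] by simp
  then obtain N where N: "\<And>n m k. m \<ge> N n \<Longrightarrow> k \<ge> N n \<Longrightarrow> norm (X m - X k) < (1/2) ^ n"
    by metis
  define r where "r = rec_nat (N 0) (\<lambda>n a. max (Suc a) (N (Suc n)))"
  have r_Suc: "r (Suc n) = max (Suc (r n)) (N (Suc n))" for n
    by (simp add: r_def)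
  have r: "strict_mono r"
    by (intro strict_monoI_Suc) (simp add: r_Suc)
  have rN: "r n \<ge> N n" for n
    by (cases n) (auto simp: r_Suc, simp add: r_def)
  have "norm ((X \<circ> r) (Suc n) - (X \<circ> r) n) \<le> (1/2) ^ n" for n
    using N[where n = n and m = "r (Suc n)" and k = "r n"] rN[of n] strict_monoD[OF r, of n "Suc n"]
    by (simp add: less_imp_le)
  then have "convergent (X \<circ> r)"
    by (rule L2_fast_Cauchy_convergent) (rule Cauchy_subseq_Cauchy[OF X r])
  then obtain L where "(X \<circ> r) \<longlonglongrightarrow> L" by (auto simp: convergent_def)
  then have "X \<longlonglongrightarrow> L"
    by (rule Cauchy_converges_subseq[OF X r])
  then show "convergent X" by (auto simp: convergent_def)
qed

lemma lmeasurable_approx_basis: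
  fixes A :: "'a::euclidean_space set"
  assumes B: "countable B" "topological_basis B" and A: "A \<in> lmeasurable" and "0 < e"
  obtains W where "finite W" "W \<subseteq> B" "\<Union>W \<in> lmeasurable"
    "measure lebesgue ((A - \<Union>W) \<union> (\<Union>W - A)) < e"
proof -
  obtain U where U: "open U" "A \<subseteq> U" "U - A \<in> lmeasurable" "emeasure lebesgue (U - A) < ennreal (e/2)"
    using sets_lebesgue_outer_open[of A "e/2"] A \<open>0 < e\<close> by (auto simp: fmeasurableD)
  have Um: "U \<in> lmeasurable"
    using fmeasurable.Un[OF A U(3)] U(2) by (simp add: Un_absorb1)
  have UA: "measure lebesgue (U - A) < e/2"
    using U(4) emeasure_eq_measure2[OF U(3)] \<open>0 < e\<close> by (simp add: ennreal_less_iff)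
  define V where "V = insert {} {b \<in> B. b \<subseteq> U}"
  define b where "b = from_nat_into V"
  have V: "countable V" "V \<noteq> {}" using B(1) by (auto simp: V_def)
  have rb: "range b = V"
    unfolding b_def by (rule range_from_nat_into[OF V(2,1)])
  have bop: "open (b i)" for i
  proof -
    have "b i \<in> V" using rb by auto
    then show ?thesis using topological_basis_open[OF B(2)] by (auto simp: V_def)
  qed
  define C where "C n = (\<Union>i<n. b i)" for n
  have Cop: "open (C n)" for n
    unfolding C_def using bop by blast
  have CU: "(\<Union>n. C n) = U"
  proof -
    have "(\<Union>n. C n) = \<Union>(range b)"
      unfolding C_def by auto
    also have "\<dots> = U"
    proof
      show "\<Union>(range b) \<subseteq> U" unfolding rb by (auto simp: V_def)
      show "U \<subseteq> \<Union>(range b)"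
      proof
        fix x assume "x \<in> U"
        then obtain b' where "b' \<in> B" "x \<in> b'" "b' \<subseteq> U"
          using topological_basisE[OF B(2) U(1)] by blast
        then show "x \<in> \<Union>(range b)" unfolding rb by (auto simp: V_def)
      qed
    qed
    finally show ?thesis .
  qed
  have Csub: "C n \<subseteq> U" for n using CU by auto
  have Cm: "C n \<in> lmeasurable" for n
    by (rule fmeasurableI2[OF Um Csub]) (simp add: Cop lborelD)
  have "(\<lambda>n. measure lebesgue (C n)) \<longlonglongrightarrow> measure lebesgue (\<Union>n. C n)"
  proof (rule Lim_measure_incseq)
    show "range C \<subseteq> sets lebesgue" using Cm by (auto simp: fmeasurableD)
    show "incseq C" unfolding incseq_def C_def
      by (intro allI impI UN_mono) auto
    show "emeasure lebesgue (\<Union>n. C n) \<noteq> \<infinity>"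
      using Um unfolding CU by (auto simp: fmeasurable_def)
  qed
  then have "\<exists>N. \<forall>n\<ge>N. norm (measure lebesgue (C n) - measure lebesgue U) < e/2"
    unfolding CU using \<open>0 < e\<close> by (intro LIMSEQ_D) auto
  then obtain n where n: "\<bar>measure lebesgue (C n) - measure lebesgue U\<bar> < e/2"
    by auto
  have "measure lebesgue (U - C n) = measure lebesgue U - measure lebesgue (C n)"
    by (rule measurable_measure_Diff[OF Um _ Csub]) (simp add: Cm fmeasurableD)
  then have UC: "measure lebesgue (U - C n) < e/2" using n by linarith
  have "measure lebesgue ((A - C n) \<union> (C n - A)) \<le> measure lebesgue (A - C n) + measure lebesgue (C n - A)"
    by (rule measure_Un_le) (use A Cm in \<open>auto simp: fmeasurableD\<close>)
  also have "measure lebesgue (A - C n) \<le> measure lebesgue (U - C n)"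
    by (rule measure_mono_fmeasurable) (use A Cm Um U(2) in \<open>auto simp: fmeasurableD fmeasurable_Diff\<close>)
  also have "measure lebesgue (C n - A) \<le> measure lebesgue (U - A)"
    by (rule measure_mono_fmeasurable) (use A Cm Um U(3) Csub in \<open>auto simp: fmeasurableD\<close>)
  finally have le: "measure lebesgue ((A - C n) \<union> (C n - A)) < e"
    using UC UA by linarith
  have eq: "\<Union>(b ` {..<n} - {{}}) = C n" by (auto simp: C_def)
  show ?thesis
  proof
    show "finite (b ` {..<n} - {{}})" by simp
    show "b ` {..<n} - {{}} \<subseteq> B"
    proof
      fix z assume "z \<in> b ` {..<n} - {{}}"
      then have "z \<in> V" "z \<noteq> {}" using rb by auto
      then show "z \<in> B" by (simp add: V_def)
    qed
    show "\<Union>(b ` {..<n} - {{}}) \<in> lmeasurable" unfolding eq by (rule Cm)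
    show "measure lebesgue ((A - \<Union>(b ` {..<n} - {{}})) \<union> (\<Union>(b ` {..<n} - {{}}) - A)) < e"
      unfolding eq by (rule le)
  qed
qed

lemma square_integrable_indicator:
  assumes "A \<in> lmeasurable"
  shows "square_integrable (\<lambda>x. c * indicator A x)"
proof (rule square_integrable_cmult)
  have "(\<lambda>x. (cmod (indicator A x :: complex))\<^sup>2) = (indicator A :: _ \<Rightarrow> real)"
    by (auto simp: fun_eq_iff indicator_def)
  moreover have "integrable lebesgue (indicator A :: _ \<Rightarrow> real)"
    using assms unfolding fmeasurable_def by (intro integrable_real_indicator) auto
  ultimately show "square_integrable (indicator A)"
    using assms by (simp add: square_integrable_def fmeasurableD borel_measurable_indicator)
qed

lemma norm_cmult_L2:
  assumes "square_integrable f"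
  shows "norm (abs_L2 (\<lambda>x. c * f x)) = cmod c * norm (abs_L2 f)"
proof -
  have "(norm (abs_L2 (\<lambda>x. c * f x)))\<^sup>2 = (cmod c * norm (abs_L2 f))\<^sup>2"
    using assms by (simp add: norm_abs_L2 square_integrable_cmult norm_mult power_mult_distrib)
  then show ?thesis by (simp add: power2_eq_iff_nonneg)
qed

lemma norm_diff_indicator_L2:
  assumes "A \<in> lmeasurable" "B \<in> lmeasurable"
  shows "(norm (abs_L2 (\<lambda>x. c * indicator A x) - abs_L2 (\<lambda>x. c * indicator B x)))\<^sup>2 =
    (cmod c)\<^sup>2 * measure lebesgue ((A - B) \<union> (B - A))"
proof -
  have "(norm (abs_L2 (\<lambda>x. c * indicator A x) - abs_L2 (\<lambda>x. c * indicator B x)))\<^sup>2 =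
     (LINT x|lebesgue. (cmod (c * indicator A x - c * indicator B x))\<^sup>2)"
    using assms by (simp add: abs_L2_diff norm_abs_L2 square_integrable_indicator square_integrable_diff)
  also have "(\<lambda>x. (cmod (c * indicator A x - c * indicator B x))\<^sup>2) =
     (\<lambda>x. (cmod c)\<^sup>2 * indicator ((A - B) \<union> (B - A)) x)"
    by (auto simp: fun_eq_iff indicator_def)
  also have "(LINT x|lebesgue. (cmod c)\<^sup>2 * indicator ((A - B) \<union> (B - A)) x) =
     (cmod c)\<^sup>2 * measure lebesgue ((A - B) \<union> (B - A))"
    by simp
  finally show ?thesis .
qed

lemma L2_separable: "\<exists>D :: 'a::euclidean_space L2 set. countable D \<and> closure D = UNIV"
proof -
  obtain \<B> :: "'a set set" where B: "countable \<B>" "topological_basis \<B>"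
    using ex_countable_basis by blast
  obtain Q :: "complex set" where Q: "countable Q" "\<And>X. open X \<Longrightarrow> X \<noteq> {} \<Longrightarrow> \<exists>d\<in>Q. d \<in> X"
    using countable_dense_exists[where 'a = complex] by metis
  define \<U> where "\<U> = Union ` {W. finite W \<and> W \<subseteq> \<B>} \<inter> lmeasurable"
  have \<U>: "countable \<U>"
    unfolding \<U>_def using countable_Collect_finite_subset[OF B(1)] by (intro countable_Int1 countable_image)
  define cI where "cI c A = abs_L2 (\<lambda>x::'a. c * indicator A x)" for c A
  define D where "D = (\<lambda>xs. sum_list (map (\<lambda>(c, A). cI c A) xs)) ` lists (Q \<times> \<U>)"
  define C where "C = closure D"
  have "countable D"
    unfolding D_def by (intro countable_image countable_lists countable_SIGMA Q \<U>)
  have closed: "closed C" by (simp add: C_def)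
  have seqI: "x \<in> C" if "\<And>n. u n \<in> D" "u \<longlonglongrightarrow> x" for u x
    unfolding C_def closure_sequential by (rule exI[of _ u]) (use that in \<open>auto\<close>)
  have D_add: "x + y \<in> D" if x: "x \<in> D" and y: "y \<in> D" for x y
  proof -
    obtain xs where xs: "xs \<in> lists (Q \<times> \<U>)" "x = sum_list (map (\<lambda>(c, A). cI c A) xs)"
      using x unfolding D_def by blast
    obtain ys where ys: "ys \<in> lists (Q \<times> \<U>)" "y = sum_list (map (\<lambda>(c, A). cI c A) ys)"
      using y unfolding D_def by blast
    have "xs @ ys \<in> lists (Q \<times> \<U>)" "x + y = sum_list (map (\<lambda>(c, A). cI c A) (xs @ ys))"
      using xs ys by (simp_all add: append_in_lists_conv)
    then show ?thesis unfolding D_def by blast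
  qed
  have C_add: "x + y \<in> C" if xy: "x \<in> C" "y \<in> C" for x y
  proof -
    obtain u v where "\<And>n. u n \<in> D" "u \<longlonglongrightarrow> x" "\<And>n. v n \<in> D" "v \<longlonglongrightarrow> y"
      using xy unfolding C_def closure_sequential by blast
    then show ?thesis
      by (intro seqI[of "\<lambda>n. u n + v n"] D_add tendsto_add)
  qed
  have C_zero: "0 \<in> C"
  proof -
    have "0 \<in> D" unfolding D_def by (rule image_eqI[of _ _ "[]"]) auto
    then show ?thesis unfolding C_def using closure_subset by blast
  qed
  have C_cU: "cI c A \<in> C" if A: "A \<in> \<U>" for c A
  proof -
    have Am: "A \<in> lmeasurable" using A by (simp add: \<U>_def)
    have "\<exists>q\<in>Q. q \<in> ball c (inverse (real (Suc n)))" for n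
      by (rule Q(2)) auto
    then obtain q where q: "\<And>n. q n \<in> Q" "\<And>n. dist c (q n) < inverse (real (Suc n))"
      by (metis mem_ball)
    have qc: "q \<longlonglongrightarrow> c"
    proof (rule iffD2[OF tendsto_dist_iff])
      show "(\<lambda>n. dist (q n) c) \<longlonglongrightarrow> 0"
        by (rule tendsto_sandwich[OF _ _ tendsto_const LIMSEQ_inverse_real_of_nat])
           (use q(2) in \<open>auto intro!: always_eventually less_imp_le simp: dist_commute\<close>)
    qed
    have inD: "cI (q n) A \<in> D" for n
      unfolding D_def by (rule image_eqI[of _ _ "[(q n, A)]"]) (use q A in auto)
    have "norm (cI (q n) A - cI c A) = cmod (q n - c) * norm (cI 1 A)" for n
    proof -
      have "cI (q n) A - cI c A = abs_L2 (\<lambda>x. (q n - c) * (1 * indicator A x))"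
        unfolding cI_def using Am by (simp add: abs_L2_diff square_integrable_indicator left_diff_distrib)
      then show ?thesis
        unfolding cI_def by (simp only: norm_cmult_L2[OF square_integrable_indicator[OF Am]])
    qed
    moreover have "(\<lambda>n. cmod (q n - c) * norm (cI 1 A)) \<longlonglongrightarrow> 0"
      using qc by (intro tendsto_mult_left_zero tendsto_norm_zero) (simp add: LIM_zero)
    ultimately have "(\<lambda>n. norm (cI (q n) A - cI c A)) \<longlonglongrightarrow> 0"
      by simp
    then have "(\<lambda>n. cI (q n) A) \<longlonglongrightarrow> cI c A"
      by (rule LIM_zero_cancel[OF tendsto_norm_zero_cancel])
    then show ?thesis
      by (rule seqI[OF inD])
  qed
  have C_cI: "cI c A \<in> C" if A: "A \<in> lmeasurable" for c A
  proof -
    have "\<exists>Z\<in>\<U>. measure lebesgue ((A - Z) \<union> (Z - A)) < inverse (real (Suc n))" for n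
      by (rule lmeasurable_approx_basis[OF B A, of "inverse (real (Suc n))"]) (auto simp: \<U>_def)
    then obtain Z where Z: "\<And>n. Z n \<in> \<U>"
      "\<And>n. measure lebesgue ((A - Z n) \<union> (Z n - A)) < inverse (real (Suc n))"
      by metis
    have Zm: "Z n \<in> lmeasurable" for n using Z(1)[of n] by (simp add: \<U>_def)
    have "(\<lambda>n. measure lebesgue ((A - Z n) \<union> (Z n - A))) \<longlonglongrightarrow> 0"
      by (rule tendsto_sandwich[OF _ _ tendsto_const LIMSEQ_inverse_real_of_nat])
         (use Z(2) in \<open>auto intro!: always_eventually less_imp_le\<close>)
    then have "(\<lambda>n. (cmod c)\<^sup>2 * measure lebesgue ((A - Z n) \<union> (Z n - A))) \<longlonglongrightarrow> 0"
      by (rule tendsto_mult_right_zero)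
    then have "(\<lambda>n. (norm (cI c A - cI c (Z n)))\<^sup>2) \<longlonglongrightarrow> 0"
      unfolding cI_def norm_diff_indicator_L2[OF A Zm] .
    then have "(\<lambda>n. sqrt ((norm (cI c A - cI c (Z n)))\<^sup>2)) \<longlonglongrightarrow> sqrt 0"
      by (rule tendsto_real_sqrt)
    then have "(\<lambda>n. norm (cI c (Z n) - cI c A)) \<longlonglongrightarrow> 0"
      by (simp add: norm_minus_commute)
    then have "(\<lambda>n. cI c (Z n)) \<longlonglongrightarrow> cI c A"
      by (rule LIM_zero_cancel[OF tendsto_norm_zero_cancel])
    then show ?thesis
      by (rule closed_sequentially[OF closed C_cU[OF Z(1)]])
  qed
  have C_sum: "square_integrable (\<lambda>x. \<Sum>y\<in>S. y * indicator (E y) x) \<and>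
      abs_L2 (\<lambda>x. \<Sum>y\<in>S. y * indicator (E y) x) \<in> C"
    if "finite S" "\<And>y. y \<in> S \<Longrightarrow> E y \<in> lmeasurable" for S and E :: "complex \<Rightarrow> 'a set"
    using that
  proof (induction S rule: finite_induct)
    case empty
    have "abs_L2 (\<lambda>x::'a. 0) = 0" by (simp add: zero_L2_def)
    then show ?case using C_zero square_integrable_zero by simp
  next
    case (insert y S)
    have 1: "square_integrable (\<lambda>x. y * indicator (E y) x)"
      by (rule square_integrable_indicator) (use insert in auto)
    have 2: "abs_L2 (\<lambda>x. y * indicator (E y) x) \<in> C"
      using C_cI[of "E y" y] insert.prems by (simp add: cI_def)
    have 3: "square_integrable (\<lambda>x. \<Sum>y\<in>S. y * indicator (E y) x)"
      "abs_L2 (\<lambda>x. \<Sum>y\<in>S. y * indicator (E y) x) \<in> C"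
      using insert by auto
    show ?case
      using square_integrable_add[OF 1 3(1)] C_add[OF 2 3(2)]
      unfolding sum.insert[OF insert.hyps] abs_L2_add[OF 1 3(1)] by (rule conjI)
  qed
  have C_simple: "abs_L2 s \<in> C"
    if s: "simple_function lebesgue s" "square_integrable s" for s :: "'a \<Rightarrow> complex"
  proof -
    define E where "E y = s -` {y}" for y
    have E: "E y \<in> lmeasurable" if "y \<noteq> 0" for y
    proof -
      have "integrable lebesgue (\<lambda>x. indicator (E y) x *\<^sub>R (cmod (s x))\<^sup>2)"
        by (rule integrable_mult_indicator)
           (use s in \<open>auto simp: E_def square_integrable_def intro: simple_functionD(2)[where M = lebesgue, simplified]\<close>)
      then have "integrable lebesgue (\<lambda>x. inverse ((cmod y)\<^sup>2) * (indicator (E y) x *\<^sub>R (cmod (s x))\<^sup>2))"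
        by (rule integrable_mult_right)
      also have "(\<lambda>x. inverse ((cmod y)\<^sup>2) * (indicator (E y) x *\<^sub>R (cmod (s x))\<^sup>2)) = indicator (E y)"
        using that by (auto simp: fun_eq_iff E_def indicator_def)
      finally show ?thesis
        unfolding integrable_indicator_iff by (simp del: emeasure_completion add: fmeasurable_def less_top)
    qed
    have fin: "finite (range s - {0})"
      using s(1) by (simp add: simple_function_def)
    have "s x = (\<Sum>y\<in>range s - {0}. y * indicator (E y) x)" for x
    proof (cases "s x = 0")
      case True
      then have "(\<Sum>y\<in>range s - {0}. y * indicator (E y) x) = 0"
        by (intro sum.neutral) (auto simp: E_def)
      then show ?thesis using True by simp
    next
      case False
      have "(\<Sum>y\<in>range s - {0}. y * indicator (E y) x) = (\<Sum>y\<in>{s x}. y * indicator (E y) x)"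
        by (rule sum.mono_neutral_right) (use fin False in \<open>auto simp: E_def indicator_def\<close>)
      then show ?thesis by (simp add: E_def)
    qed
    then have "s = (\<lambda>x. \<Sum>y\<in>range s - {0}. y * indicator (E y) x)" by (rule ext)
    then show ?thesis using C_sum[OF fin, of E] E by simp
  qed
  have "x \<in> C" for x
  proof -
    define f where "f = rep_L2 x"
    have f: "square_integrable f" "abs_L2 f = x"
      by (simp_all add: f_def square_integrable_rep_L2)
    have [measurable]: "f \<in> borel_measurable lebesgue"
      by (rule square_integrable_measurable[OF f(1)])
    obtain s where s: "\<And>i. simple_function lebesgue (s i)" "\<And>x. (\<lambda>i. s i x) \<longlonglongrightarrow> f x"
      "\<And>i x. cmod (s i x) \<le> 2 * cmod (f x)"
      using borel_measurable_implies_sequence_metric[of f lebesgue 0] by auto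
    have [measurable]: "s i \<in> borel_measurable lebesgue" for i
      by (rule borel_measurable_simple_function[OF s(1)])
    have fi: "integrable lebesgue (\<lambda>x. 4 * (cmod (f x))\<^sup>2)" "integrable lebesgue (\<lambda>x. 9 * (cmod (f x))\<^sup>2)"
      using f(1) by (auto simp: square_integrable_def)
    have si: "square_integrable (s i)" for i
    proof (rule square_integrable_bound[OF _ fi(1)])
      fix x show "(cmod (s i x))\<^sup>2 \<le> 4 * (cmod (f x))\<^sup>2"
        using power_mono[OF s(3)[of i x], of 2] by (simp add: power_mult_distrib)
    qed measurable
    have "(\<lambda>i. LINT x|lebesgue. (cmod (s i x - f x))\<^sup>2) \<longlonglongrightarrow> (LINT x|(lebesgue :: 'a measure). 0)"
    proof (rule integral_dominated_convergence[OF _ _ fi(2)])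
      show "AE x in lebesgue. (\<lambda>i. (cmod (s i x - f x))\<^sup>2) \<longlonglongrightarrow> 0"
        using s(2) by (intro AE_I2 tendsto_null_power tendsto_norm_zero) (auto simp: LIM_zero)
      show "AE x in lebesgue. norm ((cmod (s i x - f x))\<^sup>2) \<le> 9 * (cmod (f x))\<^sup>2" for i
      proof (rule AE_I2)
        fix x
        have "cmod (s i x - f x) \<le> 3 * cmod (f x)"
          using norm_triangle_ineq4[of "s i x" "f x"] s(3)[of i x] by linarith
        from power_mono[OF this, of 2] show "norm ((cmod (s i x - f x))\<^sup>2) \<le> 9 * (cmod (f x))\<^sup>2"
          by (simp add: power_mult_distrib)
      qed
    qed measurable
    then have "(\<lambda>i. (norm (abs_L2 (s i) - x))\<^sup>2) \<longlonglongrightarrow> 0"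
      unfolding f(2)[symmetric] abs_L2_diff[OF si f(1)] norm_abs_L2[OF square_integrable_diff[OF si f(1)]]
      by simp
    then have "(\<lambda>i. sqrt ((norm (abs_L2 (s i) - x))\<^sup>2)) \<longlonglongrightarrow> sqrt 0"
      by (rule tendsto_real_sqrt)
    then have "(\<lambda>i. norm (abs_L2 (s i) - x)) \<longlonglongrightarrow> 0"
      by simp
    then have "(\<lambda>i. abs_L2 (s i)) \<longlonglongrightarrow> x"
      by (rule LIM_zero_cancel[OF tendsto_norm_zero_cancel])
    then show ?thesis
      by (rule closed_sequentially[OF closed C_simple[OF s(1) si]])
  qed
  then show ?thesis using \<open>countable D\<close> unfolding C_def by blast
qed

instance L2 :: (euclidean_space) second_countable_topology
proof
  obtain D :: "'a L2 set" where D: "countable D" "closure D = UNIV"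
    using L2_separable by blast
  define B where "B = (\<lambda>(d, n). ball d (inverse (real (Suc n)))) ` (D \<times> (UNIV :: nat set))"
  have "countable B" unfolding B_def using D(1) by (intro countable_image countable_SIGMA) auto
  moreover have "topological_basis B"
  proof (rule topological_basisI)
    show "open b" if "b \<in> B" for b using that by (auto simp: B_def)
  next
    fix U :: "'a L2 set" and x assume "open U" "x \<in> U"
    then obtain e where e: "0 < e" "ball x e \<subseteq> U" by (auto simp: open_contains_ball)
    obtain n where n: "inverse (real (Suc n)) < e/2"
      using reals_Archimedean[of "e/2"] e(1) by auto
    obtain d where d: "d \<in> D" "dist d x < inverse (real (Suc n))"
      using D(2) closure_approachable[of x D] by (metis UNIV_I inverse_positive_iff_positive of_nat_0_less_iff zero_less_Suc)
    have "ball d (inverse (real (Suc n))) \<subseteq> ball x e"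
    proof
      fix y assume y: "y \<in> ball d (inverse (real (Suc n)))"
      have "dist x y \<le> dist d x + dist d y"
        using dist_triangle[of x y d] by (simp add: dist_commute)
      also have "\<dots> < e" using d(2) y n by (simp only: mem_ball)
      finally show "y \<in> ball x e" by simp
    qed
    moreover have "x \<in> ball d (inverse (real (Suc n)))" using d(2) by simp
    ultimately show "\<exists>b\<in>B. x \<in> b \<and> b \<subseteq> U"
      using d(1) e(2) by (intro bexI[of _ "ball d (inverse (real (Suc n)))"]) (auto simp: B_def)
  qed
  ultimately show "\<exists>B :: 'a L2 set set. countable B \<and> open = generate_topology B"
    using topological_basis_imp_subbasis by blast
qed

definition fourier_integral :: "('a::euclidean_space \<Rightarrow> complex) \<Rightarrow> 'a \<Rightarrow> complex" where
  "fourier_integral f \<kappa> =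
     (LINT x|lebesgue. f x * exp (- 2 * of_real pi * \<i> * of_real (\<kappa> \<bullet> x)))"

text \<open>
  The extension to \<open>L\<^sup>2\<close>: the limit of the Fourier integrals of any sequence in \<open>L\<^sup>1 \<inter> L\<^sup>2\<close> that
  converges to \<open>f\<close> in \<open>L\<^sup>2\<close>. By Plancherel's theorem the limit exists and does not depend on the
  sequence, and the last condition on \<open>s n\<close>, which keeps \<open>abs_L2\<close> inside its domain, holds for
  every element of \<open>L\<^sup>1 \<inter> L\<^sup>2\<close>.
\<close>

definition fourier_L2 :: "'a::euclidean_space L2 \<Rightarrow> 'a L2" where
  "fourier_L2 f = (THE F. \<exists>s.
     (\<forall>n. integrable lebesgue (s n) \<and> square_integrable (s n) \<and>
          square_integrable (fourier_integral (s n))) \<and>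
     (\<lambda>n. abs_L2 (s n)) \<longlonglongrightarrow> f \<and>
     (\<lambda>n. abs_L2 (fourier_integral (s n))) \<longlonglongrightarrow> F)"

definition Lp_space ::
  "ennreal \<Rightarrow> 'a measure \<Rightarrow> ('a \<Rightarrow> 'b::{banach, second_countable_topology}) set" where
  "Lp_space p M = {u \<in> borel_measurable M.
     if p = \<infinity> then \<exists>C. AE x in M. norm (u x) \<le> C
     else integrable M (\<lambda>x. norm (u x) powr enn2real p)}"

definition test_functions :: "real \<Rightarrow> (real \<Rightarrow> real) set" where
  "test_functions T = {\<phi>.
     (\<forall>n t. (deriv ^^ n) \<phi> differentiable (at t)) \<and>
     (\<exists>a b. 0 < a \<and> b < T \<and> (\<forall>t. t \<notin> {a..b} \<longrightarrow> \<phi> t = 0))}"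

text \<open>\<open>u\<close> belongs to \<open>W\<^sup>1\<^sup>,\<^sup>p(0,T)\<close> and \<open>v\<close> is its weak derivative.\<close>

definition weak_deriv ::
  "ennreal \<Rightarrow> real \<Rightarrow> (real \<Rightarrow> 'b::{banach, second_countable_topology}) \<Rightarrow> (real \<Rightarrow> 'b) \<Rightarrow> bool" where
  "weak_deriv p T u v \<longleftrightarrow>
     u \<in> Lp_space p (lebesgue_on {0<..<T}) \<and>
     v \<in> Lp_space p (lebesgue_on {0<..<T}) \<and>
     (\<forall>\<phi>\<in>test_functions T.
        (LINT t|lebesgue_on {0<..<T}. deriv \<phi> t *\<^sub>R u t) =
        - (LINT t|lebesgue_on {0<..<T}. \<phi> t *\<^sub>R v t))"

definition W1p ::
  "ennreal \<Rightarrow> real \<Rightarrow> (real \<Rightarrow> 'b::{banach, second_countable_topology}) set" where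
  "W1p p T = {u. \<exists>v. weak_deriv p T u v}"

text \<open>
  Arguments: densities \<open>\<rho>1 \<rho>2\<close>, layer thicknesses \<open>h1 h2\<close>, gravitational acceleration \<open>g\<close>,
  wave vector \<open>\<kappa>\<close>. The singular wave vector \<open>\<kappa> = 0\<close> forms a null set.
\<close>

definition coth :: "real \<Rightarrow> real" where
  "coth x = cosh x / sinh x"

definition T_coeff :: "real \<Rightarrow> real \<Rightarrow> real ^ 'd \<Rightarrow> real" where
  "T_coeff \<rho> h \<kappa> = \<rho> * coth (2 * pi * norm \<kappa> * h)"

definition omega :: "real \<Rightarrow> real \<Rightarrow> real \<Rightarrow> real \<Rightarrow> real \<Rightarrow> real ^ 'd \<Rightarrow> real" where
  "omega \<rho>1 \<rho>2 h1 h2 g \<kappa> =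
     sqrt (2 * pi * norm \<kappa> * (\<rho>2 - \<rho>1) * g / (T_coeff \<rho>1 h1 \<kappa> + T_coeff \<rho>2 h2 \<kappa>))"

definition omega_eps ::
  "real \<Rightarrow> real \<Rightarrow> real \<Rightarrow> real \<Rightarrow> real \<Rightarrow> real \<Rightarrow> real ^ 'd \<Rightarrow> complex" where
  "omega_eps \<rho>1 \<rho>2 h1 h2 g \<epsilon> \<kappa> = of_real (omega \<rho>1 \<rho>2 h1 h2 g \<kappa>) + \<i> * of_real \<epsilon>"

definition ship_position :: "(real \<Rightarrow> real ^ 'd) \<Rightarrow> real \<Rightarrow> real ^ 'd" where
  "ship_position U t = (LINT s:{0..t}|lebesgue. U s)"

definition source ::
  "real \<Rightarrow> real \<Rightarrow> real \<Rightarrow> real \<Rightarrow> (real ^ 'd) L2 \<Rightarrow> (real \<Rightarrow> real ^ 'd) \<Rightarrow>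
   real \<Rightarrow> real ^ 'd \<Rightarrow> complex" where
  "source \<rho>1 \<rho>2 h1 h2 f U t \<kappa> =
     2 * of_real pi * of_real \<rho>1 * \<i> * of_real (\<kappa> \<bullet> U t) *
       exp (- 2 * of_real pi * \<i> * of_real (\<kappa> \<bullet> ship_position U t)) * rep_L2 (fourier_L2 f) \<kappa> /
     of_real (sinh (2 * pi * norm \<kappa> * h1) * (T_coeff \<rho>1 h1 \<kappa> + T_coeff \<rho>2 h2 \<kappa>))"

definition A_dom :: "real \<Rightarrow> real \<Rightarrow> real \<Rightarrow> real \<Rightarrow> real \<Rightarrow> real \<Rightarrow> (real ^ 'd) L2 set" where
  "A_dom \<rho>1 \<rho>2 h1 h2 g \<epsilon> = {b.
     (\<integral>\<^sup>+\<kappa>. ennreal (((omega \<rho>1 \<rho>2 h1 h2 g \<kappa>)\<^sup>2 + \<epsilon>\<^sup>2) * (cmod (rep_L2 b \<kappa>))\<^sup>2) \<partial>lebesgue) < \<infinity>}"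

definition A_norm :: "real \<Rightarrow> real \<Rightarrow> real \<Rightarrow> real \<Rightarrow> real \<Rightarrow> real \<Rightarrow> (real ^ 'd) L2 \<Rightarrow> real" where
  "A_norm \<rho>1 \<rho>2 h1 h2 g \<epsilon> b =
     sqrt (LINT \<kappa>|lebesgue. (1 + (omega \<rho>1 \<rho>2 h1 h2 g \<kappa>)\<^sup>2 + \<epsilon>\<^sup>2) * (cmod (rep_L2 b \<kappa>))\<^sup>2)"

definition A_op ::
  "real \<Rightarrow> real \<Rightarrow> real \<Rightarrow> real \<Rightarrow> real \<Rightarrow> real \<Rightarrow> (real ^ 'd) L2 \<Rightarrow> (real ^ 'd) L2" where
  "A_op \<rho>1 \<rho>2 h1 h2 g \<epsilon> b = abs_L2 (\<lambda>\<kappa>. \<i> * omega_eps \<rho>1 \<rho>2 h1 h2 g \<epsilon> \<kappa> * rep_L2 b \<kappa>)"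

definition C0_A_dom ::
  "real \<Rightarrow> real \<Rightarrow> real \<Rightarrow> real \<Rightarrow> real \<Rightarrow> real \<Rightarrow> real \<Rightarrow> (real \<Rightarrow> (real ^ 'd) L2) set" where
  "C0_A_dom \<rho>1 \<rho>2 h1 h2 g \<epsilon> T = {\<mu>.
     (\<forall>t\<in>{0..T}. \<mu> t \<in> A_dom \<rho>1 \<rho>2 h1 h2 g \<epsilon>) \<and>
     (\<forall>t\<in>{0..T}. ((\<lambda>s. A_norm \<rho>1 \<rho>2 h1 h2 g \<epsilon> (\<mu> s - \<mu> t)) \<longlongrightarrow> 0) (at t within {0..T}))}"

definition is_solution ::
  "real \<Rightarrow> real \<Rightarrow> real \<Rightarrow> real \<Rightarrow> real \<Rightarrow> real \<Rightarrow> real \<Rightarrow> ennreal \<Rightarrow>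
   (real ^ 'd) L2 \<Rightarrow> (real \<Rightarrow> real ^ 'd) \<Rightarrow> (real ^ 'd) L2 \<Rightarrow> (real \<Rightarrow> (real ^ 'd) L2) \<Rightarrow> bool" where
  "is_solution \<rho>1 \<rho>2 h1 h2 g \<epsilon> T p f U \<mu>0 \<mu> \<longleftrightarrow>
     \<mu> \<in> C0_A_dom \<rho>1 \<rho>2 h1 h2 g \<epsilon> T \<inter> W1p p T \<and>
     (\<exists>\<mu>'. weak_deriv p T \<mu> \<mu>' \<and>
        (AE t in lebesgue_on {0<..<T}.
           \<mu>' t = A_op \<rho>1 \<rho>2 h1 h2 g \<epsilon> (\<mu> t) - abs_L2 (source \<rho>1 \<rho>2 h1 h2 f U t))) \<and>
     \<mu> 0 = \<mu>0"

end

theory Submission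
  imports Defs
begin

text \<open>
  The equation decouples into scalar linear equations, one for each wave vector \<open>\<kappa>\<close>, whose
  solutions are given by Duhamel's formula. Since \<open>sinh (2 \<pi> \<bar>\<kappa>\<bar> h1) (T1 + T2)\<close> dominates
  \<open>\<rho>1 cosh (2 \<pi> \<bar>\<kappa>\<bar> h1)\<close> whereas \<open>\<omega>\<^sup>2\<close> grows at most linearly in \<open>\<bar>\<kappa>\<bar>\<close>, the source is dominated by
  \<open>\<bar>U t\<bar> D \<kappa>\<close> with \<open>D\<close> square integrable even with respect to the graph norm weight
  \<open>1 + \<omega>\<^sup>2 + \<epsilon>\<^sup>2\<close>; dominated convergence then gives continuity in the graph norm. The weak equation is
  the scalar one, integrated against a test function and transferred to \<open>L\<^sup>2\<close> by Fubini.
  For uniqueness, the difference \<open>w\<close> of two solutions satisfies \<open>w' = A w\<close> weakly with \<open>A w\<close>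
  continuous, so \<open>w\<close> is continuously differentiable by the lemma of du Bois-Reymond, and its energy
  does not increase because \<open>Re \<langle>A w, w\<rangle> = - \<epsilon> \<parallel>w\<parallel>\<^sup>2 \<le> 0\<close>. All that matters about
  \<open>fourier_L2 f\<close> is that it is an element of \<open>L\<^sup>2\<close>, so Plancherel's theorem plays no role.
\<close>

text \<open>The velocity is only \<open>L\<^sup>p\<close> in time, so the Duhamel integral need not
  be differentiable at a given time, and the proof never differentiates it. The test function,
  multiplied by the exponential, carries all derivatives, and exchanging the order of integration
  over \<open>s \<le> t\<close> replaces the product rule. In the uniqueness proof this roughness
  disappears because the source cancels in the difference of two solutions. Duhamel's formula is
  used in two forms. With \<open>exp (lam x * (t - s))\<close> and \<open>s \<le> t\<close> each
  exponential has modulus at most 1, which gives bounds uniform in the wave vector. With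
  \<open>exp (lam x * t)\<close> pulled out, the bounds depend on \<open>x\<close>, but the time
  dependence splits into a smooth factor and a primitive, which gives continuity, measurability and
  the weak equation. Membership in \<open>L\<^sup>2\<close>-valued Bochner spaces also needs the
  source to be measurable as an \<open>L\<^sup>2\<close>-valued map. This is read off from its
  structure: measurable coefficients \<open>U t \<bullet> b\<close> times
  \<open>L\<^sup>2\<close>-continuous functions of the ship position.\<close>

section \<open>Smooth bump functions\<close>

text \<open>The regularity clause of \<open>test_functions\<close>. As \<open>deriv\<close> is
  total, it is the differentiability of every iterate that makes the iterates genuine
  derivatives.\<close>

definition smooth :: "(real \<Rightarrow> real) \<Rightarrow> bool" where
  "smooth f \<longleftrightarrow> (\<forall>n t. (deriv ^^ n) f differentiable (at t))"

text \<open>No formula for the iterated derivatives of \<open>f\<close> is required: an invariant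
  family around \<open>f\<close> suffices. Constants, affine substitutions, products and flat
  functions are treated by choosing such a family.\<close>

lemma smooth_coinduct:
  assumes "f \<in> S" and S: "\<And>f t. f \<in> S \<Longrightarrow> f differentiable (at t)" "\<And>f. f \<in> S \<Longrightarrow> deriv f \<in> S"
  shows "smooth f"
proof -
  have "(deriv ^^ n) f \<in> S" for n
    by (induction n) (auto simp: assms(1) S(2))
  then show ?thesis by (auto simp: smooth_def S(1))
qed

lemma smooth_differentiable: "smooth f \<Longrightarrow> f differentiable (at t)"
  unfolding smooth_def by (metis funpow_0)

lemma smooth_DERIV: "smooth f \<Longrightarrow> (f has_real_derivative deriv f t) (at t)"
  using smooth_differentiable by (simp add: DERIV_deriv_iff_real_differentiable)

lemma smooth_deriv: "smooth f \<Longrightarrow> smooth (deriv f)"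
  unfolding smooth_def by (metis funpow_Suc_right comp_apply)

lemma smooth_if_deriv:
  assumes "\<And>t. (f has_real_derivative g t) (at t)" "smooth g"
  shows "smooth f"
proof -
  have "deriv f = g" using assms(1) by (auto intro!: DERIV_imp_deriv)
  show ?thesis unfolding smooth_def
  proof (intro allI)
    fix n t show "(deriv ^^ n) f differentiable (at t)"
      using assms \<open>deriv f = g\<close>
      by (cases n) (auto simp: smooth_def real_differentiable_def funpow_Suc_right simp del: funpow.simps(2))
  qed
qed

text \<open>The product rule turns one product into a sum of two, so single products are not
  invariant under \<open>deriv\<close>, but their finite sums are. This stands in for the general
  Leibniz formula.\<close>

inductive_set sums_of_products :: "(real \<Rightarrow> real) set" where
  product: "smooth f \<Longrightarrow> smooth g \<Longrightarrow> (\<lambda>x. f x * g x) \<in> sums_of_products"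
| add: "f \<in> sums_of_products \<Longrightarrow> g \<in> sums_of_products \<Longrightarrow> (\<lambda>x. f x + g x) \<in> sums_of_products"

lemma sums_of_products_DERIV:
  "f \<in> sums_of_products \<Longrightarrow> \<exists>f'\<in>sums_of_products. \<forall>x. (f has_real_derivative f' x) (at x)"
proof (induction rule: sums_of_products.induct)
  case (product f g)
  have "(\<lambda>x. f x * deriv g x + deriv f x * g x) \<in> sums_of_products"
    using product by (intro sums_of_products.intros smooth_deriv)
  moreover have "((\<lambda>x. f x * g x) has_real_derivative f x * deriv g x + deriv f x * g x) (at x)" for x
    using product by (auto intro!: derivative_eq_intros smooth_DERIV)
  ultimately show ?case by (intro bexI[where x="\<lambda>x. f x * deriv g x + deriv f x * g x"]) auto
next
  case (add f g)
  then obtain f' g' where "f' \<in> sums_of_products" "g' \<in> sums_of_products"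
    "\<forall>x. (f has_real_derivative f' x) (at x)" "\<forall>x. (g has_real_derivative g' x) (at x)" by blast
  then show ?case
    by (intro bexI[where x="\<lambda>x. f' x + g' x"]) (auto intro!: derivative_intros sums_of_products.add)
qed

lemma sums_of_products_smooth: "f \<in> sums_of_products \<Longrightarrow> smooth f"
proof (erule smooth_coinduct)
  fix f t assume "f \<in> sums_of_products"
  from sums_of_products_DERIV[OF this] obtain f'
    where f': "f' \<in> sums_of_products" "\<And>x. (f has_real_derivative f' x) (at x)" by blast
  show "f differentiable at t" unfolding real_differentiable_def using f'(2) by blast
  have "deriv f = f'" using f'(2) by (auto intro!: DERIV_imp_deriv)
  then show "deriv f \<in> sums_of_products" using f'(1) by simp
qed

lemma smooth_mult: "smooth f \<Longrightarrow> smooth g \<Longrightarrow> smooth (\<lambda>x. f x * g x)"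
  by (rule sums_of_products_smooth[OF sums_of_products.product])

lemma smooth_const: "smooth (\<lambda>x. c)"
  by (rule smooth_coinduct[where S = "range (\<lambda>c x. c)"]) auto

text \<open>Reads the sum as \<open>f x * 1 + g x * 1\<close>, an element of
  \<open>sums_of_products\<close>.\<close>

lemma smooth_add: "smooth f \<Longrightarrow> smooth g \<Longrightarrow> smooth (\<lambda>x. f x + g x)"
  using sums_of_products_smooth[OF sums_of_products.add[OF product[OF _ smooth_const] product[OF _ smooth_const]],
      of f g 1 1] by simp

lemma smooth_diff: "smooth f \<Longrightarrow> smooth g \<Longrightarrow> smooth (\<lambda>x. f x - g x)"
  using smooth_add[OF _ smooth_mult[OF _ smooth_const], of f g "-1"] by simp

lemma smooth_affine:
  assumes "smooth f"
  shows "smooth (\<lambda>x. f (c * x + d))"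
proof (rule smooth_coinduct)
  \<comment> \<open>The factor \<open>k\<close> absorbs the powers of \<open>c\<close> that the
    chain rule produces.\<close>
  let ?S = "{\<lambda>x. k * f (c * x + d) |k f. smooth f}"
  show "(\<lambda>x. f (c * x + d)) \<in> ?S"
    using assms by (auto intro!: exI[of _ 1] exI[of _ f])
  fix h assume "h \<in> ?S"
  then obtain k f where h: "h = (\<lambda>x. k * f (c * x + d))" "smooth f" by auto
  have D: "(h has_real_derivative (k * c) * deriv f (c * x + d)) (at x)" for x
    unfolding h(1)
    by (rule derivative_eq_intros DERIV_chain2[OF smooth_DERIV[OF h(2)]] refl)+ simp
  show "h differentiable at t" for t unfolding real_differentiable_def using D by blast
  have "deriv h = (\<lambda>x. (k * c) * deriv f (c * x + d))"
    using D by (auto intro!: DERIV_imp_deriv)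
  then show "deriv h \<in> ?S" using smooth_deriv[OF h(2)] by auto
qed

text \<open>The case \<open>P = 1\<close> is the classical smooth function that vanishes to infinite
  order at 0. The polynomial factors in \<open>1/x\<close> make the family invariant under
  differentiation.\<close>

definition flat :: "real poly \<Rightarrow> real \<Rightarrow> real" where
  "flat P x = (if 0 < x then poly P (inverse x) * exp (- inverse x) else 0)"

lemma poly_exp_neg_tendsto_0: "((\<lambda>x. poly P x * exp (- x)) \<longlongrightarrow> 0) at_top" for P :: "real poly"
proof -
  have "((\<lambda>x. \<Sum>i\<le>degree P. coeff P i * (x ^ i / exp x)) \<longlongrightarrow> (\<Sum>i\<le>degree P. coeff P i * 0)) at_top"
    by (intro tendsto_intros tendsto_power_div_exp_0)
  then show ?thesis by (simp add: poly_altdef exp_minus divide_inverse sum_distrib_right mult.assoc)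
qed

text \<open>With \<open>y = 1/x\<close> the derivative of \<open>y\<close> is \<open>- y^2\<close>,
  so \<open>P(y) exp(-y)\<close> has derivative \<open>(P - P')(y) y^2 exp(-y)\<close>; the
  polynomial \<open>[:0, 0, 1:]\<close> is \<open>y^2\<close>. Only the origin needs a
  limit.\<close>

lemma flat_DERIV: "(flat P has_real_derivative flat ((P - pderiv P) * [:0, 0, 1:]) x) (at x)"
proof -
  consider "x > 0" | "x < 0" | "x = 0" by linarith
  then show ?thesis
  proof cases
    case 1
    have "((\<lambda>x. poly P (inverse x) * exp (- inverse x)) has_real_derivative
       flat ((P - pderiv P) * [:0, 0, 1:]) x) (at x)"
      using 1 unfolding flat_def
      by (auto intro!: derivative_eq_intros DERIV_chain2[OF poly_DERIV] simp: power2_eq_square field_simps)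
    moreover have "eventually (\<lambda>y. y > 0) (nhds x)"
      using 1 by (intro eventually_nhds_in_open[of "{0<..}", simplified]) auto
    ultimately show ?thesis
      by (subst DERIV_cong_ev[OF refl _ refl])
         (auto elim!: eventually_mono simp: flat_def)
  next
    case 2
    moreover have "eventually (\<lambda>y. y < 0) (nhds x)"
      using 2 by (intro eventually_nhds_in_open[of "{..<0}", simplified]) auto
    ultimately show ?thesis
      by (subst DERIV_cong_ev[of x x _ "\<lambda>_. 0"]) (auto elim!: eventually_mono simp: flat_def)
  next
    case 3
    \<comment> \<open>Dividing by \<open>h\<close> multiplies \<open>P\<close> by one more power of
      \<open>1/h\<close>, that is by \<open>[:0, 1:]\<close>, and the exponential still
      wins.\<close>
    have "((\<lambda>h. flat P h / h) \<longlongrightarrow> 0) (at_right 0)"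
    proof (rule Lim_transform_eventually)
      show "((\<lambda>h. poly (P * [:0, 1:]) (inverse h) * exp (- inverse h)) \<longlongrightarrow> 0) (at_right 0)"
        by (rule filterlim_compose[OF poly_exp_neg_tendsto_0 filterlim_inverse_at_top_right])
      show "\<forall>\<^sub>F h in at_right 0. poly (P * [:0, 1:]) (inverse h) * exp (- inverse h) = flat P h / h"
        using eventually_at_right_less[of 0] by eventually_elim (simp add: flat_def divide_inverse)
    qed
    moreover have "((\<lambda>h. flat P h / h) \<longlongrightarrow> 0) (at_left 0)"
      by (rule tendsto_eventually) (auto simp: flat_def eventually_at_filter)
    ultimately have "((\<lambda>h. flat P h / h) \<longlongrightarrow> 0) (at 0)"
      by (rule filterlim_split_at[rotated])
    then show ?thesis unfolding 3 DERIV_def by (simp add: flat_def)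
  qed
qed

lemma smooth_flat: "smooth (flat P)"
proof (rule smooth_coinduct[where S = "range flat"])
  fix f assume "f \<in> range flat"
  then obtain P where f: "f = flat P" by auto
  show "f differentiable at t" for t unfolding f real_differentiable_def using flat_DERIV by blast
  have "deriv f = flat ((P - pderiv P) * [:0, 0, 1:])"
    unfolding f using flat_DERIV by (auto intro!: DERIV_imp_deriv)
  then show "deriv f \<in> range flat" by simp
qed simp

text \<open>Each factor switches off one half-line, so the product lives on the open interval from
  \<open>-d\<close> to \<open>d\<close>.\<close>

definition bump :: "real \<Rightarrow> real \<Rightarrow> real" where
  "bump d x = flat 1 (d + x) * flat 1 (d - x)"

lemma smooth_bump: "smooth (bump d)"
  unfolding bump_def
  using smooth_mult[OF smooth_affine[OF smooth_flat] smooth_affine[OF smooth_flat], of 1 1 d 1 "-1" d]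
  by (simp add: add.commute)

lemma bump_nonneg: "0 \<le> bump d x"
  by (simp add: bump_def flat_def)

lemma bump_pos: "0 < d \<Longrightarrow> 0 < bump d 0"
  by (simp add: bump_def flat_def)

lemma bump_eq_0: "d \<le> \<bar>x\<bar> \<Longrightarrow> bump d x = 0"
  by (auto simp: bump_def flat_def)

lemma continuous_on_smooth: "smooth f \<Longrightarrow> continuous_on S f"
  by (intro differentiable_imp_continuous_on differentiable_at_imp_differentiable_on smooth_differentiable)

text \<open>Provides a smooth step with a constant plateau. The difference of two translates has
  compact support, since the plateaus cancel, and its derivative is a difference of two
  bumps.\<close>

lemma bump_antiderivative:
  assumes "0 < d"
  obtains H where "\<And>x. (H has_real_derivative bump d x) (at x)"
    "\<And>x. x \<le> -d \<Longrightarrow> H x = 0" "\<And>x. d \<le> x \<Longrightarrow> H x = H d"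
proof
  \<comment> \<open>Starting one unit to the left of the support makes every
    \<open>x \<ge> -d\<close> an interior point of \<open>{-d-1..x+1}\<close>.\<close>
  define H where "H x = integral {-d-1..x} (bump d)" for x
  have 0: "H x = 0" if "x \<le> -d" for x
    unfolding H_def using that assms by (intro integral_unique has_integral_is_0) (auto simp: bump_eq_0)
  then show "H x = 0" if "x \<le> -d" for x using that .
  show D: "(H has_real_derivative bump d x) (at x)" for x
  proof (cases "x < -d")
    case True
    moreover have "eventually (\<lambda>y. y < -d) (nhds x)"
      using True by (intro eventually_nhds_in_open[of "{..<-d}", simplified]) auto
    ultimately show ?thesis
      by (subst DERIV_cong_ev[of x x _ "\<lambda>_. 0"]) (auto elim!: eventually_mono simp: bump_eq_0 0)
  next
    case False
    then have "(H has_real_derivative bump d x) (at x within {-d-1..x+1})"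
      unfolding H_def
      by (intro integral_has_real_derivative continuous_on_smooth smooth_bump) auto
    then show ?thesis using False by (subst (asm) at_within_interior) auto
  qed
  show "H x = H d" if "d \<le> x" for x
  proof (cases "d = x")
    case False
    have "\<exists>z. d < z \<and> z < x \<and> H x - H d = (x - d) * bump d z"
      using that False by (intro MVT2) (auto intro: D)
    then show ?thesis using assms by (auto simp: bump_eq_0)
  qed simp
qed

section \<open>The lemma of du Bois-Reymond\<close>

lemma test_functions_iff:
  "\<phi> \<in> test_functions T \<longleftrightarrow> smooth \<phi> \<and> (\<exists>a b. 0 < a \<and> b < T \<and> (\<forall>t. t \<notin> {a..b} \<longrightarrow> \<phi> t = 0))"
  by (auto simp: test_functions_def smooth_def)

lemma test_functions_boundary:
  "\<phi> \<in> test_functions T \<Longrightarrow> 0 < T \<Longrightarrow> \<phi> 0 = 0 \<and> \<phi> T = 0"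
  by (force simp: test_functions_iff)

lemma test_functions_smooth: "\<phi> \<in> test_functions T \<Longrightarrow> smooth \<phi>"
  by (simp add: test_functions_iff)

lemma integrable_lebesgue_on_mono:
  fixes f :: "'a::euclidean_space \<Rightarrow> 'b::{banach, second_countable_topology}"
  assumes "integrable (lebesgue_on S) f" "S' \<subseteq> S" "S \<in> sets lebesgue" "S' \<in> sets lebesgue"
  shows "integrable (lebesgue_on S') f"
  using set_integrable_subset[of lebesgue S f S'] assms
  by (simp add: set_integrable_def integrable_restrict_space)

lemma lebesgue_on_interval_eq_integral:
  fixes f :: "real \<Rightarrow> real"
  assumes "continuous_on {a..b} f"
  shows "integrable (lebesgue_on {a<..<b}) f" "(LINT t|lebesgue_on {a<..<b}. f t) = integral {a..b} f"
proof -
  have "integrable (lebesgue_on {a..b}) f"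
    by (rule continuous_imp_integrable_real[OF assms])
  then show i: "integrable (lebesgue_on {a<..<b}) f"
    by (rule integrable_lebesgue_on_mono) auto
  show "(LINT t|lebesgue_on {a<..<b}. f t) = integral {a..b} f"
    using lebesgue_integral_eq_integral[OF i] integral_open_interval_real[of a b f] by simp
qed

text \<open>Subtracting the primitive \<open>N\<close> of \<open>v\<close> leaves a continuous
  \<open>z\<close> with vanishing weak derivative. If \<open>z a < z b\<close>, a test function that
  rises near \<open>a\<close> and falls by the same amount near \<open>b\<close> detects the
  difference, so \<open>z\<close> is constant.\<close>

lemma du_bois_reymond_real:
  fixes u v :: "real \<Rightarrow> real"
  assumes T: "0 < T" and u: "continuous_on {0..T} u" and v: "continuous_on {0..T} v"
    and weak: "\<And>\<phi>. \<phi> \<in> test_functions T \<Longrightarrow>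
      (LINT t|lebesgue_on {0<..<T}. deriv \<phi> t * u t) = - (LINT t|lebesgue_on {0<..<T}. \<phi> t * v t)"
    and t: "t \<in> {0..T}"
  shows "u t = u 0 + integral {0..t} v"
proof -
  define N where "N t = integral {0..t} v" for t
  define z where "z t = u t - N t" for t
  have N': "(N has_real_derivative v t) (at t within {0..T})" if "t \<in> {0..T}" for t
    unfolding N_def using integral_has_real_derivative[OF v that] .
  have N: "continuous_on {0..T} N"
    using N' by (rule DERIV_continuous_on)
  have z: "continuous_on {0..T} z"
    unfolding z_def by (intro continuous_intros u N)
  \<comment> \<open>Combines the weak equation with the fundamental theorem for
    \<open>\<phi> t * (N t + c)\<close>, whose boundary values vanish. The free constant
    \<open>c\<close> is later the level between \<open>z a\<close> and \<open>z b\<close> that gives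
    the integrand a sign.\<close>
  have z_weak: "integral {0..T} (\<lambda>t. deriv \<phi> t * (z t - c)) = 0" if \<phi>: "\<phi> \<in> test_functions T" for \<phi> c
  proof -
    have s: "smooth \<phi>" using test_functions_smooth[OF \<phi>] .
    have cont: "continuous_on {0..T} \<phi>" "continuous_on {0..T} (deriv \<phi>)"
      using s by (auto intro: continuous_on_smooth smooth_deriv)
    have "((\<lambda>t. deriv \<phi> t * (N t + c) + \<phi> t * v t) has_integral \<phi> T * (N T + c) - \<phi> 0 * (N 0 + c)) {0..T}"
    proof (rule fundamental_theorem_of_calculus)
      fix t assume "t \<in> {0..T}"
      then have "((\<lambda>t. \<phi> t * (N t + c)) has_real_derivative deriv \<phi> t * (N t + c) + \<phi> t * v t) (at t within {0..T})"
        by (auto intro!: derivative_eq_intros N' has_field_derivative_at_within[OF smooth_DERIV[OF s]])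
      then show "((\<lambda>t. \<phi> t * (N t + c)) has_vector_derivative deriv \<phi> t * (N t + c) + \<phi> t * v t) (at t within {0..T})"
        by (simp add: has_real_derivative_iff_has_vector_derivative)
    qed (use T in simp)
    then have 1: "((\<lambda>t. deriv \<phi> t * (N t + c) + \<phi> t * v t) has_integral 0) {0..T}"
      using test_functions_boundary[OF \<phi> T] by simp
    have "integral {0..T} (\<lambda>t. deriv \<phi> t * u t) = - integral {0..T} (\<lambda>t. \<phi> t * v t)"
      using weak[OF \<phi>] by (simp add: lebesgue_on_interval_eq_integral continuous_intros cont u v)
    then have 2: "((\<lambda>t. deriv \<phi> t * u t) has_integral - integral {0..T} (\<lambda>t. \<phi> t * v t)) {0..T}"
      by (metis integrable_integral integrable_continuous_interval continuous_on_mult cont(2) u)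
    have 3: "((\<lambda>t. \<phi> t * v t) has_integral integral {0..T} (\<lambda>t. \<phi> t * v t)) {0..T}"
      by (intro integrable_integral integrable_continuous_interval continuous_intros cont v)
    have "((\<lambda>t. deriv \<phi> t * (z t - c)) has_integral 0) {0..T}"
      using has_integral_add[OF has_integral_diff[OF 2 1] 3] by (simp add: z_def algebra_simps)
    then show ?thesis by (rule integral_unique)
  qed
  have z_not_less: "\<not> z a < z b" if ab: "a \<in> {0<..<T}" "b \<in> {0<..<T}" for a b
  proof
    assume less: "z a < z b"
    define c where "c = (z a + z b) / 2"
    have c: "z a < c" "c < z b" using less by (auto simp: c_def)
    have "continuous (at a) z" "continuous (at b) z"
      using z ab by (auto simp: continuous_on_interior)
    then have "\<forall>\<^sub>F s in nhds a. s \<in> {0<..<T} \<and> z s < c" "\<forall>\<^sub>F s in nhds b. s \<in> {0<..<T} \<and> z s > c"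
      using c ab by (auto intro!: eventually_conj eventually_nhds_in_open order_tendstoD
          simp: continuous_within tendsto_at_iff_tendsto_nhds simp del: greaterThanLessThan_iff)
    then obtain d1 d2 where d12: "d1 > 0" "\<And>s. dist s a < d1 \<Longrightarrow> s \<in> {0<..<T} \<and> z s < c"
       "d2 > 0" "\<And>s. dist s b < d2 \<Longrightarrow> s \<in> {0<..<T} \<and> z s > c"
      unfolding eventually_nhds_metric by blast
    \<comment> \<open>Halving turns the strict distance bounds into closed ones, so the sign of
      \<open>z - c\<close> is known on both supports including their ends, and these stay inside the
      open time interval.\<close>
    define d where "d = min d1 d2 / 2"
    have d: "d > 0" "\<And>s. \<bar>s - a\<bar> \<le> d \<Longrightarrow> s \<in> {0<..<T} \<and> z s < c"
       "\<And>s. \<bar>s - b\<bar> \<le> d \<Longrightarrow> s \<in> {0<..<T} \<and> z s > c"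
      using d12 by (auto simp: d_def dist_real_def)
    obtain H where H: "\<And>x. (H has_real_derivative bump d x) (at x)"
      "\<And>x. x \<le> -d \<Longrightarrow> H x = 0" "\<And>x. d \<le> x \<Longrightarrow> H x = H d"
      using bump_antiderivative[OF d(1)] by metis
    \<comment> \<open>Equal plateaus cancel to the right of both points, whichever of
      \<open>a\<close> and \<open>b\<close> comes first.\<close>
    define \<phi> where "\<phi> x = H (x - a) - H (x - b)" for x
    have H_smooth: "smooth H" by (rule smooth_if_deriv[OF H(1) smooth_bump])
    have "smooth \<phi>"
      unfolding \<phi>_def using smooth_affine[OF H_smooth, of 1 "-a"] smooth_affine[OF H_smooth, of 1 "-b"]
      by (intro smooth_diff) auto
    moreover have "\<phi> t = 0" if "t \<notin> {min a b - d..max a b + d}" for t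
      using that H(2)[of "t - a"] H(2)[of "t - b"] H(3)[of "t - a"] H(3)[of "t - b"]
      by (auto simp: \<phi>_def)
    moreover have "0 < min a b - d" "max a b + d < T"
      using d(2)[of "a - d"] d(3)[of "b - d"] d(2)[of "a + d"] d(3)[of "b + d"] d(1) by auto
    ultimately have \<phi>: "\<phi> \<in> test_functions T"
      unfolding test_functions_iff by blast
    have \<phi>': "deriv \<phi> x = bump d (x - a) - bump d (x - b)" for x
      unfolding \<phi>_def
      by (intro DERIV_imp_deriv) (rule derivative_eq_intros DERIV_chain2[OF H(1)] refl | simp)+
    \<comment> \<open>Minus the integrand of \<open>z_weak\<close>. The bump at \<open>b\<close>
      lives where \<open>z > c\<close> and the bump at \<open>a\<close> where \<open>z < c\<close>,
      so \<open>k\<close> is nonnegative although its integral is zero; yet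
      \<open>k a > 0\<close>.\<close>
    define k where "k x = (bump d (x - b) - bump d (x - a)) * (z x - c)" for x
    have k_nonneg: "0 \<le> bump d (x - b) * (z x - c)" "0 \<le> bump d (x - a) * (c - z x)" for x
      using d(2)[of x] d(3)[of x] bump_eq_0[of d "x - a"] bump_eq_0[of d "x - b"]
        bump_nonneg[of d "x - a"] bump_nonneg[of d "x - b"]
      by (cases "\<bar>x - b\<bar> \<le> d"; cases "\<bar>x - a\<bar> \<le> d"; force)+
    have k_eq: "k x = bump d (x - b) * (z x - c) + bump d (x - a) * (c - z x)" for x
      by (simp add: k_def algebra_simps)
    have bump_cont: "continuous_on S (\<lambda>x. bump d (x - e))" for S e
      using continuous_on_smooth[OF smooth_affine[OF smooth_bump, of d 1 "-e"]] by simp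
    have "continuous_on {0..T} k"
      unfolding k_def by (intro continuous_intros bump_cont z)
    moreover have "integral {0..T} k = 0"
    proof -
      have "k = (\<lambda>t. - (deriv \<phi> t * (z t - c)))"
        by (simp add: fun_eq_iff k_def \<phi>' algebra_simps)
      then show ?thesis using z_weak[OF \<phi>, of c] by (simp only: integral_neg minus_zero)
    qed
    moreover have "0 \<le> k x" for x
      unfolding k_eq by (intro add_nonneg_nonneg k_nonneg)
    ultimately have "\<forall>x\<in>{0..T}. k x = 0"
      using T by (simp only: integral_eq_0_iff)
    then have "k a = 0" using ab by simp
    moreover have "0 < bump d (a - a) * (c - z a)"
      using bump_pos[OF d(1)] c by simp
    ultimately show False using k_nonneg(1)[of a] by (simp add: k_eq)
  qed
  have const: "z s = z (T/2)" if "s \<in> {0<..<T}" for s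
  proof -
    have "T/2 \<in> {0<..<T}" using T by simp
    from z_not_less[OF this that] z_not_less[OF that this]
    show ?thesis by simp
  qed
  have "z s = z (T/2)" if "s \<in> {0..T}" for s
  proof (rule continuous_constant_on_closure[where S = "{0<..<T}" and f = z])
    have "closure {0<..<T} = {0..T}" using T by simp
    then show "continuous_on (closure {0<..<T}) z" "s \<in> closure {0<..<T}" using z that by auto
  qed (rule const)
  from this[OF t] this[of 0] show ?thesis using T by (simp add: z_def N_def)
qed

text \<open>Pairing with each vector \<open>h\<close> reduces to the real case; the hypotheses
  \<open>int\<close> let the inner product pass under the Bochner integrals. Continuity of
  \<open>v\<close> then turns the integral identity into a classical derivative.\<close>

lemma du_bois_reymond:
  fixes u v :: "real \<Rightarrow> 'b::{real_inner, banach, second_countable_topology}"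
  assumes T: "0 < T" and u: "continuous_on {0..T} u" and v: "continuous_on {0..T} v"
    and int: "\<And>\<phi>. \<phi> \<in> test_functions T \<Longrightarrow> integrable (lebesgue_on {0<..<T}) (\<lambda>t. deriv \<phi> t *\<^sub>R u t)"
      "\<And>\<phi>. \<phi> \<in> test_functions T \<Longrightarrow> integrable (lebesgue_on {0<..<T}) (\<lambda>t. \<phi> t *\<^sub>R v t)"
    and weak: "\<And>\<phi>. \<phi> \<in> test_functions T \<Longrightarrow>
      (LINT t|lebesgue_on {0<..<T}. deriv \<phi> t *\<^sub>R u t) = - (LINT t|lebesgue_on {0<..<T}. \<phi> t *\<^sub>R v t)"
    and t: "t \<in> {0..T}"
  shows "(u has_vector_derivative v t) (at t within {0..T})"
proof -
  have *: "u t = u 0 + integral {0..t} v" if t: "t \<in> {0..T}" for t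
  proof (rule vector_eq_rdot[THEN iffD1], rule allI)
    fix h
    have "inner (u t) h = inner (u 0) h + integral {0..t} (\<lambda>s. inner (v s) h)"
    proof (rule du_bois_reymond_real[OF T _ _ _ t, where u = "\<lambda>s. inner (u s) h"])
      fix \<phi> assume \<phi>: "\<phi> \<in> test_functions T"
      have "(LINT t|lebesgue_on {0<..<T}. inner (deriv \<phi> t *\<^sub>R u t) h) =
        - (LINT t|lebesgue_on {0<..<T}. inner (\<phi> t *\<^sub>R v t) h)"
        by (simp only: weak[OF \<phi>] integral_inner_left[OF int(1)[OF \<phi>]] integral_inner_left[OF int(2)[OF \<phi>]]
            inner_minus_left)
      then show "(LINT t|lebesgue_on {0<..<T}. deriv \<phi> t * inner (u t) h) =
        - (LINT t|lebesgue_on {0<..<T}. \<phi> t * inner (v t) h)"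
        by simp
    qed (use T u v in \<open>auto intro!: continuous_on_inner continuous_on_const\<close>)
    also have "integral {0..t} (\<lambda>s. inner (v s) h) = inner (integral {0..t} v) h"
      using integral_linear[OF _ bounded_linear_inner_left, of v "{0..t}" h] t
      by (simp add: o_def integrable_continuous_interval continuous_on_subset[OF v])
    finally show "inner (u t) h = inner (u 0 + integral {0..t} v) h"
      by (simp add: inner_add_left)
  qed
  show ?thesis
  proof (rule has_vector_derivative_transform[OF t])
    show "((\<lambda>t. u 0 + integral {0..t} v) has_vector_derivative v t) (at t within {0..T})"
      using has_vector_derivative_add[OF has_vector_derivative_const integral_has_vector_derivative[OF v t]]
      by simp
  qed (rule *)
qed

section \<open>Integration of functions with values in \<open>L\<^sup>2\<close>\<close>

lemma sigma_finite_lebesgue: "sigma_finite_measure (lebesgue :: 'a::euclidean_space measure)"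
proof
  show "\<exists>A::'a set set. countable A \<and> A \<subseteq> sets lebesgue \<and> \<Union>A = space lebesgue \<and>
      (\<forall>a\<in>A. emeasure lebesgue a \<noteq> \<infinity>)"
    by (intro exI[of _ "range (\<lambda>n::nat. box (- real n *\<^sub>R One) (real n *\<^sub>R One))"])
       (auto simp: emeasure_lborel_cbox_eq UN_box_eq_UNIV)
qed

lemma square_integrable_dominated:
  fixes f :: "'a::euclidean_space \<Rightarrow> complex"
  assumes "f \<in> borel_measurable lebesgue" "\<And>x. cmod (f x) \<le> D x" "integrable lebesgue (\<lambda>x. (D x)\<^sup>2)"
  shows "square_integrable f"
  by (rule square_integrable_bound[OF assms(1,3)]) (intro power_mono assms(2) norm_ge_zero)

lemma norm_abs_L2_le:
  fixes f :: "'a::euclidean_space \<Rightarrow> complex"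
  assumes "f \<in> borel_measurable lebesgue" "\<And>x. cmod (f x) \<le> c * D x" "integrable lebesgue (\<lambda>x. (D x)\<^sup>2)" "0 \<le> c"
  shows "norm (abs_L2 f) \<le> c * sqrt (LINT x|lebesgue. (D x)\<^sup>2)"
proof -
  have i: "integrable lebesgue (\<lambda>x. (c * D x)\<^sup>2)"
    using assms(3) by (simp add: power_mult_distrib)
  have f: "square_integrable f"
    by (rule square_integrable_dominated[OF assms(1,2) i])
  have "(norm (abs_L2 f))\<^sup>2 = (LINT x|lebesgue. (cmod (f x))\<^sup>2)"
    by (rule norm_abs_L2[OF f])
  also have "\<dots> \<le> (LINT x|lebesgue. (c * D x)\<^sup>2)"
    using f i by (intro integral_mono power_mono assms(2)) (auto simp: square_integrable_def)
  also have "\<dots> = c\<^sup>2 * (LINT x|lebesgue. (D x)\<^sup>2)"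
    by (simp add: power_mult_distrib)
  finally have "sqrt ((norm (abs_L2 f))\<^sup>2) \<le> sqrt (c\<^sup>2 * (LINT x|lebesgue. (D x)\<^sup>2))"
    by (rule real_sqrt_le_mono)
  then show ?thesis using \<open>0 \<le> c\<close> by (simp add: real_sqrt_mult)
qed

text \<open>Along a sequence this is dominated convergence for the squared pointwise difference,
  with majorant \<open>4 * (D x)\<^sup>2\<close>.\<close>

lemma continuous_on_abs_L2:
  fixes \<Phi> :: "'t::metric_space \<Rightarrow> 'a::euclidean_space \<Rightarrow> complex"
  assumes meas: "\<And>t. t \<in> S \<Longrightarrow> \<Phi> t \<in> borel_measurable lebesgue"
    and bound: "\<And>t x. t \<in> S \<Longrightarrow> cmod (\<Phi> t x) \<le> D x" and D: "integrable lebesgue (\<lambda>x. (D x)\<^sup>2)"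
    and cont: "\<And>x. continuous_on S (\<lambda>t. \<Phi> t x)"
  shows "continuous_on S (\<lambda>t. abs_L2 (\<Phi> t))"
  unfolding continuous_on_sequentially
proof (intro allI ballI impI, elim conjE)
  fix X t assume X: "\<forall>n. X n \<in> S" "X \<longlonglongrightarrow> t" and t: "t \<in> S"
  have sq: "square_integrable (\<Phi> s)" if "s \<in> S" for s
    by (rule square_integrable_dominated[OF meas[OF that] bound[OF that] D])
  have [measurable]: "\<Phi> t \<in> borel_measurable lebesgue" "\<Phi> (X n) \<in> borel_measurable lebesgue" for n
    using meas t X by auto
  have "(\<lambda>n. LINT x|lebesgue. (cmod (\<Phi> (X n) x - \<Phi> t x))\<^sup>2) \<longlonglongrightarrow> (LINT x|(lebesgue::'a measure). 0)"
  proof (rule integral_dominated_convergence)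
    show "integrable lebesgue (\<lambda>x. 4 * (D x)\<^sup>2)" using D by simp
    show "AE x in lebesgue. (\<lambda>n. (cmod (\<Phi> (X n) x - \<Phi> t x))\<^sup>2) \<longlonglongrightarrow> 0"
    proof (rule AE_I2)
      fix x
      have "(\<lambda>n. \<Phi> (X n) x) \<longlonglongrightarrow> \<Phi> t x"
        using cont[of x] X t unfolding continuous_on_sequentially by (auto simp: o_def)
      then show "(\<lambda>n. (cmod (\<Phi> (X n) x - \<Phi> t x))\<^sup>2) \<longlonglongrightarrow> 0"
        by (intro tendsto_null_power tendsto_norm_zero) (auto simp: LIM_zero)
    qed
    show "AE x in lebesgue. norm ((cmod (\<Phi> (X n) x - \<Phi> t x))\<^sup>2) \<le> 4 * (D x)\<^sup>2" for n
    proof (rule AE_I2)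
      fix x
      have "cmod (\<Phi> (X n) x - \<Phi> t x) \<le> 2 * D x"
        using norm_triangle_ineq4[of "\<Phi> (X n) x" "\<Phi> t x"] bound[of "X n" x] bound[of t x] X t by simp
      from power_mono[OF this, of 2]
      show "norm ((cmod (\<Phi> (X n) x - \<Phi> t x))\<^sup>2) \<le> 4 * (D x)\<^sup>2"
        by (simp add: power_mult_distrib)
    qed
  qed measurable
  then have "(\<lambda>n. (norm (abs_L2 (\<Phi> (X n)) - abs_L2 (\<Phi> t)))\<^sup>2) \<longlonglongrightarrow> 0"
    using X t by (simp add: abs_L2_diff sq norm_abs_L2 square_integrable_diff)
  then have "(\<lambda>n. sqrt ((norm (abs_L2 (\<Phi> (X n)) - abs_L2 (\<Phi> t)))\<^sup>2)) \<longlonglongrightarrow> sqrt 0"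
    by (rule tendsto_real_sqrt)
  then have "(\<lambda>n. norm (abs_L2 (\<Phi> (X n)) - abs_L2 (\<Phi> t))) \<longlonglongrightarrow> 0" by simp
  then show "((\<lambda>t. abs_L2 (\<Phi> t)) \<circ> X) \<longlonglongrightarrow> abs_L2 (\<Phi> t)"
    unfolding o_def by (rule LIM_zero_cancel[OF tendsto_norm_zero_cancel])
qed

lemma integrable_abs_L2:
  fixes F :: "'t \<Rightarrow> 'a::euclidean_space \<Rightarrow> complex"
  assumes "\<And>t. t \<in> space M \<Longrightarrow> F t \<in> borel_measurable lebesgue"
    and "(\<lambda>t. abs_L2 (F t)) \<in> borel_measurable M"
    and "\<And>t x. t \<in> space M \<Longrightarrow> cmod (F t x) \<le> a t * D x" "\<And>t. 0 \<le> a t" "integrable M a"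
    and "integrable lebesgue (\<lambda>x. (D x)\<^sup>2)"
  shows "integrable M (\<lambda>t. abs_L2 (F t))"
proof (rule Bochner_Integration.integrable_bound)
  show "integrable M (\<lambda>t. a t * sqrt (LINT x|lebesgue. (D x)\<^sup>2))" using assms(5) by simp
  show "AE t in M. norm (abs_L2 (F t)) \<le> norm (a t * sqrt (LINT x|lebesgue. (D x)\<^sup>2))"
    using assms by (intro AE_I2 order_trans[OF norm_abs_L2_le[of _ "a _"]]) auto
qed fact

text \<open>Tested against its own value, the Bochner integral becomes an iterated scalar integral.\<close>

lemma integral_abs_L2_eq_0:
  fixes F :: "'t \<Rightarrow> 'a::euclidean_space \<Rightarrow> complex"
  assumes M: "sigma_finite_measure M"
    and F[measurable]: "(\<lambda>(t, x). F t x) \<in> borel_measurable (M \<Otimes>\<^sub>M lebesgue)"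
    and FL: "(\<lambda>t. abs_L2 (F t)) \<in> borel_measurable M"
    and bound: "\<And>t x. t \<in> space M \<Longrightarrow> cmod (F t x) \<le> a t * D x" and a: "\<And>t. 0 \<le> a t" "integrable M a"
    and D: "D \<in> borel_measurable lebesgue" "\<And>x. 0 \<le> D x" "integrable lebesgue (\<lambda>x. (D x)\<^sup>2)"
    and zero: "\<And>x. (LINT t|M. F t x) = 0"
  shows "(LINT t|M. abs_L2 (F t)) = 0"
proof -
  interpret M: sigma_finite_measure M by fact
  interpret L: sigma_finite_measure "lebesgue :: 'a measure" by (rule sigma_finite_lebesgue)
  interpret P: pair_sigma_finite M "lebesgue :: 'a measure" ..
  define h where "h = (LINT t|M. abs_L2 (F t))"
  define r where "r = rep_L2 h"
  have r: "square_integrable r" "abs_L2 r = h"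
    by (simp_all add: r_def square_integrable_rep_L2)
  have [measurable]: "r \<in> borel_measurable lebesgue" "D \<in> borel_measurable lebesgue" "a \<in> borel_measurable M"
    using r D a by (auto simp: square_integrable_def)
  have cnj: "cnj \<in> borel_measurable borel"
    by (intro borel_measurable_continuous_onI continuous_intros)
  have Ft: "F t \<in> borel_measurable lebesgue" if "t \<in> space M" for t
    using measurable_compose[OF measurable_Pair1'[OF that] F] by simp
  have Fx: "(\<lambda>t. F t x) \<in> borel_measurable M" for x
    using measurable_compose[OF measurable_Pair2'[of x lebesgue M] F] by simp
  have sq: "square_integrable (F t)" if "t \<in> space M" for t
    using that D(3)
    by (intro square_integrable_dominated[OF Ft bound]) (simp_all only: power_mult_distrib integrable_mult_right)
  have iFL: "integrable M (\<lambda>t. abs_L2 (F t))"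
    using Ft FL bound a D(3) by (rule integrable_abs_L2)
  have iF: "integrable M (\<lambda>t. F t x)" for x
  proof (rule Bochner_Integration.integrable_bound[OF _ Fx])
    show "integrable M (\<lambda>t. a t * D x)" using a(2) by (rule integrable_mult_left)
    show "AE t in M. norm (F t x) \<le> norm (a t * D x)"
      using bound a D(2) by (intro AE_I2) simp
  qed
  have iDr: "integrable lebesgue (\<lambda>x. D x * cmod (r x))"
  proof (rule Bochner_Integration.integrable_bound)
    show "integrable lebesgue (\<lambda>x. (D x)\<^sup>2 + (cmod (r x))\<^sup>2)"
      using D r by (simp add: square_integrable_def)
    have "D x * cmod (r x) \<le> (D x)\<^sup>2 + (cmod (r x))\<^sup>2" for x
      using sum_squares_bound[of "D x" "cmod (r x)"] D(2)[of x] mult_nonneg_nonneg[OF D(2)[of x] norm_ge_zero[of "r x"]]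
      by linarith
    then show "AE x in lebesgue. norm (D x * cmod (r x)) \<le> norm ((D x)\<^sup>2 + (cmod (r x))\<^sup>2)"
      using D(2) by (intro AE_I2) simp
  qed measurable
  \<comment> \<open>The majorant \<open>a t * (D x * cmod (r x))\<close> separates the variables,
    with an integrable factor in each, which is what Fubini requires.\<close>
  have int: "integrable (M \<Otimes>\<^sub>M lebesgue) (\<lambda>(t, x). Re (F t x * cnj (r x)))"
  proof (rule Bochner_Integration.integrable_bound)
    show "integrable (M \<Otimes>\<^sub>M lebesgue) (\<lambda>(t, x). a t * (D x * cmod (r x)))"
    proof (rule P.Fubini_integrable)
      show "(\<lambda>(t, x). a t * (D x * cmod (r x))) \<in> borel_measurable (M \<Otimes>\<^sub>M lebesgue)" by measurable
      have "(LINT x|lebesgue. norm (a t * (D x * cmod (r x)))) = a t * (LINT x|lebesgue. D x * cmod (r x))" for t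
        using a(1)[of t] D(2) by (simp add: abs_mult)
      then show "integrable M (\<lambda>t. LINT x|lebesgue. norm (case (t, x) of (t, x) \<Rightarrow> a t * (D x * cmod (r x))))"
        using a(2) by simp
      show "AE t in M. integrable lebesgue (\<lambda>x. case (t, x) of (t, x) \<Rightarrow> a t * (D x * cmod (r x)))"
        using iDr by simp
    qed
    have [measurable]: "(\<lambda>x. cnj (r x)) \<in> borel_measurable lebesgue"
      using cnj by (rule measurable_compose[rotated]) measurable
    show "(\<lambda>(t, x). Re (F t x * cnj (r x))) \<in> borel_measurable (M \<Otimes>\<^sub>M lebesgue)" by measurable
    show "AE p in M \<Otimes>\<^sub>M lebesgue. norm (case p of (t, x) \<Rightarrow> Re (F t x * cnj (r x))) \<le>
        norm (case p of (t, x) \<Rightarrow> a t * (D x * cmod (r x)))"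
    proof (rule AE_I2, clarsimp simp: space_pair_measure)
      fix t x assume t: "t \<in> space M"
      have "\<bar>Re (F t x * cnj (r x))\<bar> \<le> cmod (F t x) * cmod (r x)"
        using abs_Re_le_cmod[of "F t x * cnj (r x)"] by (simp add: norm_mult)
      also have "\<dots> \<le> a t * D x * cmod (r x)"
        by (intro mult_right_mono bound t) simp
      finally show "\<bar>Re (F t x) * Re (r x) + Im (F t x) * Im (r x)\<bar> \<le> \<bar>a t * (D x * cmod (r x))\<bar>"
        using a(1)[of t] D(2)[of x] by (simp add: abs_mult)
    qed
  qed
  have "inner h h = (LINT t|M. inner (abs_L2 (F t)) h)"
    unfolding h_def using integral_inner_left[of h, OF iFL] by (simp add: h_def)
  also have "\<dots> = (LINT t|M. LINT x|lebesgue. Re (F t x * cnj (r x)))"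
    using sq r by (intro Bochner_Integration.integral_cong refl) (simp flip: r(2) add: inner_L2.abs_eq)
  also have "\<dots> = (LINT x|lebesgue. LINT t|M. Re (F t x * cnj (r x)))"
    by (rule P.Fubini_integral[symmetric]) (use int in simp)
  also have "\<dots> = (LINT x|(lebesgue::'a measure). 0)"
  proof (intro Bochner_Integration.integral_cong refl)
    fix x
    have "(LINT t|M. Re (F t x * cnj (r x))) = Re (LINT t|M. F t x * cnj (r x))"
      by (rule integral_Re) (intro integrable_mult_left iF)
    also have "(LINT t|M. F t x * cnj (r x)) = 0"
      by (simp only: integral_mult_left_zero zero mult_zero_left)
    finally show "(LINT t|M. Re (F t x * cnj (r x))) = 0" by simp
  qed
  finally show ?thesis by (simp add: h_def)
qed

section \<open>Lebesgue spaces and integration by parts on a bounded time interval\<close>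

lemma finite_measure_open_interval: "finite_measure (lebesgue_on {a<..<b::real})"
  by (rule finite_measure_lebesgue_on) auto

text \<open>Constants belong to \<open>L\<^sup>p\<close> of a finite measure, so a bound affine in
  \<open>norm (u t)\<close> is enough. For finite exponents it rests on
  \<open>1 + s \<le> 2 * max 1 s\<close> and
  \<open>max 1 s powr q \<le> 1 + s powr q\<close>.\<close>

lemma Lp_space_dominated:
  fixes u :: "'t \<Rightarrow> 'b::{banach, second_countable_topology}" and v :: "'t \<Rightarrow> 'c::{banach, second_countable_topology}"
  assumes "finite_measure M" and p: "1 \<le> p" and u: "u \<in> Lp_space p M" and v: "v \<in> borel_measurable M"
    and le: "\<And>t. t \<in> space M \<Longrightarrow> norm (v t) \<le> c * (1 + norm (u t))"
  shows "v \<in> Lp_space p M"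
proof -
  interpret finite_measure M by fact
  \<comment> \<open>The given \<open>c\<close> may be negative when \<open>M\<close> has empty
    space; the monotonicity arguments want a nonnegative factor.\<close>
  define c' where "c' = max c 0"
  have c': "0 \<le> c'" "norm (v t) \<le> c' * (1 + norm (u t))" if "t \<in> space M" for t
    using le[OF that] mult_right_mono[of c c' "1 + norm (u t)"] by (auto simp: c'_def)
  have [measurable]: "u \<in> borel_measurable M" using u by (simp add: Lp_space_def)
  note v[measurable]
  show ?thesis
  proof (cases "p = \<infinity>")
    case True
    then obtain C where "AE t in M. norm (u t) \<le> C" using u by (auto simp: Lp_space_def)
    then have "AE t in M. norm (v t) \<le> c' * (1 + C)"
    proof (rule AE_mp, intro AE_I2 impI)
      fix t assume "t \<in> space M" "norm (u t) \<le> C"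
      then show "norm (v t) \<le> c' * (1 + C)"
        using c'[of t] by (intro order_trans[OF c'(2) mult_left_mono]) auto
    qed
    then show ?thesis using True v by (auto simp: Lp_space_def)
  next
    case False
    define q where "q = enn2real p"
    have q: "1 \<le> q" using p False enn2real_mono[of 1 p] by (auto simp: q_def less_top)
    have "integrable M (\<lambda>t. norm (v t) powr q)"
    proof (rule Bochner_Integration.integrable_bound)
      show "integrable M (\<lambda>t. (2 * c') powr q * (1 + norm (u t) powr q))"
        using u False by (simp add: Lp_space_def q_def)
      show "AE t in M. norm (norm (v t) powr q) \<le> norm ((2 * c') powr q * (1 + norm (u t) powr q))"
      proof (intro AE_I2)
        fix t assume t: "t \<in> space M"
        have "norm (v t) powr q \<le> (2 * c' * max 1 (norm (u t))) powr q"
        proof (intro powr_mono2 order_trans[OF c'(2)[OF t]])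
          have "c' * (1 + norm (u t)) \<le> c' * (2 * max 1 (norm (u t)))"
            using c'[OF t] by (intro mult_left_mono) auto
          then show "c' * (1 + norm (u t)) \<le> 2 * c' * max 1 (norm (u t))" by simp
        qed (use q in auto)
        also have "\<dots> = (2 * c') powr q * max 1 (norm (u t)) powr q"
          using c'[OF t] by (simp add: powr_mult)
        also have "\<dots> \<le> (2 * c') powr q * (1 + norm (u t) powr q)"
          by (intro mult_left_mono) (auto simp: max_def)
        finally show "norm (norm (v t) powr q) \<le> norm ((2 * c') powr q * (1 + norm (u t) powr q))"
          by simp
      qed
    qed measurable
    then show ?thesis using False v by (auto simp: Lp_space_def q_def)
  qed
qed

text \<open>For finite \<open>q \<ge> 1\<close> it comes from \<open>x \<le> 1 + x powr q\<close>;
  constants are integrable on a finite measure space.\<close>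

lemma Lp_space_integrable:
  fixes u :: "'t \<Rightarrow> 'b::{banach, second_countable_topology}"
  assumes "finite_measure M" and p: "1 \<le> p" and u: "u \<in> Lp_space p M"
  shows "integrable M u"
proof -
  interpret finite_measure M by fact
  have [measurable]: "u \<in> borel_measurable M" using u by (simp add: Lp_space_def)
  show ?thesis
  proof (cases "p = \<infinity>")
    case True
    then obtain C where "AE t in M. norm (u t) \<le> C" using u by (auto simp: Lp_space_def)
    then show ?thesis by (intro integrable_const_bound) auto
  next
    case False
    define q where "q = enn2real p"
    have q: "1 \<le> q" using p False enn2real_mono[of 1 p] by (auto simp: q_def less_top)
    show ?thesis
    proof (rule Bochner_Integration.integrable_bound)
      show "integrable M (\<lambda>t. 1 + norm (u t) powr q)"
        using u False by (simp add: Lp_space_def q_def)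
      have "x \<le> 1 + x powr q" if "0 \<le> x" for x :: real
        using that q powr_mono[of 1 q x] by (cases "x \<le> 1") (auto intro: add_increasing2)
      then show "AE t in M. norm (u t) \<le> norm (1 + norm (u t) powr q)" by (intro AE_I2) simp
    qed measurable
  qed
qed

lemma FTC_open_interval:
  fixes \<psi> \<psi>' :: "real \<Rightarrow> complex"
  assumes "a \<le> b" "\<And>t. t \<in> {a..b} \<Longrightarrow> (\<psi> has_vector_derivative \<psi>' t) (at t within {a..b})"
    and \<psi>': "continuous_on {a..b} \<psi>'"
  shows "integrable (lebesgue_on {a<..<b}) \<psi>'" "(LINT t|lebesgue_on {a<..<b}. \<psi>' t) = \<psi> b - \<psi> a"
proof -
  have "set_integrable lebesgue {a..b} \<psi>'"
    using continuous_imp_integrable[of a b \<psi>'] \<psi>'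
    by (simp add: set_integrable_def integrable_restrict_space)
  from set_integrable_subset[OF this, of "{a<..<b}"]
  show i: "integrable (lebesgue_on {a<..<b}) \<psi>'"
    by (simp add: set_integrable_def integrable_restrict_space greaterThanLessThan_subseteq_atLeastAtMost_iff)
  have "(LINT t|lebesgue_on {a<..<b}. \<psi>' t) = integral {a<..<b} \<psi>'"
    using i by (rule lebesgue_integral_eq_integral) auto
  also have "\<dots> = integral {a..b} \<psi>'"
    by (rule integral_subset_negligible)
       (auto intro: negligible_subset[of "{a, b}"])
  also have "\<dots> = \<psi> b - \<psi> a"
    by (intro integral_unique fundamental_theorem_of_calculus assms)
  finally show "(LINT t|lebesgue_on {a<..<b}. \<psi>' t) = \<psi> b - \<psi> a" .
qed

text \<open>The primitive of a merely integrable \<open>k\<close> admits no classical product rule.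
  Exchanging the order of integration over the triangle \<open>s \<le> t\<close> leaves the integral
  of \<open>\<psi>'\<close> from \<open>s\<close> to \<open>T\<close>, which is
  \<open>- \<psi> s\<close> because \<open>\<psi> T = 0\<close>.\<close>

lemma integral_by_parts_primitive:
  fixes k \<psi> \<psi>' :: "real \<Rightarrow> complex"
  assumes T: "0 < T" and k: "integrable (lebesgue_on {0<..<T}) k"
    and \<psi>: "\<And>t. t \<in> {0..T} \<Longrightarrow> (\<psi> has_vector_derivative \<psi>' t) (at t within {0..T})"
    and \<psi>': "continuous_on {0..T} \<psi>'" and "\<psi> T = 0"
  shows "(LINT t|lebesgue_on {0<..<T}. \<psi>' t * (LINT s|lebesgue_on {0<..<T}. indicator {..t} s * k s)) =
    - (LINT t|lebesgue_on {0<..<T}. \<psi> t * k t)"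
proof -
  define M where "M = lebesgue_on {0<..<T}"
  interpret M: finite_measure M unfolding M_def by (rule finite_measure_open_interval)
  interpret MM: pair_sigma_finite M M ..
  have sM: "space M = {0<..<T}" by (simp add: M_def)
  have meas: "(\<lambda>t. indicator S t *\<^sub>R \<psi>' t) \<in> borel_measurable lebesgue"
    if "S \<subseteq> {0..T}" "S \<in> sets lebesgue" for S
    using borel_measurable_restrict_space_iff[of S lebesgue \<psi>'] that
      continuous_imp_measurable_on_sets_lebesgue[OF continuous_on_subset[OF \<psi>' that(1)] that(2)] by simp
  have inner: "(LINT t|M. \<psi>' t * (indicator {..t} s * k s)) = - (\<psi> s * k s)" if s: "s \<in> space M" for s
  proof -
    have "(LINT t|M. \<psi>' t * (indicator {..t} s * k s)) = (LINT t|M. indicator {s..<T} t *\<^sub>R \<psi>' t) * k s"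
      unfolding integral_mult_left_zero[symmetric] using s
      by (intro Bochner_Integration.integral_cong) (auto simp: sM indicator_def)
    also have "(LINT t|M. indicator {s..<T} t *\<^sub>R \<psi>' t) = (LINT t|lebesgue. indicator {s..<T} t *\<^sub>R \<psi>' t)"
      using s unfolding M_def
      by (subst integral_restrict_space) (auto intro!: Bochner_Integration.integral_cong simp: indicator_def)
    also have "\<dots> = (LINT t|lebesgue. indicator {s<..<T} t *\<^sub>R \<psi>' t)"
    proof (rule integral_cong_AE)
      have "AE t in lebesgue. t \<noteq> s"
        by (intro AE_I'[of "{s}"]) auto
      then show "AE t in lebesgue. indicator {s..<T} t *\<^sub>R \<psi>' t = indicator {s<..<T} t *\<^sub>R \<psi>' t"
        by eventually_elim (auto simp: indicator_def)
    qed (use s in \<open>auto intro!: meas simp: sM\<close>)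
    also have "\<dots> = (LINT t|lebesgue_on {s<..<T}. \<psi>' t)"
      by (simp add: integral_restrict_space)
    also have "\<dots> = \<psi> T - \<psi> s"
      using s by (intro FTC_open_interval)
        (auto simp: sM intro!: has_vector_derivative_within_subset[OF \<psi>] continuous_on_subset[OF \<psi>'])
    finally show ?thesis using \<open>\<psi> T = 0\<close> by simp
  qed
  obtain B where B: "\<And>t. t \<in> {0..T} \<Longrightarrow> cmod (\<psi>' t) \<le> B"
    using compact_imp_bounded[OF compact_continuous_image[OF \<psi>']] unfolding bounded_iff by blast
  have "integrable M \<psi>'" unfolding M_def by (rule FTC_open_interval(1)[OF _ \<psi> \<psi>']) (use T in auto)
  then have [measurable]: "k \<in> borel_measurable M" "\<psi>' \<in> borel_measurable M"
    using k by (auto simp: M_def)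
  have [measurable]: "(\<lambda>x. x) \<in> M \<rightarrow>\<^sub>M borel"
    unfolding M_def by (auto intro!: measurable_restrict_space1 measurable_completion)
  \<comment> \<open>The cut-off, seen as a function of both times, is the indicator of the
    measurable triangle \<open>fst p \<le> snd p\<close>.\<close>
  have joint: "(\<lambda>(s, t). \<psi>' t * (indicator {..t} s * k s)) \<in> borel_measurable (M \<Otimes>\<^sub>M M)"
  proof -
    have "{p \<in> space (M \<Otimes>\<^sub>M M). fst p \<le> snd p} \<in> sets (M \<Otimes>\<^sub>M M)"
      using borel_measurable_le[of fst "M \<Otimes>\<^sub>M M" snd] measurable_compose[OF measurable_fst, of "\<lambda>x. x" M borel M]
        measurable_compose[OF measurable_snd, of "\<lambda>x. x" M borel M] by simp
    then have "(\<lambda>p. \<psi>' (snd p) * (indicator {p \<in> space (M \<Otimes>\<^sub>M M). fst p \<le> snd p} p * k (fst p))) \<in> borel_measurable (M \<Otimes>\<^sub>M M)"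
      by measurable
    also have "?this \<longleftrightarrow> ?thesis"
      by (intro measurable_cong) (auto simp: indicator_def)
    finally show ?thesis .
  qed
  have "integrable (M \<Otimes>\<^sub>M M) (\<lambda>(s, t). \<psi>' t * (indicator {..t} s * k s))"
  proof (rule Bochner_Integration.integrable_bound)
    show "integrable (M \<Otimes>\<^sub>M M) (\<lambda>(s, t). B * cmod (k s))"
      by (rule MM.Fubini_integrable) (use k in \<open>auto simp: M_def[symmetric] abs_mult\<close>)
    show "AE p in M \<Otimes>\<^sub>M M. norm (case p of (s, t) \<Rightarrow> \<psi>' t * (indicator {..t} s * k s)) \<le>
      norm (case p of (s, t) \<Rightarrow> B * cmod (k s))"
    proof (intro AE_I2, safe)
      fix s t assume "(s, t) \<in> space (M \<Otimes>\<^sub>M M)"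
      then have "cmod (\<psi>' t) \<le> \<bar>B\<bar>" using B[of t] by (auto simp: space_pair_measure sM)
      then have "cmod (\<psi>' t) * cmod (k s) \<le> \<bar>B\<bar> * cmod (k s)"
        by (rule mult_right_mono) simp
      then show "norm (\<psi>' t * (indicator {..t} s * k s)) \<le> norm (B * cmod (k s))"
        by (simp add: norm_mult abs_mult indicator_def)
    qed
  qed fact
  then have "(LINT t|M. LINT s|M. \<psi>' t * (indicator {..t} s * k s)) =
      (LINT s|M. LINT t|M. \<psi>' t * (indicator {..t} s * k s))"
    by (rule MM.Fubini_integral)
  also have "\<dots> = (LINT s|M. - (\<psi> s * k s))"
    by (intro Bochner_Integration.integral_cong inner refl)
  finally show ?thesis by (simp add: M_def)
qed

section \<open>Evolution generated by a multiplication operator\<close>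

lemma borel_measurable_continuous_on_interval:
  fixes f :: "real \<Rightarrow> 'b::real_normed_vector"
  assumes "continuous_on {a..b} f"
  shows "f \<in> borel_measurable (lebesgue_on {a<..<b})"
proof -
  have "continuous_on {a<..<b} f" by (rule continuous_on_subset[OF assms]) auto
  then have "(\<lambda>x. indicator {a<..<b} x *\<^sub>R f x) \<in> borel_measurable borel"
    by (rule borel_measurable_continuous_on_indicator[rotated]) simp
  then have "(\<lambda>x. indicator {a<..<b} x *\<^sub>R f x) \<in> borel_measurable lebesgue"
    by (intro measurable_completion) simp
  then show ?thesis by (simp add: borel_measurable_restrict_space_iff)
qed

text \<open>A continuous factor is bounded on the compact interval. Formulating this by norms covers
  complex products and \<open>scaleR\<close> at once.\<close>

lemma integrable_continuous_times:
  fixes v :: "real \<Rightarrow> 'b::{banach, second_countable_topology}"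
    and f :: "real \<Rightarrow> 'c::real_normed_vector" and k :: "real \<Rightarrow> 'd::{banach, second_countable_topology}"
  assumes k: "integrable (lebesgue_on {a<..<b}) k" and v: "v \<in> borel_measurable (lebesgue_on {a<..<b})"
    and f: "continuous_on {a..b} f" and le: "\<And>t. t \<in> {a<..<b} \<Longrightarrow> norm (v t) \<le> norm (f t) * norm (k t)"
  shows "integrable (lebesgue_on {a<..<b}) v"
proof -
  have "bounded (f ` {a..b})" by (intro compact_imp_bounded compact_continuous_image f) simp
  then obtain B where B: "\<And>t. t \<in> {a..b} \<Longrightarrow> norm (f t) \<le> B" unfolding bounded_iff by blast
  show ?thesis
  proof (rule Bochner_Integration.integrable_bound[OF _ v])
    show "integrable (lebesgue_on {a<..<b}) (\<lambda>t. B * norm (k t))" using k by simp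
    show "AE t in lebesgue_on {a<..<b}. norm (v t) \<le> norm (B * norm (k t))"
    proof (rule AE_I2)
      fix t assume "t \<in> space (lebesgue_on {a<..<b})"
      then have t: "t \<in> {a<..<b}" by simp
      have "norm (v t) \<le> norm (f t) * norm (k t)" by (rule le[OF t])
      also have "\<dots> \<le> B * norm (k t)" using t by (intro mult_right_mono B) auto
      also have "\<dots> \<le> norm (B * norm (k t))" by (simp only: real_norm_def abs_ge_self)
      finally show "norm (v t) \<le> norm (B * norm (k t))" .
    qed
  qed
qed

lemma integrable_continuous_on_interval:
  fixes f :: "real \<Rightarrow> 'b::{banach, second_countable_topology}"
  assumes f: "continuous_on {a..b} f"
  shows "integrable (lebesgue_on {a<..<b}) f"
proof (rule integrable_continuous_times[OF _ borel_measurable_continuous_on_interval[OF f] f])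
  interpret finite_measure "lebesgue_on {a<..<b}" by (rule finite_measure_open_interval)
  show "integrable (lebesgue_on {a<..<b}) (\<lambda>t. 1 :: real)" by simp
qed simp

text \<open>The cut-offs \<open>indicator {..X n}\<close> converge at every
  \<open>s \<noteq> t\<close>, with \<open>norm (k s)\<close> as majorant. Integrating over a fixed
  interval keeps the measure independent of \<open>t\<close>.\<close>

lemma continuous_on_primitive:
  fixes k :: "real \<Rightarrow> 'b::{banach, second_countable_topology}"
  assumes k: "integrable (lebesgue_on {0<..<T}) k"
  shows "continuous_on UNIV (\<lambda>t. LINT s|lebesgue_on {0<..<T}. indicator {..t} s *\<^sub>R k s)"
  unfolding continuous_on_sequentially
proof (intro allI ballI impI, elim conjE)
  fix X :: "nat \<Rightarrow> real" and t assume X: "X \<longlonglongrightarrow> t"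
  have meas: "(\<lambda>s. indicator {..t} s *\<^sub>R k s) \<in> borel_measurable (lebesgue_on {0<..<T})" for t
  proof -
    have "indicator {..t} \<in> borel_measurable (lebesgue_on {0<..<T})"
      by (intro measurable_restrict_space1 borel_measurable_indicator) simp
    then show ?thesis using k by (intro borel_measurable_scaleR) auto
  qed
  have "(\<lambda>n. LINT s|lebesgue_on {0<..<T}. indicator {..X n} s *\<^sub>R k s) \<longlonglongrightarrow>
    (LINT s|lebesgue_on {0<..<T}. indicator {..t} s *\<^sub>R k s)"
  proof (rule integral_dominated_convergence[where w = "\<lambda>s. norm (k s)"])
    have "AE s in lebesgue. s \<noteq> t" by (intro AE_I'[of "{t}"]) auto
    then have "AE s in lebesgue_on {0<..<T}. s \<noteq> t" by (auto simp: AE_restrict_space_iff elim: eventually_mono)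
    then show "AE s in lebesgue_on {0<..<T}. (\<lambda>n. indicator {..X n} s *\<^sub>R k s) \<longlonglongrightarrow> indicator {..t} s *\<^sub>R k s"
    proof eventually_elim
      fix s assume "s \<noteq> t"
      then consider "s < t" | "t < s" by linarith
      then have "\<forall>\<^sub>F n in sequentially. indicator {..X n} s *\<^sub>R k s = indicator {..t} s *\<^sub>R k s"
      proof cases
        case 1 show ?thesis using order_tendstoD(1)[OF X 1] by eventually_elim (use 1 in \<open>auto simp: indicator_def\<close>)
      next
        case 2 show ?thesis using order_tendstoD(2)[OF X 2] by eventually_elim (use 2 in \<open>auto simp: indicator_def\<close>)
      qed
      then show "(\<lambda>n. indicator {..X n} s *\<^sub>R k s) \<longlonglongrightarrow> indicator {..t} s *\<^sub>R k s"
        by (rule tendsto_eventually)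
    qed
  qed (use k meas in \<open>auto simp: indicator_def\<close>)
  then show "((\<lambda>t. LINT s|lebesgue_on {0<..<T}. indicator {..t} s *\<^sub>R k s) \<circ> X) \<longlonglongrightarrow>
    (LINT s|lebesgue_on {0<..<T}. indicator {..t} s *\<^sub>R k s)"
    by (simp add: o_def)
qed

lemma indicator_scaleR_eq: "indicator A s *\<^sub>R z = indicator A s * z" for z :: complex
  by (simp add: indicator_def)

lemma set_integral_eq_open_interval:
  fixes k :: "real \<Rightarrow> 'b::{banach, second_countable_topology}"
  assumes k: "k \<in> borel_measurable (lebesgue_on {0<..<T})" and t: "t \<in> {0..T}"
  shows "(LINT s:{0..t}|lebesgue. k s) = (LINT s|lebesgue_on {0<..<T}. indicator {..t} s *\<^sub>R k s)"
proof -
  let ?g = "\<lambda>s. indicator {0<..<T} s *\<^sub>R (indicator {..t} s *\<^sub>R k s)"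
  have "(\<lambda>s. indicator {..t} s *\<^sub>R k s) \<in> borel_measurable (lebesgue_on {0<..<T})"
    by (intro borel_measurable_scaleR k measurable_restrict_space1 borel_measurable_indicator) simp
  then have g: "?g \<in> borel_measurable lebesgue"
    by (subst (asm) borel_measurable_restrict_space_iff) auto
  \<comment> \<open>As \<open>k\<close> is measurable only on the open interval, its values at 0 and
    \<open>T\<close> are split off; supported on single points, they are measurable whatever they
    are.\<close>
  have eq: "(\<lambda>s. indicator {0..t} s *\<^sub>R k s) =
      (\<lambda>s. ?g s + (indicator {0} s *\<^sub>R k 0 + indicator ({T} \<inter> {0<..t}) s *\<^sub>R k T))"
    using t by (auto simp: fun_eq_iff indicator_def)
  have sets: "{0::real} \<in> sets lebesgue" "{T} \<inter> {0<..t} \<in> sets lebesgue"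
    by auto
  have "(LINT s:{0..t}|lebesgue. k s) = (LINT s|lebesgue. ?g s)"
    unfolding set_lebesgue_integral_def
  proof (rule integral_cong_AE)
    show "(\<lambda>s. indicator {0..t} s *\<^sub>R k s) \<in> borel_measurable lebesgue"
      unfolding eq
      by (intro borel_measurable_add g borel_measurable_scaleR borel_measurable_const borel_measurable_indicator sets)
    have "AE s in lebesgue. s \<notin> {0, T}" by (intro AE_I'[of "{0, T}"]) auto
    then show "AE s in lebesgue. indicator {0..t} s *\<^sub>R k s = ?g s"
      by eventually_elim (use t in \<open>auto simp: indicator_def\<close>)
  qed (rule g)
  then show ?thesis by (simp add: integral_restrict_space)
qed

lemma borel_measurable_ident_lebesgue_on: "(\<lambda>t. t) \<in> lebesgue_on S \<rightarrow>\<^sub>M borel"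
  by (auto intro!: measurable_restrict_space1 measurable_completion)

text \<open>The family of scalar problems \<open>u' = lam u - src\<close> over the points
  \<open>x\<close>. The sign of \<open>Re lam\<close> makes the forward evolution contractive; the
  weight \<open>1 + (cmod (lam x))\<^sup>2\<close> in \<open>m0_int\<close> and \<open>D_int\<close>
  is that of the graph norm.\<close>

locale mult_evolution =
  fixes lam m0 :: "'a::euclidean_space \<Rightarrow> complex" and src :: "real \<Rightarrow> 'a \<Rightarrow> complex"
    and a :: "real \<Rightarrow> real" and D :: "'a \<Rightarrow> real" and T :: real
  assumes T: "0 < T"
    and lam_meas: "lam \<in> borel_measurable lebesgue" and lam: "\<And>x. Re (lam x) \<le> 0"
    and src_meas: "(\<lambda>(t, x). src t x) \<in> borel_measurable (lebesgue_on {0<..<T} \<Otimes>\<^sub>M lebesgue)"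
    and src_L2_meas: "(\<lambda>t. abs_L2 (src t)) \<in> borel_measurable (lebesgue_on {0<..<T})"
    and src_le: "\<And>t x. t \<in> {0<..<T} \<Longrightarrow> cmod (src t x) \<le> a t * D x"
    and a: "\<And>t. 0 \<le> a t" "integrable (lebesgue_on {0<..<T}) a"
    and D_nonneg: "\<And>x. 0 \<le> D x" and D_meas: "D \<in> borel_measurable lebesgue"
    and m0_meas: "m0 \<in> borel_measurable lebesgue"
    and m0_int: "integrable lebesgue (\<lambda>x. (1 + (cmod (lam x))\<^sup>2) * (cmod (m0 x))\<^sup>2)"
    and D_int: "integrable lebesgue (\<lambda>x. (1 + (cmod (lam x))\<^sup>2) * (D x)\<^sup>2)"
begin

abbreviation "I \<equiv> lebesgue_on {0<..<T}"

text \<open>Duhamel's formula with the integral from 0 to \<open>t\<close> written as a cut-off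
  integral over the fixed interval, so that \<open>t\<close> and \<open>x\<close> enter only as
  parameters of the integrand.\<close>

definition sol :: "real \<Rightarrow> 'a \<Rightarrow> complex" where
  "sol t x = exp (lam x * of_real t) * m0 x -
     (LINT s|I. indicator {..t} s * (exp (lam x * of_real (t - s)) * src s x))"

definition weight :: "'a \<Rightarrow> real" where "weight x = sqrt (1 + (cmod (lam x))\<^sup>2)"

text \<open>One majorant for all purposes: the integral of \<open>a\<close> serves the weighted
  solution, and the extra 1 makes \<open>bound\<close> dominate \<open>D\<close>, hence the source,
  even if that integral is zero.\<close>

definition bound :: "'a \<Rightarrow> real" where "bound x = weight x * (cmod (m0 x) + (1 + (LINT s|I. a s)) * D x)"

sublocale I: finite_measure I by (rule finite_measure_open_interval)

lemma weight_ge_1: "1 \<le> weight x"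
  by (simp add: weight_def)

lemma cmod_lam_le: "cmod (lam x) \<le> weight x"
  by (simp add: weight_def real_le_rsqrt)

lemma weight_meas[measurable]: "weight \<in> borel_measurable lebesgue"
  unfolding weight_def using lam_meas by measurable

lemma bound_meas: "bound \<in> borel_measurable lebesgue"
  unfolding bound_def using m0_meas D_meas by measurable

lemma int_a_nonneg: "0 \<le> (LINT s|I. a s)"
  using a by (intro Bochner_Integration.integral_nonneg) auto

lemma bound_nonneg: "0 \<le> bound x"
  unfolding bound_def using weight_ge_1[of x] D_nonneg[of x] int_a_nonneg by simp

lemma bound_int: "integrable lebesgue (\<lambda>x. (bound x)\<^sup>2)"
proof (rule Bochner_Integration.integrable_bound)
  define A where "A = 1 + (LINT s|I. a s)"
  show "integrable lebesgue (\<lambda>x. 2 * ((1 + (cmod (lam x))\<^sup>2) * (cmod (m0 x))\<^sup>2) + 2 * A\<^sup>2 * ((1 + (cmod (lam x))\<^sup>2) * (D x)\<^sup>2))"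
    by (intro Bochner_Integration.integrable_add integrable_mult_right m0_int D_int)
  show "AE x in lebesgue. norm ((bound x)\<^sup>2) \<le>
    norm (2 * ((1 + (cmod (lam x))\<^sup>2) * (cmod (m0 x))\<^sup>2) + 2 * A\<^sup>2 * ((1 + (cmod (lam x))\<^sup>2) * (D x)\<^sup>2))"
  proof (rule AE_I2)
    fix x
    have "(u + v)\<^sup>2 \<le> 2 * u\<^sup>2 + 2 * v\<^sup>2" for u v :: real
      using sum_squares_bound[of u v] by (simp add: power2_sum)
    then have "(weight x)\<^sup>2 * (cmod (m0 x) + A * D x)\<^sup>2 \<le> (weight x)\<^sup>2 * (2 * (cmod (m0 x))\<^sup>2 + 2 * (A * D x)\<^sup>2)"
      by (intro mult_left_mono) auto
    also have "\<dots> = 2 * ((1 + (cmod (lam x))\<^sup>2) * (cmod (m0 x))\<^sup>2) + 2 * A\<^sup>2 * ((1 + (cmod (lam x))\<^sup>2) * (D x)\<^sup>2)"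
      by (simp add: weight_def power_mult_distrib algebra_simps)
    finally show "norm ((bound x)\<^sup>2) \<le>
      norm (2 * ((1 + (cmod (lam x))\<^sup>2) * (cmod (m0 x))\<^sup>2) + 2 * A\<^sup>2 * ((1 + (cmod (lam x))\<^sup>2) * (D x)\<^sup>2))"
      by (simp add: bound_def power_mult_distrib flip: A_def)
  qed
  show "(\<lambda>x. (bound x)\<^sup>2) \<in> borel_measurable lebesgue" using bound_meas by measurable
qed

lemma src_meas_x: "src t \<in> borel_measurable lebesgue" if "t \<in> {0<..<T}"
  using measurable_compose[OF measurable_Pair1'[of t I] src_meas] that by simp

lemma src_meas_t: "(\<lambda>t. src t x) \<in> borel_measurable I"
  using measurable_compose[OF measurable_Pair2'[of x lebesgue I] src_meas] by simp

lemma src_int: "integrable I (\<lambda>t. src t x)"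
proof (rule Bochner_Integration.integrable_bound[OF _ src_meas_t])
  show "integrable I (\<lambda>t. a t * D x)" using a(2) by (rule integrable_mult_left)
  show "AE t in I. norm (src t x) \<le> norm (a t * D x)"
    using src_le a D_nonneg by (intro AE_I2) simp
qed

text \<open>The backward exponential may grow, but for fixed \<open>x\<close> it stays below
  \<open>exp (cmod (lam x) * T)\<close>. No uniformity in \<open>x\<close> is claimed.\<close>

lemma exp_src_int: "integrable I (\<lambda>s. exp (- lam x * of_real s) * src s x)"
proof (rule Bochner_Integration.integrable_bound)
  show "integrable I (\<lambda>s. exp (cmod (lam x) * T) * src s x)"
    by (intro integrable_mult_right src_int)
  have [measurable]: "(\<lambda>t. src t x) \<in> borel_measurable I" "(\<lambda>t. t) \<in> I \<rightarrow>\<^sub>M borel"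
    by (rule src_meas_t borel_measurable_ident_lebesgue_on)+
  show "(\<lambda>s. exp (- lam x * of_real s) * src s x) \<in> borel_measurable I"
    by measurable
  show "AE s in I. norm (exp (- lam x * of_real s) * src s x) \<le> norm (exp (cmod (lam x) * T) * src s x)"
  proof (rule AE_I2)
    fix s assume "s \<in> space I"
    then have "- Re (lam x) * s \<le> cmod (lam x) * T"
      using abs_Re_le_cmod[of "lam x"] by (intro mult_mono) auto
    then show "norm (exp (- lam x * of_real s) * src s x) \<le> norm (exp (cmod (lam x) * T) * src s x)"
      unfolding norm_mult by (intro mult_right_mono) (auto simp: norm_exp_eq_Re)
  qed
qed

text \<open>After \<open>exp (lam x * t)\<close> is pulled out, \<open>t\<close> occurs in the
  integral only through the cut-off, so the bracket is a constant minus a primitive.\<close>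

lemma sol_alt: "sol t x = exp (lam x * of_real t) *
  (m0 x - (LINT s|I. indicator {..t} s * (exp (- lam x * of_real s) * src s x)))"
proof -
  have "(LINT s|I. indicator {..t} s * (exp (lam x * of_real (t - s)) * src s x)) =
    (LINT s|I. exp (lam x * of_real t) * (indicator {..t} s * (exp (- lam x * of_real s) * src s x)))"
    by (intro Bochner_Integration.integral_cong) (auto simp: algebra_simps exp_diff exp_minus divide_inverse)
  also have "\<dots> = exp (lam x * of_real t) * (LINT s|I. indicator {..t} s * (exp (- lam x * of_real s) * src s x))"
    by (rule integral_mult_right_zero)
  finally show ?thesis unfolding sol_def right_diff_distrib by simp
qed

lemma sol_continuous: "continuous_on S (\<lambda>t. sol t x)"
proof -
  have "continuous_on UNIV (\<lambda>t. LINT s|I. indicator {..t} s * (exp (- lam x * of_real s) * src s x))"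
    using continuous_on_primitive[OF exp_src_int] by (simp add: indicator_scaleR_eq)
  then have "continuous_on UNIV (\<lambda>t. sol t x)" unfolding sol_alt
    by (intro continuous_on_mult continuous_on_exp continuous_on_diff continuous_on_const continuous_on_of_real continuous_on_id)
  then show ?thesis by (rule continuous_on_subset) simp
qed

text \<open>On \<open>s \<le> t\<close> the propagator \<open>exp (lam x * (t - s))\<close> has
  modulus at most 1, since \<open>Re (lam x) \<le> 0\<close>. Hence a bound free of
  \<open>lam\<close>, which leaves the whole weight available for the graph norm.\<close>

lemma sol_le:
  assumes "0 \<le> t"
  shows "cmod (sol t x) \<le> cmod (m0 x) + (LINT s|I. a s) * D x"
proof -
  have e: "cmod (exp (lam x * of_real r)) \<le> 1" if "0 \<le> r" for r
    using lam[of x] that by (simp add: norm_exp_eq_Re mult_nonpos_nonneg)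
  have "cmod (LINT s|I. indicator {..t} s * (exp (lam x * of_real (t - s)) * src s x)) \<le> (LINT s|I. a s * D x)"
  proof (rule order_trans[OF integral_norm_bound integral_mono_AE'])
    show "integrable I (\<lambda>s. a s * D x)" using a(2) by (rule integrable_mult_left)
    show "AE s in I. cmod (indicator {..t} s * (exp (lam x * of_real (t - s)) * src s x)) \<le> a s * D x"
    proof (rule AE_I2)
      fix s assume "s \<in> space I"
      then have "cmod (src s x) \<le> a s * D x" by (intro src_le) simp
      moreover have "cmod (exp (lam x * of_real (t - s)) * src s x) \<le> cmod (src s x)" if "s \<le> t"
        using e[of "t - s"] that by (simp add: norm_mult mult_left_le_one_le)
      ultimately show "cmod (indicator {..t} s * (exp (lam x * of_real (t - s)) * src s x)) \<le> a s * D x"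
        using a(1)[of s] D_nonneg[of x] by (cases "s \<le> t") (auto simp: indicator_def)
    qed
  qed (use a D_nonneg in auto)
  moreover have "cmod (exp (lam x * of_real t) * m0 x) \<le> cmod (m0 x)"
    using e[OF assms] by (simp add: norm_mult mult_left_le_one_le)
  ultimately show ?thesis
    unfolding sol_def by (intro order_trans[OF norm_triangle_ineq4]) simp
qed

text \<open>With \<open>\<tau>\<close> constant this gives measurability in \<open>x\<close>, with
  the two projections joint measurability; both are instances of the measurability of an integral
  depending on a parameter.\<close>

lemma sol_meas_compose:
  assumes \<tau>: "\<tau> \<in> borel_measurable N" and \<xi>: "\<xi> \<in> N \<rightarrow>\<^sub>M lebesgue"
  shows "(\<lambda>p. sol (\<tau> p) (\<xi> p)) \<in> borel_measurable N"
proof -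
  have [measurable]: "(\<lambda>p. lam (\<xi> p)) \<in> borel_measurable N" "(\<lambda>p. m0 (\<xi> p)) \<in> borel_measurable N"
    using measurable_compose[OF \<xi> lam_meas] measurable_compose[OF \<xi> m0_meas] .
  note \<tau>[measurable]
  have [measurable]: "(\<lambda>q. src (snd q) (\<xi> (fst q))) \<in> borel_measurable (N \<Otimes>\<^sub>M I)"
    using measurable_compose[OF measurable_Pair[OF measurable_snd measurable_compose[OF measurable_fst \<xi>]] src_meas]
    by simp
  have [measurable]: "snd \<in> borel_measurable (N \<Otimes>\<^sub>M I)"
    by (rule measurable_compose[OF measurable_snd borel_measurable_ident_lebesgue_on])
  have "(\<lambda>q. if snd q \<le> \<tau> (fst q) then exp (- lam (\<xi> (fst q)) * of_real (snd q)) * src (snd q) (\<xi> (fst q)) else 0)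
      \<in> borel_measurable (N \<Otimes>\<^sub>M I)"
    by measurable
  also have "(\<lambda>q. if snd q \<le> \<tau> (fst q) then exp (- lam (\<xi> (fst q)) * of_real (snd q)) * src (snd q) (\<xi> (fst q)) else 0) =
      (\<lambda>(p, s). indicator {..\<tau> p} s * (exp (- lam (\<xi> p) * of_real s) * src s (\<xi> p)))"
    by (auto simp: fun_eq_iff indicator_def)
  finally have "(\<lambda>p. LINT s|I. indicator {..\<tau> p} s * (exp (- lam (\<xi> p) * of_real s) * src s (\<xi> p))) \<in> borel_measurable N"
    by (rule I.borel_measurable_lebesgue_integral)
  then show ?thesis unfolding sol_alt by measurable
qed

lemma sol_meas: "sol t \<in> borel_measurable lebesgue"
  by (rule sol_meas_compose) auto

lemma sol_joint_meas: "(\<lambda>(t, x). sol t x) \<in> borel_measurable (I \<Otimes>\<^sub>M lebesgue)"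
  unfolding split_beta by (intro sol_meas_compose measurable_snd measurable_compose[OF measurable_fst borel_measurable_ident_lebesgue_on])

lemma weighted_sol_le:
  assumes "0 \<le> t" shows "weight x * cmod (sol t x) \<le> bound x"
  unfolding bound_def using sol_le[OF assms, of x] D_nonneg[of x] weight_ge_1[of x]
  by (intro mult_left_mono) (auto simp: algebra_simps)

lemma dominated_by_weight:
  assumes "0 \<le> t" "cmod c \<le> weight x" shows "cmod (c * sol t x) \<le> bound x"
  using weighted_sol_le[OF assms(1), of x] mult_right_mono[OF assms(2) norm_ge_zero[of "sol t x"]]
  by (simp add: norm_mult)

lemma sol_sq:
  assumes "0 \<le> t" "c \<in> borel_measurable lebesgue" "\<And>x. cmod (c x) \<le> weight x"
  shows "square_integrable (\<lambda>x. c x * sol t x)"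
  using assms sol_meas[of t]
  by (intro square_integrable_dominated[OF _ dominated_by_weight bound_int]) auto

text \<open>The multiplier \<open>c\<close> is taken to be 1, \<open>lam\<close> or the square root
  of the graph norm weight: continuity of the solution, of its image under the operator, and in the
  graph norm.\<close>

lemma sol_L2_continuous:
  assumes "c \<in> borel_measurable lebesgue" "\<And>x. cmod (c x) \<le> weight x"
  shows "continuous_on {0..T} (\<lambda>t. abs_L2 (\<lambda>x. c x * sol t x))"
  using assms sol_meas
  by (intro continuous_on_abs_L2[OF _ dominated_by_weight bound_int] continuous_intros sol_continuous) auto

lemma weighted_src_le: "t \<in> {0<..<T} \<Longrightarrow> cmod (src t x) \<le> a t * bound x"
proof (rule order_trans[OF src_le mult_left_mono])
  have "1 * D x \<le> weight x * ((LINT s|I. a s) * D x + D x)"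
    using weight_ge_1[of x] D_nonneg[of x] int_a_nonneg by (intro mult_mono) auto
  also have "\<dots> \<le> bound x"
    unfolding bound_def using weight_ge_1[of x] by (intro mult_left_mono) (auto simp: algebra_simps)
  finally show "D x \<le> bound x" by simp
qed (use a in auto)

lemma src_sq: "t \<in> {0<..<T} \<Longrightarrow> square_integrable (src t)"
  using bound_int
  by (intro square_integrable_dominated[OF src_meas_x weighted_src_le]) (auto simp: power_mult_distrib)

lemma src_L2_int: "integrable I (\<lambda>t. abs_L2 (src t))"
  by (rule integrable_abs_L2[OF _ src_L2_meas weighted_src_le a bound_int]) (auto intro: src_meas_x)

text \<open>With \<open>\<psi> t = \<phi> t * exp (lam x * t)\<close> the integrand becomes
  \<open>\<psi>' t * (m0 x - K t) - \<psi> t * k t\<close>. The term with \<open>m0 x\<close>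
  vanishes because \<open>\<psi>\<close> is zero at both ends, and the other two cancel by
  \<open>integral_by_parts_primitive\<close>.\<close>

lemma sol_scalar_weak:
  assumes \<phi>: "\<phi> \<in> test_functions T"
  shows "(LINT t|I. deriv \<phi> t * sol t x + \<phi> t * (lam x * sol t x - src t x)) = 0"
proof -
  have s: "smooth \<phi>" using test_functions_smooth[OF \<phi>] .
  define k where "k s = exp (- lam x * of_real s) * src s x" for s :: real
  define K where "K t = (LINT s|I. indicator {..t} s * k s)" for t
  define \<psi> where "\<psi> t = \<phi> t * exp (lam x * of_real t)" for t
  define \<psi>' where "\<psi>' t = (deriv \<phi> t + \<phi> t * lam x) * exp (lam x * of_real t)" for t
  have k: "integrable I k" unfolding k_def by (rule exp_src_int)
  have K: "continuous_on {0..T} K"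
    using continuous_on_subset[OF continuous_on_primitive[OF k], of "{0..T}"]
    by (simp add: K_def indicator_scaleR_eq)
  have D\<psi>: "(\<psi> has_vector_derivative \<psi>' t) (at t within {0..T})" for t
  proof -
    have "((\<lambda>t. complex_of_real (\<phi> t)) has_vector_derivative of_real (deriv \<phi> t)) (at t)"
      using smooth_DERIV[OF s] by (rule has_vector_derivative_of_real)
    moreover have "((\<lambda>t. exp (lam x * of_real t)) has_vector_derivative lam x * exp (lam x * of_real t)) (at t)"
      by (rule has_vector_derivative_real_field) (auto intro!: derivative_eq_intros)
    ultimately have "(\<psi> has_vector_derivative \<psi>' t) (at t)"
      unfolding \<psi>_def \<psi>'_def
      by (auto intro!: has_vector_derivative_eq_rhs[OF has_vector_derivative_mult] simp: algebra_simps)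
    then show ?thesis by (rule has_vector_derivative_at_within)
  qed
  have c: "continuous_on {0..T} \<phi>" "continuous_on {0..T} (deriv \<phi>)"
    using s by (auto intro: continuous_on_smooth smooth_deriv)
  have c\<psi>: "continuous_on {0..T} \<psi>" "continuous_on {0..T} \<psi>'"
    unfolding \<psi>_def \<psi>'_def by (intro continuous_intros c)+
  have \<psi>0: "\<psi> 0 = 0" "\<psi> T = 0"
    using test_functions_boundary[OF \<phi> T] by (auto simp: \<psi>_def)
  have i1: "integrable I (\<lambda>t. \<psi>' t * (m0 x - K t))" and i2: "integrable I (\<lambda>t. \<psi>' t * K t)"
    and i3: "integrable I \<psi>'"
    using integrable_continuous_on_interval[OF continuous_on_mult[OF c\<psi>(2) continuous_on_diff[OF continuous_on_const K]]]
      integrable_continuous_on_interval[OF continuous_on_mult[OF c\<psi>(2) K]]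
      integrable_continuous_on_interval[OF c\<psi>(2)] by simp_all
  have i4: "integrable I (\<lambda>t. \<psi> t * k t)"
    using borel_measurable_continuous_on_interval[OF c\<psi>(1)] k
    by (intro integrable_continuous_times[OF k _ c\<psi>(1)]) (auto simp: norm_mult)
  have "(LINT t|I. deriv \<phi> t * sol t x + \<phi> t * (lam x * sol t x - src t x)) =
    (LINT t|I. \<psi>' t * (m0 x - K t) - \<psi> t * k t)"
  proof (intro Bochner_Integration.integral_cong refl)
    fix t
    have "exp (lam x * of_real t) * exp (- lam x * of_real t) = 1"
      by (simp flip: exp_add)
    then have "\<psi> t * k t = \<phi> t * src t x"
      by (simp add: \<psi>_def k_def)
    moreover have "\<psi>' t * (m0 x - K t) = (deriv \<phi> t + \<phi> t * lam x) * sol t x"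
      by (simp add: \<psi>'_def sol_alt K_def k_def mult.assoc)
    ultimately show "deriv \<phi> t * sol t x + \<phi> t * (lam x * sol t x - src t x) = \<psi>' t * (m0 x - K t) - \<psi> t * k t"
      by (simp add: algebra_simps)
  qed
  also have "\<dots> = (LINT t|I. \<psi>' t) * m0 x - (LINT t|I. \<psi>' t * K t) - (LINT t|I. \<psi> t * k t)"
    using i1 i2 i3 i4 by (simp add: right_diff_distrib)
  also have "(LINT t|I. \<psi>' t) = 0"
    using FTC_open_interval(2)[OF _ D\<psi> c\<psi>(2)] T \<psi>0 by simp
  also have "(LINT t|I. \<psi>' t * K t) = - (LINT t|I. \<psi> t * k t)"
    unfolding K_def by (rule integral_by_parts_primitive[OF T k D\<psi> c\<psi>(2) \<psi>0(2)])
  finally show ?thesis by simp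
qed

text \<open>The scalar identity holds for every \<open>x\<close>, so
  \<open>integral_abs_L2_eq_0\<close> applies to the single combination \<open>F\<close>; its
  Bochner integral is then split into the two sides of the claim.\<close>

lemma sol_weak:
  assumes \<phi>: "\<phi> \<in> test_functions T"
  shows "(LINT t|I. deriv \<phi> t *\<^sub>R abs_L2 (sol t)) =
    - (LINT t|I. \<phi> t *\<^sub>R (abs_L2 (\<lambda>x. lam x * sol t x) - abs_L2 (src t)))"
proof -
  have s: "smooth \<phi>" using test_functions_smooth[OF \<phi>] .
  have c: "continuous_on {0..T} \<phi>" "continuous_on {0..T} (deriv \<phi>)"
    using s by (auto intro: continuous_on_smooth smooth_deriv)
  have cs: "continuous_on {0..T} (\<lambda>t. abs_L2 (sol t))"
    using sol_L2_continuous[of "\<lambda>x. 1"] weight_ge_1 by simp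
  have cl: "continuous_on {0..T} (\<lambda>t. abs_L2 (\<lambda>x. lam x * sol t x))"
    using sol_L2_continuous[OF lam_meas cmod_lam_le] .
  have i1: "integrable I (\<lambda>t. deriv \<phi> t *\<^sub>R abs_L2 (sol t))"
    by (rule integrable_continuous_on_interval[OF continuous_on_scaleR[OF c(2) cs]])
  have i2: "integrable I (\<lambda>t. \<phi> t *\<^sub>R (abs_L2 (\<lambda>x. lam x * sol t x) - abs_L2 (src t)))"
  proof (rule integrable_continuous_times[OF _ _ c(1)])
    show i: "integrable I (\<lambda>t. abs_L2 (\<lambda>x. lam x * sol t x) - abs_L2 (src t))"
      by (rule Bochner_Integration.integrable_diff[OF integrable_continuous_on_interval[OF cl] src_L2_int])
    show "(\<lambda>t. \<phi> t *\<^sub>R (abs_L2 (\<lambda>x. lam x * sol t x) - abs_L2 (src t))) \<in> borel_measurable I"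
      by (rule borel_measurable_scaleR[OF borel_measurable_continuous_on_interval[OF c(1)] borel_measurable_integrable[OF i]])
  qed simp
  define F where "F t x = deriv \<phi> t * sol t x + \<phi> t * (lam x * sol t x - src t x)" for t x
  have abs_F: "abs_L2 (F t) = deriv \<phi> t *\<^sub>R abs_L2 (sol t) + \<phi> t *\<^sub>R (abs_L2 (\<lambda>x. lam x * sol t x) - abs_L2 (src t))"
    if t: "t \<in> space I" for t
  proof -
    have 1: "square_integrable (sol t)" "square_integrable (\<lambda>x. lam x * sol t x)" "square_integrable (src t)"
      using sol_sq[of t "\<lambda>x. 1"] sol_sq[of t lam] lam_meas cmod_lam_le weight_ge_1 src_sq t by auto
    then show ?thesis unfolding F_def
      by (simp add: abs_L2_add abs_L2_diff scaleR_L2.abs_eq square_integrable_diff square_integrable_cmult)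
  qed
  have "bounded (\<phi> ` {0..T})" "bounded (deriv \<phi> ` {0..T})"
    by (intro compact_imp_bounded compact_continuous_image c; simp)+
  then obtain B1 B2 where B12: "\<And>t. t \<in> {0..T} \<Longrightarrow> \<bar>\<phi> t\<bar> \<le> B1" "\<And>t. t \<in> {0..T} \<Longrightarrow> \<bar>deriv \<phi> t\<bar> \<le> B2"
    unfolding bounded_iff real_norm_def by blast
  have B0: "0 \<le> B1" "0 \<le> B2" using B12[of 0] T by (auto intro: order_trans[OF abs_ge_zero])
  have "(LINT t|I. abs_L2 (F t)) = 0"
  proof (rule integral_abs_L2_eq_0)
    show "sigma_finite_measure I" ..
    have [measurable]: "(\<lambda>(t, x). sol t x) \<in> borel_measurable (I \<Otimes>\<^sub>M lebesgue)"
      "(\<lambda>(t, x). src t x) \<in> borel_measurable (I \<Otimes>\<^sub>M lebesgue)" "\<phi> \<in> borel_measurable I"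
      "deriv \<phi> \<in> borel_measurable I" "lam \<in> borel_measurable lebesgue"
      by (rule sol_joint_meas src_meas borel_measurable_continuous_on_interval c lam_meas)+
    show "(\<lambda>(t, x). F t x) \<in> borel_measurable (I \<Otimes>\<^sub>M lebesgue)"
      unfolding F_def by measurable
    show "(\<lambda>t. abs_L2 (F t)) \<in> borel_measurable I"
      using i1 i2 by (subst measurable_cong[OF abs_F]) auto
    \<comment> \<open>\<open>B2\<close> accounts for \<open>deriv \<phi> t * sol t x\<close>, and
      \<open>B1 * (1 + a t)\<close> for \<open>\<phi> t\<close> times \<open>lam x * sol t x\<close>
      and the source.\<close>
    show "integrable I (\<lambda>t. B2 + B1 * (1 + a t))" using a(2) by simp
    show "0 \<le> B2 + B1 * (1 + a t)" for t using B0 a(1)[of t] by simp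
    show "cmod (F t x) \<le> (B2 + B1 * (1 + a t)) * bound x" if "t \<in> space I" for t x
    proof -
      have t: "t \<in> {0<..<T}" "t \<in> {0..T}" using that by auto
      have "cmod (F t x) \<le> \<bar>deriv \<phi> t\<bar> * cmod (sol t x) + \<bar>\<phi> t\<bar> * (cmod (lam x * sol t x) + cmod (src t x))"
        unfolding F_def
        by (intro order_trans[OF norm_triangle_ineq] add_mono)
          (auto simp: norm_mult intro!: mult_left_mono norm_triangle_ineq4[THEN order_trans])
      also have "\<dots> \<le> B2 * bound x + B1 * (bound x + a t * bound x)"
        using t B0 B12 dominated_by_weight[of t 1 x] dominated_by_weight[of t "lam x" x] weight_ge_1 cmod_lam_le weighted_src_le
        by (intro add_mono mult_mono) auto
      finally show ?thesis by (simp add: algebra_simps)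
    qed
    show "(LINT t|I. F t x) = 0" for x
      unfolding F_def by (rule sol_scalar_weak[OF \<phi>])
  qed (rule bound_meas bound_nonneg bound_int)+
  also have "(LINT t|I. abs_L2 (F t)) = (LINT t|I. deriv \<phi> t *\<^sub>R abs_L2 (sol t)) +
      (LINT t|I. \<phi> t *\<^sub>R (abs_L2 (\<lambda>x. lam x * sol t x) - abs_L2 (src t)))"
    using i1 i2 by (subst Bochner_Integration.integral_cong[OF refl abs_F]) auto
  finally show ?thesis by (simp add: add_eq_0_iff2)
qed

end

section \<open>The two-layer problem\<close>

text \<open>The quadratic Taylor term of \<open>exp \<bar>x\<bar>\<close> is at most
  \<open>2 * cosh x\<close>.\<close>

lemma square_le_cosh: "x\<^sup>2 \<le> 4 * cosh x" for x :: real
proof -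
  have "\<bar>x\<bar>\<^sup>2 / 2 \<le> exp \<bar>x\<bar>"
    using exp_lower_Taylor_quadratic[of "\<bar>x\<bar>"] by simp
  also have "exp \<bar>x\<bar> \<le> 2 * cosh x"
    by (simp add: cosh_field_def abs_if)
  finally show ?thesis by simp
qed

lemma square_le_cosh_square: "x\<^sup>2 \<le> 4 * (cosh x)\<^sup>2" for x :: real
proof -
  have "cosh x * 1 \<le> cosh x * cosh x" by (intro mult_left_mono cosh_real_ge_1) simp
  then show ?thesis using square_le_cosh[of x] unfolding power2_eq_square by linarith
qed

text \<open>From \<open>x \<le> 1 + x\<^sup>2\<close> the cube is at most
  \<open>x\<^sup>2 + (x\<^sup>2)\<^sup>2\<close>, and 20 is 4 + 16 from the two quadratic
  bounds.\<close>

lemma cube_le_cosh_square: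
  fixes x :: real
  assumes "0 \<le> x"
  shows "x ^ 3 \<le> 20 * (cosh x)\<^sup>2"
proof -
  have "x * x\<^sup>2 \<le> (1 + x\<^sup>2) * x\<^sup>2"
    using sum_squares_bound[of x 1] assms by (intro mult_right_mono) (auto simp: power2_eq_square intro: order_trans[rotated])
  also have "\<dots> = x\<^sup>2 + (x\<^sup>2)\<^sup>2" by (simp add: algebra_simps power2_eq_square)
  also have "(x\<^sup>2)\<^sup>2 \<le> (4 * cosh x)\<^sup>2" by (intro power_mono square_le_cosh) simp
  finally show ?thesis using square_le_cosh_square[of x] by (simp add: power3_eq_cube power2_eq_square)
qed

lemma abs_L2_sum:
  assumes "finite S" "\<And>j. j \<in> S \<Longrightarrow> square_integrable (f j)"
  shows "square_integrable (\<lambda>x. \<Sum>j\<in>S. f j x) \<and> abs_L2 (\<lambda>x. \<Sum>j\<in>S. f j x) = (\<Sum>j\<in>S. abs_L2 (f j))"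
  using assms
proof (induction S rule: finite_induct)
  case empty then show ?case by (simp add: square_integrable_zero zero_L2_def)
next
  case (insert j S) then show ?case by (simp add: square_integrable_add abs_L2_add[symmetric])
qed

lemma coth_ge_1: "0 < x \<Longrightarrow> 1 \<le> coth x"
  by (simp add: coth_def sinh_le_cosh_real)

locale two_layer =
  fixes \<rho>1 \<rho>2 h1 h2 g \<epsilon> T :: real and p :: ennreal
    and f :: "(real ^ 'd) L2" and U :: "real \<Rightarrow> real ^ 'd"
  assumes \<rho>1: "0 < \<rho>1" and \<rho>2: "\<rho>1 < \<rho>2" and h: "0 < h1" "0 < h2" and g: "0 < g"
    and \<epsilon>: "0 \<le> \<epsilon>" and T: "0 < T" and p: "1 \<le> p"
    and U: "U \<in> Lp_space p (lebesgue_on {0<..<T})"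
begin

abbreviation "om \<equiv> omega \<rho>1 \<rho>2 h1 h2 g :: real ^ 'd \<Rightarrow> real"
abbreviation "domA \<equiv> A_dom \<rho>1 \<rho>2 h1 h2 g \<epsilon> :: (real ^ 'd) L2 set"
abbreviation "opA \<equiv> A_op \<rho>1 \<rho>2 h1 h2 g \<epsilon> :: (real ^ 'd) L2 \<Rightarrow> (real ^ 'd) L2"
abbreviation "normA \<equiv> A_norm \<rho>1 \<rho>2 h1 h2 g \<epsilon> :: (real ^ 'd) L2 \<Rightarrow> real"
abbreviation "src \<equiv> source \<rho>1 \<rho>2 h1 h2 f U"
abbreviation "I \<equiv> lebesgue_on {0<..<T}"

definition lam :: "real ^ 'd \<Rightarrow> complex" where
  "lam \<kappa> = \<i> * omega_eps \<rho>1 \<rho>2 h1 h2 g \<epsilon> \<kappa>"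

text \<open>Multiplication by \<open>wt\<close> turns the graph norm into the plain norm. It is
  complex-valued so that it can serve as a multiplier like \<open>lam\<close>.\<close>

definition wt :: "real ^ 'd \<Rightarrow> complex" where
  "wt \<kappa> = of_real (sqrt (1 + (cmod (lam \<kappa>))\<^sup>2))"

definition den :: "real ^ 'd \<Rightarrow> real" where
  "den \<kappa> = sinh (2 * pi * norm \<kappa> * h1) * (T_coeff \<rho>1 h1 \<kappa> + T_coeff \<rho>2 h2 \<kappa>)"

definition src_bound :: "real ^ 'd \<Rightarrow> real" where
  "src_bound \<kappa> = 2 * pi * \<rho>1 * norm \<kappa> * cmod (rep_L2 (fourier_L2 f) \<kappa>) / \<bar>den \<kappa>\<bar>"

section \<open>The symbol of the operator and the decay of the source in the wave vector\<close>

lemma cmod_lam: "(cmod (lam \<kappa>))\<^sup>2 = (om \<kappa>)\<^sup>2 + \<epsilon>\<^sup>2"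
  by (simp add: lam_def omega_eps_def norm_mult cmod_power2)

lemma Re_lam: "Re (lam \<kappa>) = - \<epsilon>"
  by (simp add: lam_def omega_eps_def)

lemma cmod_wt: "cmod (wt \<kappa>) = sqrt (1 + (cmod (lam \<kappa>))\<^sup>2)"
  by (simp add: wt_def)

lemma T_coeff_ge:
  assumes "0 < \<rho>" "0 < hh" "\<kappa> \<noteq> (0 :: real ^ 'd)"
  shows "\<rho> \<le> T_coeff \<rho> hh \<kappa>"
  using coth_ge_1[of "2 * pi * norm \<kappa> * hh"] assms by (simp add: T_coeff_def)

text \<open>The factor \<open>sinh\<close> cancels the denominator of \<open>coth\<close> in the
  first layer exactly, leaving \<open>cosh\<close>; the second layer only adds a nonnegative
  term.\<close>

lemma den_ge:
  assumes "\<kappa> \<noteq> 0"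
  shows "\<rho>1 * cosh (2 * pi * norm \<kappa> * h1) \<le> den \<kappa>"
proof -
  have "\<rho>1 * cosh (2 * pi * norm \<kappa> * h1) = sinh (2 * pi * norm \<kappa> * h1) * T_coeff \<rho>1 h1 \<kappa>"
    using assms h by (simp add: T_coeff_def coth_def)
  also have "\<dots> \<le> den \<kappa>"
    unfolding den_def using assms h \<rho>1 \<rho>2 T_coeff_ge[of \<rho>2 h2 \<kappa>] by (intro mult_left_mono) auto
  finally show ?thesis .
qed

text \<open>As \<open>coth \<ge> 1\<close> on positive arguments, the denominator under the root is
  at least \<open>\<rho>1\<close>; at \<open>\<kappa> = 0\<close> both sides vanish.\<close>

lemma om_sq_le: "(om \<kappa>)\<^sup>2 \<le> 2 * pi * norm \<kappa> * (\<rho>2 - \<rho>1) * g / \<rho>1"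
proof (cases "\<kappa> = 0")
  case False
  have "\<rho>1 \<le> T_coeff \<rho>1 h1 \<kappa> + T_coeff \<rho>2 h2 \<kappa>"
    using T_coeff_ge[of \<rho>1 h1 \<kappa>] T_coeff_ge[of \<rho>2 h2 \<kappa>] False \<rho>1 \<rho>2 h by simp
  moreover have "0 \<le> 2 * pi * norm \<kappa> * (\<rho>2 - \<rho>1) * g" using \<rho>2 g by simp
  ultimately show ?thesis
    using \<rho>1 unfolding omega_def by (simp add: divide_left_mono)
qed (simp add: omega_def)

text \<open>The squared source contributes \<open>r\<^sup>2 / (cosh (b * r))\<^sup>2\<close> with
  \<open>r = norm \<kappa>\<close>, and the weight at most one further power of \<open>r\<close>. So
  only the quotients of \<open>r\<^sup>2\<close> and \<open>r ^ 3\<close> by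
  \<open>(cosh (b * r))\<^sup>2\<close> have to be bounded.\<close>

lemma weighted_src_bound_le:
  obtains C where "\<And>\<kappa>. (1 + (cmod (lam \<kappa>))\<^sup>2) * (src_bound \<kappa>)\<^sup>2 \<le> C * (cmod (rep_L2 (fourier_L2 f) \<kappa>))\<^sup>2" 
proof -
  define b where "b = 2 * pi * h1"
  define c where "c = 2 * pi * (\<rho>2 - \<rho>1) * g / \<rho>1"
  have b: "0 < b" using h by (simp add: b_def)
  have c: "0 \<le> c" using \<rho>1 \<rho>2 g by (simp add: c_def)
  \<comment> \<open>The fractions are the constants 4 and 20 of the hyperbolic inequalities after
    rescaling their argument to \<open>b * r\<close>.\<close>
  define C where "C = (2 * pi)\<^sup>2 * ((1 + \<epsilon>\<^sup>2) * 4 / b\<^sup>2 + c * 20 / b ^ 3)"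
  have "(1 + (cmod (lam \<kappa>))\<^sup>2) * (src_bound \<kappa>)\<^sup>2 \<le> C * (cmod (rep_L2 (fourier_L2 f) \<kappa>))\<^sup>2" for \<kappa>
  proof (cases "\<kappa> = 0")
    case True then show ?thesis using b c by (simp add: src_bound_def C_def)
  next
    case False
    define r where "r = norm \<kappa>"
    define F where "F = cmod (rep_L2 (fourier_L2 f) \<kappa>)"
    have r: "0 < r" using False by (simp add: r_def)
    define ch where "ch = (cosh (b * r))\<^sup>2"
    have ch: "0 < ch" by (simp add: ch_def)
    have r2: "r\<^sup>2 \<le> 4 / b\<^sup>2 * ch" and r3: "r ^ 3 \<le> 20 / b ^ 3 * ch"
      using square_le_cosh_square[of "b * r"] cube_le_cosh_square[of "b * r"] b r
      by (auto simp: ch_def field_simps power_mult_distrib)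
    have den: "\<rho>1 * cosh (b * r) \<le> \<bar>den \<kappa>\<bar>"
      using den_ge[OF False] by (simp add: b_def r_def mult_ac)
    have pos: "0 < \<rho>1 * cosh (b * r)" using \<rho>1 by simp
    have "src_bound \<kappa> \<le> 2 * pi * \<rho>1 * r * F / (\<rho>1 * cosh (b * r))"
      unfolding src_bound_def r_def[symmetric] F_def[symmetric]
    proof (rule divide_left_mono[OF den])
      show "0 \<le> 2 * pi * \<rho>1 * r * F" using \<rho>1 r by (simp add: F_def)
      show "0 < \<bar>den \<kappa>\<bar> * (\<rho>1 * cosh (b * r))" using den pos by (intro mult_pos_pos[OF _ pos]) linarith
    qed
    also have "\<dots> = 2 * pi * r * F / cosh (b * r)" using \<rho>1 by simp
    finally have "(src_bound \<kappa>)\<^sup>2 \<le> (2 * pi * r * F / cosh (b * r))\<^sup>2"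
      using \<rho>1 by (intro power_mono) (auto simp: src_bound_def)
    also have "\<dots> = (2 * pi)\<^sup>2 * F\<^sup>2 * (r\<^sup>2 / ch)"
      by (simp add: ch_def power_mult_distrib power_divide)
    finally have 1: "(src_bound \<kappa>)\<^sup>2 \<le> (2 * pi)\<^sup>2 * F\<^sup>2 * (r\<^sup>2 / ch)" .
    have 2: "1 + (cmod (lam \<kappa>))\<^sup>2 \<le> (1 + \<epsilon>\<^sup>2) + c * r"
      using om_sq_le[of \<kappa>] by (simp add: cmod_lam c_def r_def mult_ac)
    have "(1 + (cmod (lam \<kappa>))\<^sup>2) * (src_bound \<kappa>)\<^sup>2 \<le> ((1 + \<epsilon>\<^sup>2) + c * r) * ((2 * pi)\<^sup>2 * F\<^sup>2 * (r\<^sup>2 / ch))"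
      using 1 2 c r by (intro mult_mono) auto
    also have "\<dots> = (2 * pi)\<^sup>2 * F\<^sup>2 * (((1 + \<epsilon>\<^sup>2) * r\<^sup>2 + c * r ^ 3) / ch)"
      by (simp add: power2_eq_square power3_eq_cube field_simps)
    also have "\<dots> \<le> (2 * pi)\<^sup>2 * F\<^sup>2 * (((1 + \<epsilon>\<^sup>2) * (4 / b\<^sup>2 * ch) + c * (20 / b ^ 3 * ch)) / ch)"
      using c ch by (intro mult_left_mono divide_right_mono add_mono r2 r3) auto
    also have "((1 + \<epsilon>\<^sup>2) * (4 / b\<^sup>2 * ch) + c * (20 / b ^ 3 * ch)) / ch = (1 + \<epsilon>\<^sup>2) * 4 / b\<^sup>2 + c * 20 / b ^ 3"
      using ch by (simp add: add_divide_distrib)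
    finally show ?thesis by (simp add: C_def F_def mult_ac)
  qed
  then show ?thesis using that by blast
qed

section \<open>Measurability and integrability of the symbol and the source\<close>

lemma cosh_sinh_meas[measurable]: "cosh \<in> borel_measurable (borel :: real measure)" "sinh \<in> borel_measurable (borel :: real measure)"
  by (intro borel_measurable_continuous_onI continuous_intros)+

lemma T_coeff_meas[measurable]: "T_coeff \<rho> hh \<in> borel_measurable (borel :: (real ^ 'd) measure)"
  unfolding T_coeff_def coth_def by measurable

lemma lam_meas[measurable]: "lam \<in> borel_measurable borel"
  unfolding lam_def omega_eps_def omega_def by measurable

lemma lam_meas_leb: "lam \<in> borel_measurable lebesgue"
  by (intro measurable_completion) measurable

lemma wt_meas: "wt \<in> borel_measurable lebesgue"
  unfolding wt_def by (intro measurable_completion) measurable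

lemma den_meas[measurable]: "den \<in> borel_measurable borel"
  unfolding den_def by measurable

lemma fourier_meas: "rep_L2 (fourier_L2 f) \<in> borel_measurable lebesgue"
  by (rule square_integrable_measurable[OF square_integrable_rep_L2])

lemma src_bound_meas: "src_bound \<in> borel_measurable lebesgue"
proof -
  have [measurable]: "den \<in> borel_measurable lebesgue" "(\<lambda>x. x) \<in> (lebesgue :: (real^'d) measure) \<rightarrow>\<^sub>M borel"
    by (intro measurable_completion; simp)+
  note fourier_meas[measurable]
  show ?thesis unfolding src_bound_def by measurable
qed

lemma src_bound_int: "integrable lebesgue (\<lambda>\<kappa>. (1 + (cmod (lam \<kappa>))\<^sup>2) * (src_bound \<kappa>)\<^sup>2)"
proof -
  obtain C where C: "\<And>\<kappa>. (1 + (cmod (lam \<kappa>))\<^sup>2) * (src_bound \<kappa>)\<^sup>2 \<le> C * (cmod (rep_L2 (fourier_L2 f) \<kappa>))\<^sup>2"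
    using weighted_src_bound_le by blast
  show ?thesis
  proof (rule Bochner_Integration.integrable_bound)
    show "integrable lebesgue (\<lambda>\<kappa>. C * (cmod (rep_L2 (fourier_L2 f) \<kappa>))\<^sup>2)"
      using square_integrable_rep_L2[of "fourier_L2 f"] by (simp add: square_integrable_def)
    show "(\<lambda>\<kappa>. (1 + (cmod (lam \<kappa>))\<^sup>2) * (src_bound \<kappa>)\<^sup>2) \<in> borel_measurable lebesgue"
      using lam_meas_leb src_bound_meas by measurable
  qed (use C in \<open>auto intro!: AE_I2 intro: order_trans[OF _ abs_ge_self]\<close>)
qed

lemma src_bound_nonneg: "0 \<le> src_bound \<kappa>"
  using \<rho>1 by (simp add: src_bound_def)

lemma src_bound_sq_int: "integrable lebesgue (\<lambda>\<kappa>. (src_bound \<kappa>)\<^sup>2)"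
  by (rule Bochner_Integration.integrable_bound[OF src_bound_int])
    (use src_bound_meas in \<open>auto simp: distrib_right intro!: AE_I2\<close>)

lemma src_le: "cmod (src t \<kappa>) \<le> norm (U t) * src_bound \<kappa>"
proof -
  have "cmod (src t \<kappa>) = 2 * pi * \<rho>1 * \<bar>\<kappa> \<bullet> U t\<bar> * cmod (rep_L2 (fourier_L2 f) \<kappa>) / \<bar>den \<kappa>\<bar>"
    using \<rho>1 unfolding source_def den_def[symmetric]
    by (simp add: norm_mult norm_divide norm_exp_eq_Re)
  also have "\<dots> \<le> 2 * pi * \<rho>1 * (norm \<kappa> * norm (U t)) * cmod (rep_L2 (fourier_L2 f) \<kappa>) / \<bar>den \<kappa>\<bar>"
    using \<rho>1 by (intro divide_right_mono mult_right_mono mult_left_mono Cauchy_Schwarz_ineq2) auto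
  finally show ?thesis by (simp add: src_bound_def mult_ac)
qed

lemma U_int: "integrable I U"
  by (rule Lp_space_integrable[OF finite_measure_open_interval p U])

lemma U_meas: "U \<in> borel_measurable I"
  using U by (simp add: Lp_space_def)

lemma ship_position_continuous: "continuous_on {0..T} (ship_position U)"
proof -
  have "continuous_on {0..T} (\<lambda>t. LINT s|I. indicator {..t} s *\<^sub>R U s)"
    by (rule continuous_on_subset[OF continuous_on_primitive[OF U_int]]) simp
  then show ?thesis
    by (rule continuous_on_eq) (simp add: ship_position_def set_integral_eq_open_interval[OF U_meas])
qed

lemma ship_position_meas: "ship_position U \<in> borel_measurable I"
  by (rule borel_measurable_continuous_on_interval[OF ship_position_continuous])

lemma src_meas: "(\<lambda>(t, \<kappa>). src t \<kappa>) \<in> borel_measurable (I \<Otimes>\<^sub>M lebesgue)"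
proof -
  have [measurable]: "den \<in> borel_measurable lebesgue" "(\<lambda>x. x) \<in> (lebesgue :: (real^'d) measure) \<rightarrow>\<^sub>M borel"
    by (intro measurable_completion; simp)+
  note fourier_meas[measurable] U_meas[measurable] ship_position_meas[measurable]
  have [measurable]: "snd \<in> borel_measurable (I \<Otimes>\<^sub>M (lebesgue :: (real^'d) measure))"
    by (rule measurable_compose[OF measurable_snd]) measurable
  show ?thesis unfolding source_def den_def[symmetric] split_beta by measurable
qed

text \<open>The source is linear in \<open>U t\<close>. Replacing \<open>U t\<close> in
  \<open>\<kappa> \<bullet> U t\<close> by a basis vector \<open>b\<close> gives
  \<open>E b t\<close>, which depends on time only through the continuous ship position and so is
  continuous into \<open>L\<^sup>2\<close>. The source is then a finite sum of such curves with
  measurable real coefficients.\<close>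

lemma src_L2_meas: "(\<lambda>t. abs_L2 (src t)) \<in> borel_measurable I"
proof -
  define E where "E b t \<kappa> = 2 * of_real pi * of_real \<rho>1 * \<i> * of_real (\<kappa> \<bullet> b) *
       exp (- 2 * of_real pi * \<i> * of_real (\<kappa> \<bullet> ship_position U t)) * rep_L2 (fourier_L2 f) \<kappa> /
     of_real (den \<kappa>)" for b t \<kappa>
  have [measurable]: "den \<in> borel_measurable lebesgue" "(\<lambda>x. x) \<in> (lebesgue :: (real^'d) measure) \<rightarrow>\<^sub>M borel"
    by (intro measurable_completion; simp)+
  note fourier_meas[measurable]
  have E_meas: "E b t \<in> borel_measurable lebesgue" for b t
    unfolding E_def by measurable
  have E_le: "cmod (E b t \<kappa>) \<le> src_bound \<kappa>" if "b \<in> Basis" for b t \<kappa>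
  proof -
    have "cmod (E b t \<kappa>) = 2 * pi * \<rho>1 * \<bar>\<kappa> \<bullet> b\<bar> * cmod (rep_L2 (fourier_L2 f) \<kappa>) / \<bar>den \<kappa>\<bar>"
      using \<rho>1 unfolding E_def by (simp add: norm_mult norm_divide norm_exp_eq_Re)
    also have "\<dots> \<le> src_bound \<kappa>"
      unfolding src_bound_def
      using \<rho>1 that by (intro divide_right_mono mult_right_mono mult_left_mono Basis_le_norm) auto
    finally show ?thesis .
  qed
  have E_sq: "square_integrable (E b t)" if "b \<in> Basis" for b t
    by (rule square_integrable_dominated[OF E_meas E_le[OF that] src_bound_sq_int])
  have "continuous_on {0..T} (\<lambda>t. abs_L2 (E b t))" if "b \<in> Basis" for b
    by (rule continuous_on_abs_L2[OF E_meas E_le[OF that] src_bound_sq_int])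
      (unfold E_def divide_inverse, intro continuous_intros ship_position_continuous)
  then have [measurable]: "(\<lambda>t. abs_L2 (E b t)) \<in> borel_measurable I" if "b \<in> Basis" for b
    using that by (intro borel_measurable_continuous_on_interval)
  have "src t = (\<lambda>\<kappa>. \<Sum>b\<in>Basis. of_real (U t \<bullet> b) * E b t \<kappa>)" for t
  proof
    fix \<kappa>
    show "src t \<kappa> = (\<Sum>b\<in>Basis. of_real (U t \<bullet> b) * E b t \<kappa>)"
      unfolding source_def den_def[symmetric] E_def euclidean_inner[of \<kappa> "U t"]
      by (simp add: sum_distrib_left sum_distrib_right sum_divide_distrib mult_ac)
  qed
  then have "abs_L2 (src t) = (\<Sum>b\<in>Basis. (U t \<bullet> b) *\<^sub>R abs_L2 (E b t))" for t
    using E_sq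
    by (simp add: abs_L2_sum square_integrable_cmult scaleR_L2.abs_eq)
  moreover have "(\<lambda>t. \<Sum>b\<in>Basis. (U t \<bullet> b) *\<^sub>R abs_L2 (E b t)) \<in> borel_measurable I"
    using U_meas by measurable
  ultimately show ?thesis by simp
qed

end

section \<open>The operator, its domain and its graph norm on representatives\<close>

lemma square_integrable_cong_AE:
  assumes "f \<in> borel_measurable lebesgue" "AE x in lebesgue. f x = g x" "square_integrable g"
  shows "square_integrable f"
  unfolding square_integrable_def
proof
  have "integrable lebesgue (\<lambda>x. (cmod (f x))\<^sup>2) = integrable lebesgue (\<lambda>x. (cmod (g x))\<^sup>2)"
  proof (rule integrable_cong_AE)
    show "AE x in lebesgue. (cmod (f x))\<^sup>2 = (cmod (g x))\<^sup>2" using assms(2) by eventually_elim simp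
  qed (use assms in \<open>auto simp: square_integrable_def\<close>)
  then show "integrable lebesgue (\<lambda>x. (cmod (f x))\<^sup>2)" using assms(3) by (simp add: square_integrable_def)
qed fact

text \<open>Domain, norm and operator are defined through the arbitrary representative
  \<open>rep_L2\<close>; this allows computing with any convenient one, such as the explicit Duhamel
  function.\<close>

lemma abs_L2_mult_rep:
  assumes "square_integrable u" "c \<in> borel_measurable lebesgue" "square_integrable (\<lambda>x. c x * u x)"
  shows "square_integrable (\<lambda>x. c x * rep_L2 (abs_L2 u) x)"
    "abs_L2 (\<lambda>x. c x * rep_L2 (abs_L2 u) x) = abs_L2 (\<lambda>x. c x * u x)"
proof -
  have ae: "AE x in lebesgue. c x * rep_L2 (abs_L2 u) x = c x * u x"
    using rep_abs_L2[OF assms(1)] by eventually_elim simp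
  show sq: "square_integrable (\<lambda>x. c x * rep_L2 (abs_L2 u) x)"
    by (intro square_integrable_cong_AE[OF _ ae assms(3)] borel_measurable_times assms(2)
        square_integrable_measurable square_integrable_rep_L2)
  show "abs_L2 (\<lambda>x. c x * rep_L2 (abs_L2 u) x) = abs_L2 (\<lambda>x. c x * u x)"
    using abs_L2_eq_iff[OF sq assms(3)] ae by simp
qed

lemma norm_abs_L2_mono:
  assumes "square_integrable u" "square_integrable v" "\<And>x. cmod (u x) \<le> cmod (v x)"
  shows "norm (abs_L2 u) \<le> norm (abs_L2 v)"
proof -
  have "(norm (abs_L2 u))\<^sup>2 \<le> (norm (abs_L2 v))\<^sup>2"
    unfolding norm_abs_L2[OF assms(1)] norm_abs_L2[OF assms(2)]
    by (intro integral_mono power_mono assms) (use assms in \<open>auto simp: square_integrable_def\<close>)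
  then show ?thesis by (rule power2_le_imp_le) simp
qed

context two_layer
begin

lemma cmod_lam_le_wt: "cmod (lam \<kappa>) \<le> cmod (wt \<kappa>)"
  by (simp add: cmod_wt real_le_rsqrt)

lemma one_le_wt: "1 \<le> cmod (wt \<kappa>)"
  by (simp add: cmod_wt)

lemma A_dom_iff: "b \<in> domA \<longleftrightarrow> square_integrable (\<lambda>\<kappa>. lam \<kappa> * rep_L2 b \<kappa>)"
proof -
  have meas: "(\<lambda>\<kappa>. lam \<kappa> * rep_L2 b \<kappa>) \<in> borel_measurable lebesgue"
    by (intro borel_measurable_times lam_meas_leb square_integrable_measurable square_integrable_rep_L2)
  have "b \<in> domA \<longleftrightarrow> (\<integral>\<^sup>+\<kappa>. ennreal ((cmod (lam \<kappa> * rep_L2 b \<kappa>))\<^sup>2) \<partial>lebesgue) < \<infinity>"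
    by (simp add: A_dom_def norm_mult power_mult_distrib cmod_lam)
  also have "\<dots> \<longleftrightarrow> square_integrable (\<lambda>\<kappa>. lam \<kappa> * rep_L2 b \<kappa>)"
  proof
    assume "square_integrable (\<lambda>\<kappa>. lam \<kappa> * rep_L2 b \<kappa>)"
    then show "(\<integral>\<^sup>+\<kappa>. ennreal ((cmod (lam \<kappa> * rep_L2 b \<kappa>))\<^sup>2) \<partial>lebesgue) < \<infinity>"
      by (simp only: nn_integral_norm_L2 infinity_ennreal_def ennreal_less_top)
  qed (rule square_integrable_nn[OF meas])
  finally show ?thesis .
qed

lemma mult_square_integrable:
  assumes "square_integrable u" "square_integrable (\<lambda>\<kappa>. lam \<kappa> * u \<kappa>)"
    and "c \<in> borel_measurable lebesgue" "\<And>\<kappa>. cmod (c \<kappa>) \<le> cmod (wt \<kappa>)"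
  shows "square_integrable (\<lambda>\<kappa>. c \<kappa> * u \<kappa>)"
proof (rule square_integrable_bound)
  show "(\<lambda>\<kappa>. c \<kappa> * u \<kappa>) \<in> borel_measurable lebesgue"
    by (intro borel_measurable_times assms(3) square_integrable_measurable assms(1))
  show "integrable lebesgue (\<lambda>\<kappa>. (cmod (u \<kappa>))\<^sup>2 + (cmod (lam \<kappa> * u \<kappa>))\<^sup>2)"
    using assms by (simp add: square_integrable_def)
  fix \<kappa>
  have "(cmod (c \<kappa>))\<^sup>2 \<le> (cmod (wt \<kappa>))\<^sup>2" by (intro power_mono assms) simp
  also have "\<dots> = 1 + (cmod (lam \<kappa>))\<^sup>2" by (simp add: cmod_wt)
  finally have "(cmod (c \<kappa>))\<^sup>2 * (cmod (u \<kappa>))\<^sup>2 \<le> (1 + (cmod (lam \<kappa>))\<^sup>2) * (cmod (u \<kappa>))\<^sup>2"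
    by (rule mult_right_mono) simp
  then show "(cmod (c \<kappa> * u \<kappa>))\<^sup>2 \<le> (cmod (u \<kappa>))\<^sup>2 + (cmod (lam \<kappa> * u \<kappa>))\<^sup>2"
    by (simp add: norm_mult power_mult_distrib algebra_simps)
qed

context
  fixes u assumes u: "square_integrable u" "square_integrable (\<lambda>\<kappa>. lam \<kappa> * u \<kappa>)"
begin

lemma abs_in_A_dom: "abs_L2 u \<in> domA"
  unfolding A_dom_iff by (rule abs_L2_mult_rep[OF u(1) lam_meas_leb u(2)])

lemma A_op_abs: "opA (abs_L2 u) = abs_L2 (\<lambda>\<kappa>. lam \<kappa> * u \<kappa>)"
  using abs_L2_mult_rep(2)[OF u(1) lam_meas_leb u(2)] by (simp add: A_op_def lam_def)

lemma wt_square_integrable: "square_integrable (\<lambda>\<kappa>. wt \<kappa> * u \<kappa>)"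
  by (rule mult_square_integrable[OF u wt_meas]) simp

lemma A_norm_abs: "normA (abs_L2 u) = norm (abs_L2 (\<lambda>\<kappa>. wt \<kappa> * u \<kappa>))"
proof -
  have "(norm (abs_L2 (\<lambda>\<kappa>. wt \<kappa> * u \<kappa>)))\<^sup>2 = (norm (abs_L2 (\<lambda>\<kappa>. wt \<kappa> * rep_L2 (abs_L2 u) \<kappa>)))\<^sup>2"
    by (simp add: abs_L2_mult_rep(2)[OF u(1) wt_meas wt_square_integrable])
  also have "\<dots> = (LINT \<kappa>|lebesgue. (cmod (wt \<kappa> * rep_L2 (abs_L2 u) \<kappa>))\<^sup>2)"
    by (rule norm_abs_L2[OF abs_L2_mult_rep(1)[OF u(1) wt_meas wt_square_integrable]])
  also have "\<dots> = (LINT \<kappa>|lebesgue. (1 + (om \<kappa>)\<^sup>2 + \<epsilon>\<^sup>2) * (cmod (rep_L2 (abs_L2 u) \<kappa>))\<^sup>2)"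
    by (simp add: norm_mult power_mult_distrib cmod_wt cmod_lam add.assoc)
  finally show ?thesis unfolding A_norm_def by (metis norm_ge_zero real_sqrt_unique)
qed

lemma norm_A_op_le: "norm (abs_L2 (\<lambda>\<kappa>. lam \<kappa> * u \<kappa>)) \<le> normA (abs_L2 u)"
  unfolding A_norm_abs
  by (rule norm_abs_L2_mono[OF u(2) wt_square_integrable]) (simp add: norm_mult mult_right_mono cmod_lam_le_wt)

lemma norm_le_A_norm: "norm (abs_L2 u) \<le> normA (abs_L2 u)"
  unfolding A_norm_abs
  by (rule norm_abs_L2_mono[OF u(1) wt_square_integrable])
     (use mult_right_mono[OF one_le_wt norm_ge_zero] in \<open>simp add: norm_mult\<close>)

lemma A_dissipative: "inner (abs_L2 (\<lambda>\<kappa>. lam \<kappa> * u \<kappa>)) (abs_L2 u) \<le> 0"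
proof -
  have "inner (abs_L2 (\<lambda>\<kappa>. lam \<kappa> * u \<kappa>)) (abs_L2 u) = (LINT \<kappa>|lebesgue. Re (lam \<kappa> * u \<kappa> * cnj (u \<kappa>)))"
    using u by (simp add: inner_L2.abs_eq)
  also have "\<dots> = (LINT \<kappa>|lebesgue. - \<epsilon> * (cmod (u \<kappa>))\<^sup>2)"
  proof (intro Bochner_Integration.integral_cong refl)
    fix \<kappa>
    have "lam \<kappa> * u \<kappa> * cnj (u \<kappa>) = lam \<kappa> * of_real ((cmod (u \<kappa>))\<^sup>2)"
      by (simp only: mult.assoc complex_norm_square)
    then show "Re (lam \<kappa> * u \<kappa> * cnj (u \<kappa>)) = - \<epsilon> * (cmod (u \<kappa>))\<^sup>2"
      by (simp only: Re_complex_of_real Re_lam times_complex.sel Im_complex_of_real mult_zero_right diff_zero)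
  qed
  also have "\<dots> \<le> 0"
    using \<epsilon> by (simp add: integral_nonneg_AE)
  finally show ?thesis .
qed

end

text \<open>A single representative \<open>u\<close> of the difference makes the norm comparisons
  and the dissipativity above applicable to a difference of two elements of the domain.\<close>

lemma A_dom_diff:
  assumes "b1 \<in> domA" "b2 \<in> domA"
  obtains u where "square_integrable u" "square_integrable (\<lambda>\<kappa>. lam \<kappa> * u \<kappa>)"
    "abs_L2 u = b1 - b2" "abs_L2 (\<lambda>\<kappa>. lam \<kappa> * u \<kappa>) = opA b1 - opA b2"
proof
  let ?u = "\<lambda>\<kappa>. rep_L2 b1 \<kappa> - rep_L2 b2 \<kappa>"
  have eq: "(\<lambda>\<kappa>. lam \<kappa> * ?u \<kappa>) = (\<lambda>\<kappa>. lam \<kappa> * rep_L2 b1 \<kappa> - lam \<kappa> * rep_L2 b2 \<kappa>)"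
    by (simp add: right_diff_distrib)
  show "square_integrable ?u" by (intro square_integrable_diff square_integrable_rep_L2)
  show "square_integrable (\<lambda>\<kappa>. lam \<kappa> * ?u \<kappa>)"
    unfolding eq using assms by (intro square_integrable_diff) (auto simp: A_dom_iff)
  show "abs_L2 ?u = b1 - b2"
    by (simp add: square_integrable_rep_L2 flip: abs_L2_diff)
  show "abs_L2 (\<lambda>\<kappa>. lam \<kappa> * ?u \<kappa>) = opA b1 - opA b2"
    unfolding eq using assms by (simp add: A_dom_iff A_op_def lam_def[symmetric] flip: abs_L2_diff)
qed

text \<open>The graph norm of a difference dominates both its plain norm and the plain norm of its
  image under the operator.\<close>

lemma C0_A_dom_continuous:
  assumes "\<mu> \<in> C0_A_dom \<rho>1 \<rho>2 h1 h2 g \<epsilon> T"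
  shows "continuous_on {0..T} \<mu>" "continuous_on {0..T} (\<lambda>t. opA (\<mu> t))"
proof -
  have le: "norm (\<mu> s - \<mu> t) \<le> normA (\<mu> s - \<mu> t)" "norm (opA (\<mu> s) - opA (\<mu> t)) \<le> normA (\<mu> s - \<mu> t)"
    if st: "s \<in> {0..T}" "t \<in> {0..T}" for s t
  proof -
    have "\<mu> s \<in> domA" "\<mu> t \<in> domA" using assms st by (auto simp: C0_A_dom_def)
    then obtain u where u: "square_integrable u" "square_integrable (\<lambda>\<kappa>. lam \<kappa> * u \<kappa>)"
      "abs_L2 u = \<mu> s - \<mu> t" "abs_L2 (\<lambda>\<kappa>. lam \<kappa> * u \<kappa>) = opA (\<mu> s) - opA (\<mu> t)"
      by (rule A_dom_diff)
    from norm_le_A_norm[OF u(1,2)] norm_A_op_le[OF u(1,2)]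
    show "norm (\<mu> s - \<mu> t) \<le> normA (\<mu> s - \<mu> t)" "norm (opA (\<mu> s) - opA (\<mu> t)) \<le> normA (\<mu> s - \<mu> t)"
      by (simp_all only: u(3,4))
  qed
  have lim: "((\<lambda>s. normA (\<mu> s - \<mu> t)) \<longlongrightarrow> 0) (at t within {0..T})" if "t \<in> {0..T}" for t
    using assms that by (auto simp: C0_A_dom_def)
  have ev: "eventually (\<lambda>s. s \<in> {0..T}) (at t within {0..T})" for t
    by (auto simp: eventually_at_filter)
  show "continuous_on {0..T} \<mu>"
    unfolding continuous_on_def
  proof (intro ballI)
    fix t assume t: "t \<in> {0..T}"
    have "((\<lambda>s. \<mu> s - \<mu> t) \<longlongrightarrow> 0) (at t within {0..T})"
      by (rule Lim_null_comparison[OF _ lim[OF t]]) (use ev[of t] in \<open>eventually_elim, intro le t\<close>)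
    then show "(\<mu> \<longlongrightarrow> \<mu> t) (at t within {0..T})" by (rule Lim_null[THEN iffD2])
  qed
  show "continuous_on {0..T} (\<lambda>t. opA (\<mu> t))"
    unfolding continuous_on_def
  proof (intro ballI)
    fix t assume t: "t \<in> {0..T}"
    have "((\<lambda>s. opA (\<mu> s) - opA (\<mu> t)) \<longlongrightarrow> 0) (at t within {0..T})"
      by (rule Lim_null_comparison[OF _ lim[OF t]]) (use ev[of t] in \<open>eventually_elim, intro le t\<close>)
    then show "((\<lambda>t. opA (\<mu> t)) \<longlongrightarrow> opA (\<mu> t)) (at t within {0..T})" by (rule Lim_null[THEN iffD2])
  qed
qed

section \<open>Uniqueness and existence of the solution\<close>

lemma test_function_integrable:
  fixes v :: "real \<Rightarrow> 'b::{banach, second_countable_topology}"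
  assumes "\<phi> \<in> test_functions T" "integrable I v"
  shows "integrable I (\<lambda>t. \<phi> t *\<^sub>R v t)" "integrable I (\<lambda>t. deriv \<phi> t *\<^sub>R v t)"
proof -
  have c: "continuous_on {0..T} \<phi>" "continuous_on {0..T} (deriv \<phi>)"
    using test_functions_smooth[OF assms(1)] by (auto intro: continuous_on_smooth smooth_deriv)
  have m: "v \<in> borel_measurable I" using assms(2) by simp
  show "integrable I (\<lambda>t. \<phi> t *\<^sub>R v t)"
    by (rule integrable_continuous_times[OF assms(2) borel_measurable_scaleR[OF borel_measurable_continuous_on_interval[OF c(1)] m] c(1)]) simp
  show "integrable I (\<lambda>t. deriv \<phi> t *\<^sub>R v t)"
    by (rule integrable_continuous_times[OF assms(2) borel_measurable_scaleR[OF borel_measurable_continuous_on_interval[OF c(2)] m] c(2)]) simp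
qed

text \<open>The energy \<open>\<parallel>\<mu> t - \<nu> t\<parallel>\<^sup>2\<close> of a difference of solutions is nonincreasing.\<close>

lemma solution_unique:
  assumes \<mu>: "is_solution \<rho>1 \<rho>2 h1 h2 g \<epsilon> T p f U \<mu>0 \<mu>"
    and \<nu>: "is_solution \<rho>1 \<rho>2 h1 h2 g \<epsilon> T p f U \<mu>0 \<nu>" and t: "t \<in> {0..T}"
  shows "\<nu> t = \<mu> t"
proof -
  obtain \<mu>' where \<mu>': "weak_deriv p T \<mu> \<mu>'" "AE t in I. \<mu>' t = opA (\<mu> t) - abs_L2 (src t)"
    using \<mu> by (auto simp: is_solution_def)
  obtain \<nu>' where \<nu>': "weak_deriv p T \<nu> \<nu>'" "AE t in I. \<nu>' t = opA (\<nu> t) - abs_L2 (src t)"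
    using \<nu> by (auto simp: is_solution_def)
  have C0: "\<mu> \<in> C0_A_dom \<rho>1 \<rho>2 h1 h2 g \<epsilon> T" "\<nu> \<in> C0_A_dom \<rho>1 \<rho>2 h1 h2 g \<epsilon> T" and init: "\<mu> 0 = \<nu> 0"
    using \<mu> \<nu> by (auto simp: is_solution_def)
  note cont = C0_A_dom_continuous[OF C0(1)] C0_A_dom_continuous[OF C0(2)]
  define w where "w t = \<mu> t - \<nu> t" for t
  define v where "v t = opA (\<mu> t) - opA (\<nu> t)" for t
  have w: "continuous_on {0..T} w" and v: "continuous_on {0..T} v"
    unfolding w_def v_def by (rule continuous_on_diff cont)+
  note int_w = integrable_continuous_on_interval[OF w] and int_v = integrable_continuous_on_interval[OF v]
  note int = integrable_continuous_on_interval[OF cont(1)] integrable_continuous_on_interval[OF cont(3)]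
  have int': "integrable I \<mu>'" "integrable I \<nu>'"
    using \<mu>'(1) \<nu>'(1) by (auto simp: weak_deriv_def intro: Lp_space_integrable[OF finite_measure_open_interval p])
  have dw: "(w has_vector_derivative v t) (at t within {0..T})" if "t \<in> {0..T}" for t
  proof (rule du_bois_reymond[OF T w v _ _ _ that])
    fix \<phi> assume \<phi>: "\<phi> \<in> test_functions T"
    note i = test_function_integrable[OF \<phi>]
    show "integrable I (\<lambda>t. deriv \<phi> t *\<^sub>R w t)" "integrable I (\<lambda>t. \<phi> t *\<^sub>R v t)"
      by (rule i int_w int_v)+
    have "(LINT t|I. deriv \<phi> t *\<^sub>R w t) = (LINT t|I. deriv \<phi> t *\<^sub>R \<mu> t) - (LINT t|I. deriv \<phi> t *\<^sub>R \<nu> t)"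
      unfolding w_def scaleR_diff_right by (intro Bochner_Integration.integral_diff i int)
    also have "\<dots> = - ((LINT t|I. \<phi> t *\<^sub>R \<mu>' t) - (LINT t|I. \<phi> t *\<^sub>R \<nu>' t))"
      using \<mu>'(1) \<nu>'(1) \<phi> by (simp add: weak_deriv_def)
    also have "(LINT t|I. \<phi> t *\<^sub>R \<mu>' t) - (LINT t|I. \<phi> t *\<^sub>R \<nu>' t) = (LINT t|I. \<phi> t *\<^sub>R \<mu>' t - \<phi> t *\<^sub>R \<nu>' t)"
      by (intro Bochner_Integration.integral_diff[symmetric] i int')
    \<comment> \<open>The sources contained in \<open>\<mu>'\<close> and \<open>\<nu>'\<close>
      cancel almost everywhere; the remaining \<open>v\<close> is continuous although neither weak
      derivative has to be.\<close>
    also have "\<dots> = (LINT t|I. \<phi> t *\<^sub>R v t)"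
    proof (rule integral_cong_AE)
      show "AE t in I. \<phi> t *\<^sub>R \<mu>' t - \<phi> t *\<^sub>R \<nu>' t = \<phi> t *\<^sub>R v t"
        using \<mu>'(2) \<nu>'(2) by eventually_elim (simp add: v_def scaleR_diff_right)
    qed (intro borel_measurable_integrable Bochner_Integration.integrable_diff i int' int_v)+
    finally show "(LINT t|I. deriv \<phi> t *\<^sub>R w t) = - (LINT t|I. \<phi> t *\<^sub>R v t)" .
  qed
  have neg: "inner (v t) (w t) \<le> 0" if "t \<in> {0..T}" for t
  proof -
    have "\<mu> t \<in> domA" "\<nu> t \<in> domA" using C0 that by (auto simp: C0_A_dom_def)
    then obtain u where u: "square_integrable u" "square_integrable (\<lambda>\<kappa>. lam \<kappa> * u \<kappa>)"
      "abs_L2 u = \<mu> t - \<nu> t" "abs_L2 (\<lambda>\<kappa>. lam \<kappa> * u \<kappa>) = opA (\<mu> t) - opA (\<nu> t)"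
      by (rule A_dom_diff)
    from A_dissipative[OF u(1,2)] show ?thesis by (simp only: u(3,4) w_def v_def)
  qed
  have "((\<lambda>s. inner (w s) (v s) + inner (v s) (w s)) has_integral inner (w t) (w t) - inner (w 0) (w 0)) {0..t}"
  proof (rule fundamental_theorem_of_calculus)
    fix s assume s: "s \<in> {0..t}"
    have "(w has_vector_derivative v s) (at s within {0..t})"
      using s t by (intro has_vector_derivative_within_subset[OF dw]) auto
    from bounded_bilinear.has_vector_derivative[OF bounded_bilinear_inner this this]
    show "((\<lambda>s. inner (w s) (w s)) has_vector_derivative inner (w s) (v s) + inner (v s) (w s)) (at s within {0..t})" .
  qed (use t in simp)
  then have "inner (w t) (w t) - inner (w 0) (w 0) \<le> 0"
    by (rule has_integral_le[OF _ has_integral_0]) (use neg t in \<open>auto simp: inner_commute[of "w _"]\<close>)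
  moreover have "w 0 = 0" using init by (simp add: w_def)
  ultimately have "inner (w t) (w t) = 0" using inner_ge_zero[of "w t"] by (simp only: inner_zero_left diff_zero order.eq_iff)
  then show ?thesis by (simp add: w_def)
qed

lemma solution_exists:
  assumes \<mu>0: "\<mu>0 \<in> domA"
  shows "\<exists>\<mu>. is_solution \<rho>1 \<rho>2 h1 h2 g \<epsilon> T p f U \<mu>0 \<mu> \<and>
    (\<forall>t\<in>{0..T}. AE \<kappa> in lebesgue.
       rep_L2 (\<mu> t) \<kappa> =
         rep_L2 (\<mu> 0) \<kappa> * exp (\<i> * omega_eps \<rho>1 \<rho>2 h1 h2 g \<epsilon> \<kappa> * of_real t) -
         (LINT \<tau>:{0..t}|lebesgue.
            exp (\<i> * omega_eps \<rho>1 \<rho>2 h1 h2 g \<epsilon> \<kappa> * of_real (t - \<tau>)) * src \<tau> \<kappa>))"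
proof -
  have m0: "square_integrable (rep_L2 \<mu>0)" "square_integrable (\<lambda>\<kappa>. lam \<kappa> * rep_L2 \<mu>0 \<kappa>)"
    using \<mu>0 square_integrable_rep_L2 by (auto simp: A_dom_iff)
  \<comment> \<open>The majorants are the time and frequency factors of \<open>src_le\<close>.
    Fixing a representative of \<open>\<mu>0\<close> makes the solution an honest function of the
    wave vector.\<close>
  interpret E: mult_evolution lam "rep_L2 \<mu>0" src "\<lambda>t. norm (U t)" src_bound T
  proof
    show "integrable lebesgue (\<lambda>x. (1 + (cmod (lam x))\<^sup>2) * (cmod (rep_L2 \<mu>0 x))\<^sup>2)"
      using m0 by (simp add: square_integrable_def norm_mult power_mult_distrib distrib_right)
    show "rep_L2 \<mu>0 \<in> borel_measurable lebesgue" using m0 by (simp add: square_integrable_def)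
    show "integrable I (\<lambda>t. norm (U t))" using U_int by simp
  qed (use T \<epsilon> in \<open>auto intro: lam_meas_leb src_meas src_L2_meas src_le src_bound_nonneg src_bound_meas src_bound_int simp: Re_lam\<close>)
  have wt_eq: "cmod (wt \<kappa>) = E.weight \<kappa>" for \<kappa> by (simp add: cmod_wt E.weight_def)
  define \<mu> where "\<mu> t = abs_L2 (E.sol t)" for t
  have sq: "square_integrable (E.sol t)" "square_integrable (\<lambda>\<kappa>. lam \<kappa> * E.sol t \<kappa>)" if "0 \<le> t" for t
    using E.sol_sq[OF that, of "\<lambda>_. 1"] E.weight_ge_1 E.sol_sq[OF that lam_meas_leb E.cmod_lam_le] by auto
  have A_\<mu>: "opA (\<mu> t) = abs_L2 (\<lambda>\<kappa>. lam \<kappa> * E.sol t \<kappa>)" if "0 \<le> t" for t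
    unfolding \<mu>_def by (rule A_op_abs[OF sq[OF that]])
  have \<mu>_0: "\<mu> 0 = \<mu>0"
  proof -
    have "E.sol 0 \<kappa> = rep_L2 \<mu>0 \<kappa>" for \<kappa>
    proof -
      have "(LINT s|I. indicator {..0} s * (exp (lam \<kappa> * of_real (0 - s)) * src s \<kappa>)) = (LINT s|I. 0)"
        by (intro Bochner_Integration.integral_cong) (auto simp: indicator_def)
      then show ?thesis by (simp add: E.sol_def)
    qed
    then have "E.sol 0 = rep_L2 \<mu>0" by (rule ext)
    then show ?thesis by (simp add: \<mu>_def)
  qed
  have C0: "\<mu> \<in> C0_A_dom \<rho>1 \<rho>2 h1 h2 g \<epsilon> T"
    unfolding C0_A_dom_def
  proof (intro CollectI conjI ballI)
    fix t assume t: "t \<in> {0..T}"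
    show "\<mu> t \<in> domA" unfolding \<mu>_def using t by (intro abs_in_A_dom sq) auto
    \<comment> \<open>Reduces continuity in the graph norm to ordinary \<open>L\<^sup>2\<close>
      continuity of the weighted solution.\<close>
    have norm_eq: "normA (\<mu> s - \<mu> t) = norm (abs_L2 (\<lambda>\<kappa>. wt \<kappa> * E.sol s \<kappa>) - abs_L2 (\<lambda>\<kappa>. wt \<kappa> * E.sol t \<kappa>))"
      if s: "s \<in> {0..T}" for s
    proof -
      note sqs = sq[of s] sq[of t]
      let ?u = "\<lambda>\<kappa>. E.sol s \<kappa> - E.sol t \<kappa>"
      have u: "square_integrable ?u" "square_integrable (\<lambda>\<kappa>. lam \<kappa> * ?u \<kappa>)"
        unfolding right_diff_distrib using sqs s t by (auto intro: square_integrable_diff)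
      have "\<mu> s - \<mu> t = abs_L2 ?u" using sqs s t by (simp add: \<mu>_def abs_L2_diff)
      moreover have "square_integrable (\<lambda>\<kappa>. wt \<kappa> * E.sol s \<kappa>)" "square_integrable (\<lambda>\<kappa>. wt \<kappa> * E.sol t \<kappa>)"
        using s t by (auto intro!: wt_square_integrable sq)
      ultimately show ?thesis by (simp add: A_norm_abs[OF u] abs_L2_diff right_diff_distrib)
    qed
    have "continuous_on {0..T} (\<lambda>t. abs_L2 (\<lambda>\<kappa>. wt \<kappa> * E.sol t \<kappa>))"
      by (rule E.sol_L2_continuous[OF wt_meas]) (simp add: wt_eq)
    then have "((\<lambda>s. abs_L2 (\<lambda>\<kappa>. wt \<kappa> * E.sol s \<kappa>)) \<longlongrightarrow> abs_L2 (\<lambda>\<kappa>. wt \<kappa> * E.sol t \<kappa>)) (at t within {0..T})"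
      using t by (simp add: continuous_on_def)
    then have "((\<lambda>s. norm (abs_L2 (\<lambda>\<kappa>. wt \<kappa> * E.sol s \<kappa>) - abs_L2 (\<lambda>\<kappa>. wt \<kappa> * E.sol t \<kappa>))) \<longlongrightarrow> 0) (at t within {0..T})"
      by (intro tendsto_norm_zero) (rule Lim_null[THEN iffD1])
    then show "((\<lambda>s. normA (\<mu> s - \<mu> t)) \<longlongrightarrow> 0) (at t within {0..T})"
      by (rule Lim_transform_eventually) (auto simp: eventually_at_filter norm_eq)
  qed
  note cont = C0_A_dom_continuous[OF C0]
  have "bounded (\<mu> ` {0..T})" "bounded ((\<lambda>t. opA (\<mu> t)) ` {0..T})"
    by (intro compact_imp_bounded compact_continuous_image cont; simp)+
  then obtain B1 B2 where B: "\<And>t. t \<in> {0..T} \<Longrightarrow> norm (\<mu> t) \<le> B1" "\<And>t. t \<in> {0..T} \<Longrightarrow> norm (opA (\<mu> t)) \<le> B2"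
    unfolding bounded_iff by blast
  have B0: "0 \<le> B1" "0 \<le> B2" using B[of 0] T by (auto intro: order_trans[OF norm_ge_zero])
  define K where "K = sqrt (LINT \<kappa>|lebesgue. (src_bound \<kappa>)\<^sup>2)"
  have K: "0 \<le> K" by (simp add: K_def)
  have src_norm: "norm (abs_L2 (src t)) \<le> norm (U t) * K" if "t \<in> {0<..<T}" for t
    unfolding K_def using that by (intro norm_abs_L2_le E.src_meas_x src_le src_bound_sq_int) auto
  have "weak_deriv p T \<mu> (\<lambda>t. opA (\<mu> t) - abs_L2 (src t))"
    unfolding weak_deriv_def
  proof (intro conjI ballI)
    \<comment> \<open>Both memberships are inherited from \<open>U\<close>: the solution and its
      image under the operator are bounded in time, and the source is at most
      \<open>K * norm (U t)\<close>.\<close>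
    show "\<mu> \<in> Lp_space p I"
    proof (rule Lp_space_dominated[OF finite_measure_open_interval p U])
      show "\<mu> \<in> borel_measurable I" by (rule borel_measurable_continuous_on_interval[OF cont(1)])
      fix t assume "t \<in> space I"
      then have "norm (\<mu> t) \<le> B1 * 1" using B(1)[of t] by simp
      also have "\<dots> \<le> B1 * (1 + norm (U t))" using B0 by (intro mult_left_mono) auto
      finally show "norm (\<mu> t) \<le> B1 * (1 + norm (U t))" .
    qed
    show "(\<lambda>t. opA (\<mu> t) - abs_L2 (src t)) \<in> Lp_space p I"
    proof (rule Lp_space_dominated[OF finite_measure_open_interval p U])
      show "(\<lambda>t. opA (\<mu> t) - abs_L2 (src t)) \<in> borel_measurable I"
        by (rule borel_measurable_diff[OF borel_measurable_continuous_on_interval[OF cont(2)] src_L2_meas])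
      fix t assume "t \<in> space I"
      then have "norm (opA (\<mu> t) - abs_L2 (src t)) \<le> B2 + norm (U t) * K"
        using B(2)[of t] src_norm[of t] by (intro order_trans[OF norm_triangle_ineq4] add_mono) auto
      also have "\<dots> \<le> (B2 + K) * (1 + norm (U t))" using B0 K by (simp add: algebra_simps)
      finally show "norm (opA (\<mu> t) - abs_L2 (src t)) \<le> (B2 + K) * (1 + norm (U t))" .
    qed
    fix \<phi> assume \<phi>: "\<phi> \<in> test_functions T"
    have "(LINT t|I. deriv \<phi> t *\<^sub>R \<mu> t) =
        - (LINT t|I. \<phi> t *\<^sub>R (abs_L2 (\<lambda>\<kappa>. lam \<kappa> * E.sol t \<kappa>) - abs_L2 (src t)))"
      unfolding \<mu>_def by (rule E.sol_weak[OF \<phi>])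
    also have "(LINT t|I. \<phi> t *\<^sub>R (abs_L2 (\<lambda>\<kappa>. lam \<kappa> * E.sol t \<kappa>) - abs_L2 (src t))) =
        (LINT t|I. \<phi> t *\<^sub>R (opA (\<mu> t) - abs_L2 (src t)))"
      by (intro Bochner_Integration.integral_cong refl) (simp add: A_\<mu>)
    finally show "(LINT t|I. deriv \<phi> t *\<^sub>R \<mu> t) = - (LINT t|I. \<phi> t *\<^sub>R (opA (\<mu> t) - abs_L2 (src t)))" .
  qed
  then have "is_solution \<rho>1 \<rho>2 h1 h2 g \<epsilon> T p f U \<mu>0 \<mu>"
    unfolding is_solution_def W1p_def using C0 \<mu>_0 by blast
  moreover have "AE \<kappa> in lebesgue. rep_L2 (\<mu> t) \<kappa> =
         rep_L2 (\<mu> 0) \<kappa> * exp (\<i> * omega_eps \<rho>1 \<rho>2 h1 h2 g \<epsilon> \<kappa> * of_real t) -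
         (LINT \<tau>:{0..t}|lebesgue.
            exp (\<i> * omega_eps \<rho>1 \<rho>2 h1 h2 g \<epsilon> \<kappa> * of_real (t - \<tau>)) * src \<tau> \<kappa>)"
    if t: "t \<in> {0..T}" for t
  proof -
    have "AE \<kappa> in lebesgue. rep_L2 (\<mu> t) \<kappa> = E.sol t \<kappa>"
      unfolding \<mu>_def using t by (intro rep_abs_L2 sq) auto
    then show ?thesis
    proof eventually_elim
      fix \<kappa> assume eq: "rep_L2 (\<mu> t) \<kappa> = E.sol t \<kappa>"
      have [measurable]: "(\<lambda>s. src s \<kappa>) \<in> borel_measurable I" "(\<lambda>s. s) \<in> I \<rightarrow>\<^sub>M borel"
        by (rule E.src_meas_t borel_measurable_ident_lebesgue_on)+
      have "(\<lambda>s. exp (lam \<kappa> * of_real (t - s)) * src s \<kappa>) \<in> borel_measurable I"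
        by measurable
      \<comment> \<open>Passes from the cut-off integral over the open time interval, in which
        \<open>E.sol\<close> is written, to the integral over \<open>{0..t}\<close>.\<close>
      from set_integral_eq_open_interval[OF this t] show "rep_L2 (\<mu> t) \<kappa> =
         rep_L2 (\<mu> 0) \<kappa> * exp (\<i> * omega_eps \<rho>1 \<rho>2 h1 h2 g \<epsilon> \<kappa> * of_real t) -
         (LINT \<tau>:{0..t}|lebesgue.
            exp (\<i> * omega_eps \<rho>1 \<rho>2 h1 h2 g \<epsilon> \<kappa> * of_real (t - \<tau>)) * src \<tau> \<kappa>)"
        unfolding eq \<mu>_0 by (simp only: E.sol_def lam_def[symmetric] indicator_scaleR_eq mult.commute[of "rep_L2 \<mu>0 \<kappa>"])
    qed
  qed
  ultimately show ?thesis by blast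
qed

end

text \<open>Functions of time are total here, so uniqueness means agreement on
  \<open>{0..T}\<close>; with it, the formula for the constructed solution carries over to every
  solution.\<close>

theorem theorem9:
  fixes \<rho>1 \<rho>2 h1 h2 g \<epsilon> T :: real and p :: ennreal
    and f \<mu>0 :: "(real ^ 'd) L2" and U :: "real \<Rightarrow> real ^ 'd"
  assumes "0 < \<rho>1" "\<rho>1 < \<rho>2" "0 < h1" "0 < h2" "0 < g"
    and "CARD('d) \<in> {1, 2}" "0 \<le> \<epsilon>" "0 < T" "1 \<le> p"
    and "U \<in> Lp_space p (lebesgue_on {0<..<T})"
    and "\<mu>0 \<in> A_dom \<rho>1 \<rho>2 h1 h2 g \<epsilon>"
  shows "\<exists>\<mu>. is_solution \<rho>1 \<rho>2 h1 h2 g \<epsilon> T p f U \<mu>0 \<mu> \<and>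
    (\<forall>\<nu>. is_solution \<rho>1 \<rho>2 h1 h2 g \<epsilon> T p f U \<mu>0 \<nu> \<longrightarrow> (\<forall>t\<in>{0..T}. \<nu> t = \<mu> t)) \<and>
    (\<forall>t\<in>{0..T}. AE \<kappa> in lebesgue.
       rep_L2 (\<mu> t) \<kappa> =
         rep_L2 (\<mu> 0) \<kappa> * exp (\<i> * omega_eps \<rho>1 \<rho>2 h1 h2 g \<epsilon> \<kappa> * of_real t) -
         (LINT \<tau>:{0..t}|lebesgue.
            exp (\<i> * omega_eps \<rho>1 \<rho>2 h1 h2 g \<epsilon> \<kappa> * of_real (t - \<tau>)) *
            source \<rho>1 \<rho>2 h1 h2 f U \<tau> \<kappa>))"
proof -
  interpret two_layer \<rho>1 \<rho>2 h1 h2 g \<epsilon> T p f U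
    using assms by unfold_locales auto
  show ?thesis
    using solution_exists[OF assms(11)] solution_unique by blast
qed

end
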